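(* Let $\psi_1(\omega)=\dfrac{1-\sqrt{1-\omega}}{1+\sqrt{1-\omega}}$ and $\psi_n(\omega)=[\psi_1(\omega^n)]^{1/n}$. The composition map $\psi_{2^n}\circ\psi_{2^{n-1}}\circ\cdots\circ\psi_2\circ\psi_1(\omega)$ converges, as $n\to\infty$, to the elliptic nome function $$\psi(\omega)=e^{-\pi\,\mathbb{K}(1-\omega)/\mathbb{K}(\omega)},$$ which is the uniformization map of $\Omega(\hat{\mathbb{C}}\setminus\{(0),1,\infty\})$ onto the unit disk $\mathbb{D}$.
   Context: $\psi_1$ is the conformal map of the one-cut plane $\mathbb{C}\setminus[1,\infty)$ onto the open unit disk $\mathbb{D}$, with inverse $\phi_1(z)=4z/(1+z)^2$. The usual branches are taken in $\psi_n(\omega)=[\psi_1(\omega^n)]^{1/n}$, so that $\psi_n$ is analytic at $0$ with $\psi_n(\omega)=4^{-1/n}\omega(1+O(\omega^n))$. The indices in the composition are the powers $1,2,4,\dots,2^n$ of $2$, with $\psi_1$ applied first. $\mathbb{K}(m)=\frac{\pi}{2}\,{}_2F_1(\tfrac12,\tfrac12;1;m)$ is the complete elliptic integral of the first kind as a function of $m=k^2$. $\hat{\mathbb{C}}=\mathbb{C}\cup\{\infty\}$, and $\Omega(\hat{\mathbb{C}}\setminus\{(0),1,\infty\})$ is the Riemann surface whose points are equivalence classes of curves originating at $0$, modulo homotopies in $\hat{\mathbb{C}}\setminus\{0,1,\infty\}$ (curves start at $0$ and otherwise avoid $0,1,\infty$), together with the origin itself on the first sheet; so $0$ is a regular point on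 the first sheet and a puncture on all other sheets. *)

theory Defs
  imports "HOL-Complex_Analysis.Complex_Analysis"
begin

definition one_cut_plane :: "complex set" where
  "one_cut_plane = - (complex_of_real ` {1..})"

definition two_cut_plane :: "complex set" where
  "two_cut_plane = - (complex_of_real ` ({..0} \<union> {1..}))"


definition psi1 :: "complex \<Rightarrow> complex" where
  "psi1 w = (1 - csqrt (1 - w)) / (1 + csqrt (1 - w))"

(* The branch of [psi1 (w^n)]^(1/n) that is asymptotic to 4^(-1/n) w at 0.  It is obtained by
   factoring out w: the quotient psi1 u / u = (1 + sqrt (1 - u))^(-2) never meets the branch cut
   of the principal power for u in the one-cut plane.  The value at 0 is 0, by the factor w. *)
definition psi :: "nat \<Rightarrow> complex \<Rightarrow> complex" where
  "psi n w = w * (psi1 (w ^ n) / w ^ n) powr (1 / of_nat n)"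

primrec psi_comp :: "nat \<Rightarrow> complex \<Rightarrow> complex" where
  "psi_comp 0 = psi 1"
| "psi_comp (Suc n) = psi (2 ^ Suc n) \<circ> psi_comp n"

lemma psi_1: "psi 1 = psi1"
  by (auto simp: psi_def psi1_def fun_eq_iff)

lemma psi_power:
  assumes "n > 0"
  shows "psi n w ^ n = psi1 (w ^ n)"
proof (cases "w = 0")
  case True
  then show ?thesis using assms by (simp add: psi_def psi1_def power_0_left)
next
  case False
  define v where "v = psi1 (w ^ n) / w ^ n"
  have "(v powr (1 / of_nat n)) ^ n = v"
    using assms by (cases "v = 0") (auto simp: powr_def exp_of_nat_mult [symmetric])
  then show ?thesis
    using False unfolding psi_def v_def [symmetric] by (simp add: power_mult_distrib v_def)
qed

lemma csqrt_one_minus_pos: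
  assumes "u \<in> one_cut_plane"
  shows "0 < Re (csqrt (1 - u))"
proof -
  have "1 - u \<notin> \<real>\<^sub>\<le>\<^sub>0"
  proof
    assume "1 - u \<in> \<real>\<^sub>\<le>\<^sub>0"
    then obtain r where "r \<le> 0" "1 - u = of_real r" by (auto simp: nonpos_Reals_def)
    then have "u = of_real (1 - r)" "1 - r \<in> {1..}" by (auto simp: algebra_simps)
    with assms show False unfolding one_cut_plane_def by blast
  qed
  moreover have "z \<in> \<real>\<^sub>\<le>\<^sub>0" if "\<not> 0 < cmod z + Re z" for z
  proof -
    have eq: "cmod z = - Re z"
      using that abs_Re_le_cmod[of z] by linarith
    then have "Im z = 0"
      using cmod_power2[of z] by simp
    moreover have "Re z \<le> 0"
      using eq norm_ge_zero[of z] by linarith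
    ultimately show ?thesis by (simp add: complex_nonpos_Reals_iff)
  qed
  ultimately have "0 < cmod (1 - u) + Re (1 - u)" by blast
  then show ?thesis by simp
qed

lemma psi_eq:
  assumes "w ^ n \<in> one_cut_plane" "n > 0"
  shows "psi n w = w * (1 + csqrt (1 - w ^ n)) powr (- (2 / of_nat n))"
proof (cases "w = 0")
  case False
  define u where "u = w ^ n"
  define s where "s = 1 + csqrt (1 - u)"
  have pos: "0 < Re s"
    using csqrt_one_minus_pos[of u] assms(1) unfolding s_def u_def plus_complex.sel one_complex.sel
    by linarith
  then have s0: "s \<noteq> 0" by auto
  have u: "u \<noteq> 0" using False by (simp add: u_def)
  have "u = (1 - csqrt (1 - u)) * s"
    using power2_csqrt[of "1 - u"] by (simp add: s_def algebra_simps power2_eq_square)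
  then have "1 - csqrt (1 - u) = u / s"
    using s0 by (simp add: eq_divide_eq)
  then have "psi1 u / u = inverse (s ^ 2)"
    using u s0 by (simp add: psi1_def s_def [symmetric] divide_simps power2_eq_square)
  moreover have "Ln (inverse (s ^ 2)) = - (2 * Ln s)"
  proof -
    have "\<bar>Im (Ln s)\<bar> < pi / 2" using Re_Ln_pos_lt[OF s0] pos by simp
    then have "Ln (exp (- (2 * Ln s))) = - (2 * Ln s)"
      by (intro Ln_exp) auto
    moreover have "exp (- (2 * Ln s)) = inverse (s ^ 2)"
      using s0 by (simp add: exp_minus exp_double)
    ultimately show ?thesis by simp
  qed
  ultimately show ?thesis
    using s0 unfolding psi_def u_def [symmetric] s_def [symmetric] powr_def by simp
qed (simp add: psi_def)


(* Gauss's 2F1 on the one-cut plane, i.e. the principal branch: the analytic continuation of the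
   hypergeometric series from the unit disc.  On the cut [1, infinity) the value is unspecified. *)
definition gauss_2F1 :: "complex \<Rightarrow> complex \<Rightarrow> complex \<Rightarrow> complex \<Rightarrow> complex" where
  "gauss_2F1 a b c =
     (SOME F. F holomorphic_on one_cut_plane \<and>
              (\<forall>m\<in>ball 0 1. F m = eval_fps (fps_hypergeo [a, b] [c] 1) m))"

definition ellK :: "complex \<Rightarrow> complex" where
  "ellK m = of_real (pi / 2) * gauss_2F1 (1/2) (1/2) 1 m"

(* For w in (-infinity, 0] the argument 1 - w lies on the cut of ellK.  The nome extends
   continuously (indeed analytically) over that half-line, and its values there are the limits. *)
definition nome :: "complex \<Rightarrow> complex" where
  "nome w =
     (let q = (\<lambda>w. exp (- (of_real pi * ellK (1 - w) / ellK w)))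
      in if w \<in> two_cut_plane then q w else Lim (at w within two_cut_plane) q)"


(* Curves are parametrised by [0,1]; a curve in the sphere that avoids infinity is a curve in the
   complex plane, so the puncture at infinity needs no separate clause. *)
definition omega_admissible :: "(real \<Rightarrow> complex) \<Rightarrow> bool" where
  "omega_admissible g \<longleftrightarrow> g 0 = 0 \<and> (\<forall>t\<in>{0<..1}. g t \<notin> {0, 1})"

definition omega_curves :: "(real \<Rightarrow> complex) set" where
  "omega_curves = {g. path g \<and> omega_admissible g}"

(* Homotopy with fixed endpoints through admissible curves. *)
definition omega_class :: "(real \<Rightarrow> complex) \<Rightarrow> (real \<Rightarrow> complex) set" where
  "omega_class g =
     {h. homotopic_with_canon (\<lambda>k. omega_admissible k \<and> k 1 = g 1) {0..1} UNIV g h}"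

definition omega_origin :: "(real \<Rightarrow> complex) set" where
  "omega_origin = {\<lambda>_. 0}"

definition Omega :: "(real \<Rightarrow> complex) set set" where
  "Omega = insert omega_origin (omega_class ` omega_curves)"

definition omega_proj :: "(real \<Rightarrow> complex) set \<Rightarrow> complex" where
  "omega_proj x = (THE p. \<forall>g\<in>x. pathfinish g = p)"

(* The point of the first sheet lying over w, reached from 0 along a straight segment. *)
definition omega_first_sheet :: "complex \<Rightarrow> (real \<Rightarrow> complex) set" where
  "omega_first_sheet w = (if w = 0 then omega_origin else omega_class (linepath 0 w))"

(* The local inverse of the projection at x: continue from x along the straight segment to w. *)
definition omega_section :: "(real \<Rightarrow> complex) set \<Rightarrow> complex \<Rightarrow> (real \<Rightarrow> complex) set" where
  "omega_section x w =
     (if x = omega_origin then omega_first_sheet w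
      else (\<Union>g\<in>x. omega_class (g +++ linepath (pathfinish g) w)))"

definition omega_radius :: "(real \<Rightarrow> complex) set \<Rightarrow> real \<Rightarrow> bool" where
  "omega_radius x r \<longleftrightarrow>
     r > 0 \<and> ball (omega_proj x) r \<inter> (if x = omega_origin then {1} else {0, 1}) = {}"

definition omega_topology :: "(real \<Rightarrow> complex) set topology" where
  "omega_topology =
     topology_generated_by
       {omega_section x ` ball (omega_proj x) r | x r. x \<in> Omega \<and> omega_radius x r}"

(* The complex structure is the one that makes the local sections of the projection inverse
   charts. *)
definition omega_holomorphic :: "((real \<Rightarrow> complex) set \<Rightarrow> complex) \<Rightarrow> bool" where
  "omega_holomorphic f \<longleftrightarrow>
     (\<forall>x\<in>Omega. \<forall>r. omega_radius x r \<longrightarrow>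
        (f \<circ> omega_section x) holomorphic_on ball (omega_proj x) r)"

(* Biholomorphic maps from Omega onto the unit disc.  Since the inverse is continuous and the
   projection is a local coordinate, holomorphy of the inverse is that of its projection. *)
definition omega_uniformization :: "((real \<Rightarrow> complex) set \<Rightarrow> complex) \<Rightarrow> bool" where
  "omega_uniformization f \<longleftrightarrow>
     homeomorphic_map omega_topology (top_of_set (ball 0 1)) f \<and>
     omega_holomorphic f \<and>
     (omega_proj \<circ> inv_into Omega f) holomorphic_on ball 0 1"

end

theory Submission
  imports Defs
begin

text \<open>
  Write \<open>k\<^sub>0 = psi1 w\<close>, \<open>k\<^sub>n\<^sub>+\<^sub>1 = psi1 (k\<^sub>n\<^sup>2)\<close> for the Landen iterates of \<open>w\<close>. The \<open>n\<close>-th composition is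
  \<open>psi1 w\<close> times \<open>exp (- \<Sum>j<n. 2\<^sup>-\<^sup>j Ln (1 + sqrt (1 - k\<^sub>j\<^sup>2)))\<close>, so it converges uniformly to a holomorphic
  \<open>q\<close> with \<open>q (k\<^sub>0\<^sup>2) = (q w)\<^sup>2\<close>.

  Near \<open>0\<close> the function \<open>q\<close> has an inverse \<open>lam\<close>, and the functional equation, read backwards, extends
  \<open>lam\<close> from a disc of radius \<open>R\<close> to one of radius \<open>sqrt R\<close>, hence to the whole unit disc. To continue an
  inverse branch of \<open>lam\<close> over a disc that avoids \<open>0\<close> and \<open>1\<close>, follow the Landen iterates of the identity on
  that disc: they omit \<open>0\<close> and \<open>1\<close> and tend to \<open>0\<close> at one point, so by the theorems of Schottky, Montel
  and Hurwitz some of them are uniformly small, and there \<open>q\<close> is the required branch. Therefore \<open>lam\<close> is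
  a covering of the punctured disc onto the twice punctured plane. Curves emanating from \<open>0\<close> lift to the
  disc, and homotopy classes of such curves correspond to the end points of the lifts, because loops
  around the puncture contract when their base point is moved into it.

  On the other side, \<open>\<Prod>n. 1 + k\<^sub>n\<close> satisfies the Landen transformation \<open>F w = (1 + k\<^sub>0) F (k\<^sub>0\<^sup>2)\<close>, as does
  the hypergeometric series by its differential equation, so the two agree. For real \<open>w\<close> both
  \<open>\<pi> F (1 - w) / F w\<close> and \<open>- ln (q w)\<close> are doubled when \<open>w\<close> is replaced by \<open>k\<^sub>0\<^sup>2\<close>, and their quotient
  tends to \<open>1\<close> at \<open>0\<close> by Wallis' product; so \<open>q\<close> is the nome.
\<close>

subsection \<open>The limit of the iterated Landen maps\<close>

text \<open>The inverse of \<open>psi1\<close>: it takes a Landen modulus to the square of the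
  modulus one step higher.\<close>

definition phi1 :: "complex \<Rightarrow> complex" where
  "phi1 k = 4 * k / (1 + k)\<^sup>2"

section \<open>Topology of the one-cut plane\<close>

lemma open_one_cut_plane: "open one_cut_plane"
proof -
  have "closed (complex_of_real ` {1..})"
    by (intro closed_injective_linear_image linear_of_real) (auto simp: inj_on_def)
  then show ?thesis by (simp add: one_cut_plane_def open_closed)
qed

lemma one_cut_plane_iff: "w \<in> one_cut_plane \<longleftrightarrow> Im w \<noteq> 0 \<or> Re w < 1"
  by (auto simp: one_cut_plane_def complex_eq_iff image_iff not_le)

lemma zero_in_one_cut_plane [simp]: "0 \<in> one_cut_plane"
  by (simp add: one_cut_plane_iff)

lemma ball_subset_one_cut_plane: "ball 0 1 \<subseteq> one_cut_plane"
proof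
  fix w :: complex assume "w \<in> ball 0 1"
  then have "Re w < 1" using complex_Re_le_cmod[of w] by simp
  then show "w \<in> one_cut_plane" by (simp add: one_cut_plane_iff)
qed

lemma scale_in_one_cut_plane:
  assumes "w \<in> one_cut_plane" "0 \<le> t" "t \<le> 1"
  shows "of_real t * w \<in> one_cut_plane"
proof (cases "Im w = 0 \<or> t = 0")
  case True
  then show ?thesis
  proof
    assume "Im w = 0"
    then have "Re w < 1" using assms by (simp add: one_cut_plane_iff)
    then have "t * Re w < 1"
      using assms(2,3) by (cases "Re w \<le> 0") (smt (verit) mult_nonneg_nonpos mult_left_le_one_le)+
    then show ?thesis by (simp add: one_cut_plane_iff)
  qed simp
next
  case False
  then show ?thesis by (simp add: one_cut_plane_iff)
qed

lemma connected_one_cut_plane: "connected one_cut_plane"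
proof -
  have "starlike one_cut_plane"
    unfolding starlike_def
  proof (intro bexI ballI subsetI)
    fix w z assume "w \<in> one_cut_plane" "z \<in> closed_segment 0 w"
    then show "z \<in> one_cut_plane"
      using scale_in_one_cut_plane by (auto simp: in_segment scaleR_conv_of_real)
  qed simp
  then show ?thesis by (rule starlike_imp_connected)
qed

lemma one_minus_not_nonpos_Reals:
  "w \<in> one_cut_plane \<Longrightarrow> 1 - w \<notin> \<real>\<^sub>\<le>\<^sub>0"
  by (auto simp: one_cut_plane_iff complex_nonpos_Reals_iff)

lemma holomorphic_csqrt_one_minus [holomorphic_intros]:
  assumes "f holomorphic_on S" "\<And>z. z \<in> S \<Longrightarrow> f z \<in> one_cut_plane"
  shows "(\<lambda>z. csqrt (1 - f z)) holomorphic_on S"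
proof -
  have "(csqrt \<circ> (\<lambda>z. 1 - f z)) holomorphic_on S"
    by (rule holomorphic_on_compose_gen[where t = "- \<real>\<^sub>\<le>\<^sub>0"])
       (use one_minus_not_nonpos_Reals assms(2) in \<open>auto intro!: holomorphic_intros assms(1)\<close>)
  then show ?thesis by (simp add: o_def)
qed

lemma one_plus_csqrt:
  assumes "w \<in> one_cut_plane"
  shows "1 + csqrt (1 - w) \<noteq> 0" "1 \<le> Re (1 + csqrt (1 - w))" "1 \<le> norm (1 + csqrt (1 - w))"
proof -
  have *: "0 < Re (csqrt (1 - w))" using csqrt_one_minus_pos[OF assms] .
  then show "1 \<le> Re (1 + csqrt (1 - w))" by simp
  then show "1 \<le> norm (1 + csqrt (1 - w))"
    using complex_Re_le_cmod[of "1 + csqrt (1 - w)"] by linarith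
  then show "1 + csqrt (1 - w) \<noteq> 0" by auto
qed

section \<open>The map \<open>psi1\<close> and the Landen iterates\<close>

lemma psi1_alt:
  assumes "w \<in> one_cut_plane"
  shows "psi1 w = w / (1 + csqrt (1 - w))\<^sup>2"
proof -
  define s where "s = csqrt (1 - w)"
  have "w = 1 - s\<^sup>2" by (simp add: s_def)
  then have "psi1 w * (1 + s)\<^sup>2 = w"
    using one_plus_csqrt(1)[OF assms] unfolding psi1_def s_def[symmetric]
    by (simp add: divide_simps) (simp add: power2_eq_square algebra_simps)
  then show ?thesis
    using one_plus_csqrt(1)[OF assms] by (simp add: s_def field_simps)
qed

lemma norm_psi1_le: "w \<in> one_cut_plane \<Longrightarrow> norm (psi1 w) \<le> norm w"
  using one_plus_csqrt(3)[of w]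
  by (simp add: psi1_alt norm_divide norm_power divide_le_eq mult_left_le_one_le)
     (simp add: mult_le_cancel_left1)

lemma psi1_eq_0_iff: "w \<in> one_cut_plane \<Longrightarrow> psi1 w = 0 \<longleftrightarrow> w = 0"
  by (auto simp: psi1_alt one_plus_csqrt)

text \<open>The root has positive real part, and the Cayley transform
  \<open>(1 - s) / (1 + s)\<close> maps the right half-plane into the unit disc.\<close>

lemma norm_psi1_less_1:
  assumes "w \<in> one_cut_plane"
  shows "norm (psi1 w) < 1"
proof -
  define s where "s = csqrt (1 - w)"
  have s: "0 < Re s" using csqrt_one_minus_pos[OF assms] by (simp add: s_def)
  have "(norm (1 - s))\<^sup>2 < (norm (1 + s))\<^sup>2"
    unfolding cmod_power2 using s by (simp add: power2_eq_square algebra_simps)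
  then have "norm (1 - s) < norm (1 + s)" by (simp add: power2_less_imp_less)
  moreover have "1 + s \<noteq> 0" using one_plus_csqrt(1)[OF assms] by (simp add: s_def)
  ultimately show ?thesis
    unfolding psi1_def s_def[symmetric] by (simp add: norm_divide)
qed

lemma holomorphic_psi1 [holomorphic_intros]:
  assumes "f holomorphic_on S" "\<And>z. z \<in> S \<Longrightarrow> f z \<in> one_cut_plane"
  shows "(\<lambda>z. psi1 (f z)) holomorphic_on S"
  unfolding psi1_def by (intro holomorphic_intros assms one_plus_csqrt) auto

lemma phi1_psi1:
  assumes "w \<in> one_cut_plane"
  shows "phi1 (psi1 w) = w"
proof -
  define s where "s = csqrt (1 - w)"
  have s: "1 + s \<noteq> 0" using one_plus_csqrt(1)[OF assms] by (simp add: s_def)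
  have "psi1 w = (1 - s) / (1 + s)" by (simp add: psi1_def s_def)
  moreover from this have "1 + psi1 w = 2 / (1 + s)" using s by (simp add: field_simps)
  ultimately have "phi1 (psi1 w) = 4 * ((1 - s) / (1 + s)) / (2 / (1 + s))\<^sup>2"
    by (simp add: phi1_def)
  also have "4 * (x / y) / (2 / y)\<^sup>2 = x * y" if "y \<noteq> 0" for x y :: complex
    using that by (simp add: power2_eq_square)
  then have "4 * ((1 - s) / (1 + s)) / (2 / (1 + s))\<^sup>2 = (1 - s) * (1 + s)" using s by blast
  also have "\<dots> = 1 - s\<^sup>2" by (simp add: power2_eq_square algebra_simps)
  finally have "phi1 (psi1 w) = 1 - s\<^sup>2" .
  then show ?thesis by (simp add: s_def)
qed

lemma one_minus_phi1: "k \<noteq> - 1 \<Longrightarrow> 1 - phi1 k = ((1 - k) / (1 + k))\<^sup>2"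
  by (simp add: phi1_def divide_simps add_eq_0_iff) (simp add: power2_eq_square algebra_simps)

text \<open>The moduli of the descending Landen transformation. \<open>psi_comp_eq\<close>
  identifies \<open>landen n w\<close> with the \<open>2 ^ n\<close>-th power of the
  \<open>n\<close>-th composition, so this recursion is free of higher roots.\<close>

primrec landen :: "nat \<Rightarrow> complex \<Rightarrow> complex" where
  "landen 0 w = psi1 w"
| "landen (Suc n) w = psi1 ((landen n w)\<^sup>2)"

lemma square_in_one_cut_plane: "norm k < 1 \<Longrightarrow> k\<^sup>2 \<in> one_cut_plane"
  using ball_subset_one_cut_plane by (force simp: norm_power power_less_one_iff)

lemma norm_landen_less_1: "w \<in> one_cut_plane \<Longrightarrow> norm (landen n w) < 1"
  by (induction n) (auto simp: norm_psi1_less_1 square_in_one_cut_plane)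

lemma landen_sq_in: "w \<in> one_cut_plane \<Longrightarrow> (landen n w)\<^sup>2 \<in> one_cut_plane"
  by (simp add: norm_landen_less_1 square_in_one_cut_plane)

text \<open>Source of all functional equations below: passing from \<open>w\<close> to the square of
  its first modulus merely drops the head of the chain.\<close>

lemma landen_shift: "landen n ((psi1 w)\<^sup>2) = landen (Suc n) w"
  by (induction n) auto

lemma norm_landen_le:
  assumes "w \<in> one_cut_plane"
  shows "norm (landen n w) \<le> norm (psi1 w) ^ 2 ^ n"
proof (induction n)
  case (Suc n)
  have "norm (landen (Suc n) w) \<le> (norm (landen n w))\<^sup>2"
    using norm_psi1_le[OF landen_sq_in[OF assms, of n]] by (simp add: norm_power)
  also have "\<dots> \<le> (norm (psi1 w) ^ 2 ^ n)\<^sup>2" using Suc by (intro power_mono) auto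
  finally show ?case by (simp add: power_mult[symmetric] mult.commute)
qed simp

lemma holomorphic_landen [holomorphic_intros]:
  "landen n holomorphic_on one_cut_plane"
proof (induction n)
  case 0
  have "(\<lambda>w. psi1 w) holomorphic_on one_cut_plane" by (intro holomorphic_intros) auto
  then show ?case by simp
next
  case (Suc n)
  have "(\<lambda>w. psi1 ((landen n w)\<^sup>2)) holomorphic_on one_cut_plane"
    by (intro holomorphic_intros Suc landen_sq_in)
  then show ?case by simp
qed

text \<open>Step \<open>j\<close> of the composition multiplies by
  \<open>exp (- nome_term j w)\<close>. The exponent in \<open>psi_eq\<close> is
  \<open>2 / 2 ^ (j + 1)\<close> up to sign, whence the weight \<open>1 / 2 ^ j\<close>.\<close>

definition nome_term :: "nat \<Rightarrow> complex \<Rightarrow> complex" where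
  "nome_term j w = of_real (1 / 2 ^ j) * Ln (1 + csqrt (1 - (landen j w)\<^sup>2))"

text \<open>Proved jointly: to apply \<open>psi_eq\<close> at the next step, the relevant power of
  the current composition must lie in the one-cut plane, and the second claim identifies it as the
  square of a Landen modulus.\<close>

lemma psi_comp_eq:
  assumes "w \<in> one_cut_plane"
  shows "psi_comp n w = psi1 w * exp (- (\<Sum>j<n. nome_term j w))"
    and "psi_comp n w ^ 2 ^ n = landen n w"
proof -
  have "psi_comp n w = psi1 w * exp (- (\<Sum>j<n. nome_term j w)) \<and> psi_comp n w ^ 2 ^ n = landen n w"
  proof (induction n)
    case 0
    then show ?case by (simp only: psi_comp.simps psi_1) simp
  next
    case (Suc n)
    define v where "v = psi_comp n w"
    have v: "v ^ 2 ^ Suc n = (landen n w)\<^sup>2"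
      using conjunct2[OF Suc, folded v_def] by (simp add: power_mult mult.commute[of 2])
    have "psi_comp (Suc n) w = psi (2 ^ Suc n) v" by (simp add: v_def)
    also have "\<dots> = v * (1 + csqrt (1 - (landen n w)\<^sup>2)) powr (- (2 / of_nat (2 ^ Suc n)))"
      using psi_eq[of v "2 ^ Suc n"] landen_sq_in[OF assms, of n] unfolding v by simp
    also have "\<dots> = v * exp (- nome_term n w)"
      using one_plus_csqrt(1)[OF landen_sq_in[OF assms, of n]]
      by (simp add: powr_def nome_term_def)
    also have "\<dots> = psi1 w * exp (- (\<Sum>j<Suc n. nome_term j w))"
      using Suc by (simp add: v_def exp_diff exp_minus field_simps exp_add)
    finally have 1: "psi_comp (Suc n) w = psi1 w * exp (- (\<Sum>j<Suc n. nome_term j w))" .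
    have "psi_comp (Suc n) w ^ 2 ^ Suc n = psi (2 ^ Suc n) v ^ 2 ^ Suc n" by (simp add: v_def)
    also have "\<dots> = psi1 ((landen n w)\<^sup>2)"
      by (subst psi_power) (simp_all add: v del: power_Suc)
    finally show ?case using 1 by simp
  qed
  then show "psi_comp n w = psi1 w * exp (- (\<Sum>j<n. nome_term j w))"
    "psi_comp n w ^ 2 ^ n = landen n w" by auto
qed

text \<open>The base has norm between 1 and 3 and positive real part, so its logarithm has real part
  between 0 and 2 and imaginary part below \<open>pi / 2\<close> in absolute value; 5 is a round
  bound.\<close>

lemma norm_Ln_one_plus_csqrt_le:
  assumes "norm u < 1"
  shows "norm (Ln (1 + csqrt (1 - u))) \<le> 5" "0 \<le> Re (Ln (1 + csqrt (1 - u)))"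
proof -
  define s where "s = 1 + csqrt (1 - u)"
  have u: "u \<in> one_cut_plane" using assms ball_subset_one_cut_plane by auto
  note s = one_plus_csqrt[OF u, folded s_def]
  have "norm (1 - u) \<le> 2" using norm_triangle_ineq4[of 1 u] assms by simp
  then have "norm (csqrt (1 - u)) \<le> sqrt 2" by simp
  also have "\<dots> \<le> 2" by (simp add: real_le_lsqrt)
  finally have "norm s \<le> 3"
    unfolding s_def using norm_triangle_ineq[of 1 "csqrt (1 - u)"] by simp
  then have *: "ln (norm s) \<le> 2" "0 \<le> ln (norm s)"
    using ln_le_minus_one[of "norm s"] s by simp_all
  have "norm (Ln s) \<le> \<bar>Re (Ln s)\<bar> + \<bar>Im (Ln s)\<bar>" by (rule cmod_le)
  also have "\<bar>Re (Ln s)\<bar> \<le> 2" using * s by simp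
  also have "\<bar>Im (Ln s)\<bar> < pi / 2" using Re_Ln_pos_lt[of s] s by simp
  finally have "norm (Ln s) \<le> 2 + pi / 2" by simp
  then show "norm (Ln (1 + csqrt (1 - u))) \<le> 5" using pi_less_4 by (simp add: s_def)
  show "0 \<le> Re (Ln (1 + csqrt (1 - u)))" using * s by (simp add: s_def)
qed

lemma norm_landen_sq_less_1: "w \<in> one_cut_plane \<Longrightarrow> norm ((landen n w)\<^sup>2) < 1"
  by (simp add: norm_power norm_landen_less_1 power_less_one_iff)

lemma norm_nome_term_le:
  assumes "w \<in> one_cut_plane"
  shows "norm (nome_term j w) \<le> 5 * (1 / 2) ^ j" "0 \<le> Re (nome_term j w)"
  using norm_Ln_one_plus_csqrt_le[OF norm_landen_sq_less_1[OF assms, of j]]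
  by (simp_all add: nome_term_def norm_mult norm_divide norm_power power_divide divide_right_mono del: csqrt.sel)

lemma holomorphic_nome_term: "nome_term j holomorphic_on one_cut_plane"
proof -
  have *: "1 + csqrt (1 - (landen j z)\<^sup>2) \<notin> \<real>\<^sub>\<le>\<^sub>0" if "z \<in> one_cut_plane" for z
    using one_plus_csqrt(2)[OF landen_sq_in[OF that, of j]]
    by (meson complex_nonpos_Reals_iff not_one_le_zero order_trans)
  have "(\<lambda>w. of_real (1 / 2 ^ j) * Ln (1 + csqrt (1 - (landen j w)\<^sup>2))) holomorphic_on one_cut_plane"
    by (intro holomorphic_on_mult holomorphic_on_const holomorphic_on_Ln' holomorphic_on_add
        holomorphic_csqrt_one_minus holomorphic_on_power holomorphic_landen landen_sq_in *)
  then show ?thesis by (simp add: nome_term_def[abs_def])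
qed

text \<open>Identified with the nome only in the last section; until then it serves as the branch of
  the inverse of \<open>lam\<close> on the one-cut plane.\<close>

definition nome_lim :: "complex \<Rightarrow> complex" where
  "nome_lim w = psi1 w * exp (- (\<Sum>j. nome_term j w))"

lemma summable_nome_term: "w \<in> one_cut_plane \<Longrightarrow> summable (\<lambda>j. nome_term j w)"
  by (rule summable_comparison_test'[of "\<lambda>j. 5 * (1 / 2) ^ j" 0])
     (auto intro!: summable_mult summable_geometric norm_nome_term_le)

lemma uniform_limit_nome_sum:
  "uniform_limit one_cut_plane (\<lambda>n w. \<Sum>j<n. nome_term j w) (\<lambda>w. \<Sum>j. nome_term j w) sequentially"
  by (rule Weierstrass_m_test[of _ _ "\<lambda>j. 5 * (1 / 2) ^ j"])
     (auto intro!: summable_mult summable_geometric norm_nome_term_le)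

lemma norm_nome_sum_le:
  assumes "w \<in> one_cut_plane"
  shows "norm (\<Sum>j<n. nome_term j w) \<le> 10" "norm (\<Sum>j. nome_term j w) \<le> 10"
proof -
  have *: "norm (\<Sum>j<n. nome_term j w) \<le> 10" for n
  proof -
    have "norm (\<Sum>j<n. nome_term j w) \<le> (\<Sum>j<n. 5 * (1 / 2) ^ j)"
      by (intro sum_norm_le norm_nome_term_le assms)
    also have "\<dots> \<le> (\<Sum>j. 5 * (1 / 2 :: real) ^ j)"
      by (intro sum_le_suminf summable_mult summable_geometric) auto
    also have "\<dots> = 10" by (simp add: suminf_mult suminf_geometric)
    finally show ?thesis .
  qed
  then show "norm (\<Sum>j<n. nome_term j w) \<le> 10" .
  show "norm (\<Sum>j. nome_term j w) \<le> 10"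
    using summable_LIMSEQ[OF summable_nome_term[OF assms]] *
    by (intro tendsto_upperbound[OF tendsto_norm]) auto
qed

text \<open>The bounds on the summands do not depend on \<open>w\<close>, so convergence is uniform
  on the whole cut plane. Exponentiation preserves it because all partial sums stay in
  \<open>cball 0 10\<close>.\<close>

lemma uniform_limit_psi_comp: "uniform_limit one_cut_plane psi_comp nome_lim sequentially"
proof -
  let ?S = "\<lambda>n w. \<Sum>j<n. nome_term j w"
  have bd: "- ?S n w \<in> cball 0 10" if "w \<in> one_cut_plane" for n w
    using norm_nome_sum_le(1)[OF that, of n] by simp
  have "uniformly_continuous_on (cball 0 10) (exp :: complex \<Rightarrow> complex)"
    by (intro compact_uniformly_continuous) (auto intro!: continuous_intros)
  then have "uniform_limit one_cut_plane (\<lambda>n w. exp (- ?S n w))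
      (\<lambda>w. exp (- (\<Sum>j. nome_term j w))) sequentially"
    by (rule uniform_limit_compose_uniformly_continuous_on
             [OF uniform_limit_uminus[OF uniform_limit_nome_sum]])
       (use bd in auto)
  moreover have "bounded ((\<lambda>w. exp (- (\<Sum>j. nome_term j w))) ` one_cut_plane)"
  proof -
    have "norm (exp (- (\<Sum>j. nome_term j w))) \<le> 1" if "w \<in> one_cut_plane" for w
      using that by (simp add: Re_suminf summable_nome_term norm_nome_term_le suminf_nonneg summable_Re)
    then show ?thesis by (simp only: bounded_iff) blast
  qed
  moreover have "bounded (psi1 ` one_cut_plane)"
    using norm_psi1_less_1 by (auto simp: bounded_iff intro!: exI[of _ 1] less_imp_le)
  ultimately have "uniform_limit one_cut_plane (\<lambda>n w. psi1 w * exp (- ?S n w))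
      (\<lambda>w. psi1 w * exp (- (\<Sum>j. nome_term j w))) sequentially"
    by (intro uniform_lim_mult uniform_limit_const) auto
  then show ?thesis
    by (rule uniform_limit_cong'[THEN iffD1, rotated -1]) (auto simp: psi_comp_eq nome_lim_def)
qed

lemma holomorphic_nome_lim: "nome_lim holomorphic_on one_cut_plane"
proof (rule holomorphic_uniform_sequence[OF open_one_cut_plane])
  fix n
  have "(\<lambda>w. psi1 w * exp (- (\<Sum>j<n. nome_term j w))) holomorphic_on one_cut_plane"
    by (intro holomorphic_intros holomorphic_nome_term) auto
  then show "psi_comp n holomorphic_on one_cut_plane"
    by (rule holomorphic_transform) (simp add: psi_comp_eq)
next
  fix w assume "w \<in> one_cut_plane"
  then obtain d where "d > 0" "cball w d \<subseteq> one_cut_plane"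
    using open_one_cut_plane open_contains_cball by blast
  then show "\<exists>d>0. cball w d \<subseteq> one_cut_plane \<and> uniform_limit (cball w d) psi_comp nome_lim sequentially"
    using uniform_limit_psi_comp uniform_limit_on_subset by blast
qed

lemma norm_nome_lim_le:
  assumes "w \<in> one_cut_plane"
  shows "norm (nome_lim w) \<le> norm (psi1 w)"
proof -
  have "0 \<le> (\<Sum>j. Re (nome_term j w))"
    using assms by (intro suminf_nonneg summable_Re summable_nome_term norm_nome_term_le)
  then show ?thesis
    using assms by (simp add: nome_lim_def norm_mult Re_suminf[symmetric] summable_nome_term mult_left_le)
qed

lemma norm_nome_lim_less_1: "w \<in> one_cut_plane \<Longrightarrow> norm (nome_lim w) < 1"
  using norm_nome_lim_le norm_psi1_less_1 by (meson le_less_trans)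

lemma nome_lim_eq_0_iff: "w \<in> one_cut_plane \<Longrightarrow> nome_lim w = 0 \<longleftrightarrow> w = 0"
  by (simp add: nome_lim_def psi1_eq_0_iff)

text \<open>By \<open>landen_shift\<close> the exponent for the first modulus squared is twice the
  tail of the exponent for \<open>w\<close>. The doubled head \<open>2 * Ln ?s\<close> produces the
  denominator in \<open>psi1_alt\<close>.\<close>

lemma nome_lim_square:
  assumes w: "w \<in> one_cut_plane"
  shows "nome_lim ((psi1 w)\<^sup>2) = (nome_lim w)\<^sup>2"
proof -
  let ?k = "(psi1 w)\<^sup>2"
  let ?s = "1 + csqrt (1 - ?k)"
  have k: "?k \<in> one_cut_plane" using landen_sq_in[OF w, of 0] by simp
  have t: "nome_term j ?k = 2 * nome_term (Suc j) w" for j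
    unfolding nome_term_def landen_shift by simp
  have "(\<Sum>j. nome_term j w) = Ln ?s + (\<Sum>j. nome_term (Suc j) w)"
    using suminf_split_head[OF summable_nome_term[OF w]] by (simp add: nome_term_def)
  moreover have "(\<Sum>j. nome_term j ?k) = 2 * (\<Sum>j. nome_term (Suc j) w)"
    unfolding t using summable_nome_term[OF w] by (subst suminf_mult) (auto simp: summable_Suc_iff[of "\<lambda>j. nome_term j w"])
  ultimately have "2 * (\<Sum>j. nome_term j w) = 2 * Ln ?s + (\<Sum>j. nome_term j ?k)" by simp
  then have "(nome_lim w)\<^sup>2 = ?k * exp (- (2 * Ln ?s + (\<Sum>j. nome_term j ?k)))"
    by (simp add: nome_lim_def power_mult_distrib exp_double[symmetric])
  also have "\<dots> = ?k * inverse (?s\<^sup>2) * exp (- (\<Sum>j. nome_term j ?k))"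
    using one_plus_csqrt(1)[OF k] by (simp add: exp_add exp_minus exp_double exp_diff field_simps)
  also have "\<dots> = nome_lim ?k"
    using k by (simp add: nome_lim_def psi1_alt[of ?k] field_simps)
  finally show ?thesis by simp
qed

text \<open>Shows that the derivative at 0 does not vanish. The factor \<open>exp (- 10)\<close>
  comes from \<open>norm_nome_sum_le\<close>, the 9 from a denominator \<open>s ^ 2\<close> with
  \<open>norm s\<close> at most 3.\<close>

lemma norm_nome_lim_ge:
  assumes "norm w < 1"
  shows "norm w * (exp (- 10) / 9) \<le> norm (nome_lim w)"
proof -
  have w: "w \<in> one_cut_plane" using assms ball_subset_one_cut_plane by auto
  define s where "s = 1 + csqrt (1 - w)"
  have s: "norm s \<ge> 1" using one_plus_csqrt(3)[OF w] by (simp add: s_def)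
  have "norm (1 - w) \<le> 4" using norm_triangle_ineq4[of 1 w] assms by simp
  then have "norm (csqrt (1 - w)) \<le> 2" by (simp add: real_le_lsqrt)
  then have "norm s \<le> 3"
    unfolding s_def using norm_triangle_ineq[of 1 "csqrt (1 - w)"] by simp
  then have "norm s ^ 2 \<le> 3 ^ 2" by (intro power_mono) auto
  then have "norm w / 9 \<le> norm (psi1 w)"
    unfolding psi1_alt[OF w] s_def[symmetric] norm_divide norm_power
    using s by (intro divide_left_mono mult_pos_pos zero_less_power) auto
  moreover have "exp (- 10) \<le> norm (exp (- (\<Sum>j. nome_term j w)))"
    using norm_nome_sum_le(2)[OF w] complex_Re_le_cmod[of "\<Sum>j. nome_term j w"] by simp
  ultimately have "norm w / 9 * exp (- 10) \<le> norm (psi1 w) * norm (exp (- (\<Sum>j. nome_term j w)))"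
    by (intro mult_mono) auto
  then show ?thesis by (simp add: nome_lim_def norm_mult)
qed

lemma nome_lim_0 [simp]: "nome_lim 0 = 0"
  by (simp add: nome_lim_eq_0_iff)

lemma deriv_nome_lim_0: "(nome_lim has_field_derivative deriv nome_lim 0) (at 0)" "deriv nome_lim 0 \<noteq> 0"
proof -
  show D: "(nome_lim has_field_derivative deriv nome_lim 0) (at 0)"
    by (rule holomorphic_derivI[OF holomorphic_nome_lim open_one_cut_plane]) auto
  have "((\<lambda>w. norm (nome_lim w / w)) \<longlongrightarrow> norm (deriv nome_lim 0)) (at 0)"
    using D by (auto simp: has_field_derivative_iff intro: tendsto_norm)
  moreover have "\<forall>\<^sub>F w in at 0. exp (- 10) / 9 \<le> norm (nome_lim w / w)"
  proof -
    have "\<forall>\<^sub>F w in at 0. w \<in> ball 0 1 - {0 :: complex}"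
      by (rule eventually_at_in_open) auto
    then show ?thesis
      by eventually_elim (use norm_nome_lim_ge in \<open>auto simp: norm_divide field_simps\<close>)
  qed
  ultimately have "exp (- 10) / 9 \<le> norm (deriv nome_lim 0)"
    by (intro tendsto_lowerbound) auto
  moreover have "0 < exp (- 10 :: real) / 9" by simp
  ultimately show "deriv nome_lim 0 \<noteq> 0" by (metis norm_zero not_le)
qed

subsection \<open>Continuation of the inverse function to the unit disc\<close>

text \<open>The quotient takes only the values 1 and -1, hence is constant on a connected set. This
  settles signs of square roots chosen below.\<close>

lemma eq_if_square_eq:
  fixes f g :: "'a::topological_space \<Rightarrow> complex"
  assumes "connected S" "continuous_on S f" "continuous_on S g"
    and sq: "\<And>x. x \<in> S \<Longrightarrow> (f x)\<^sup>2 = (g x)\<^sup>2" and nz: "\<And>x. x \<in> S \<Longrightarrow> g x \<noteq> 0"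
    and "a \<in> S" "f a = g a" "x \<in> S"
  shows "f x = g x"
proof -
  have "(\<lambda>x. f x / g x) constant_on S"
  proof (rule continuous_finite_range_constant[OF assms(1)])
    show "continuous_on S (\<lambda>x. f x / g x)" using assms by (intro continuous_intros) auto
    have "(\<lambda>x. f x / g x) ` S \<subseteq> {1, -1}"
      using sq nz by (force simp: power2_eq_iff field_simps)
    then show "finite ((\<lambda>x. f x / g x) ` S)" by (rule finite_subset) auto
  qed
  then have "f x / g x = f a / g a"
    using assms(6,8) unfolding constant_on_def by force
  then show ?thesis using nz assms(6-8) by simp
qed

lemma phi1_eq_0_iff: "k \<noteq> - 1 \<Longrightarrow> phi1 k = 0 \<longleftrightarrow> k = 0"
  by (auto simp: phi1_def add_eq_0_iff)

lemma phi1_eq_1_iff: "k \<noteq> - 1 \<Longrightarrow> phi1 k = 1 \<longleftrightarrow> k = 1"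
  using one_minus_phi1[of k] by (auto simp: add_eq_0_iff)

lemma local_inverse_nome_lim:
  obtains r \<rho> where "0 < r" "r < 1" "0 < \<rho>" "\<rho> < 1" "inj_on nome_lim (ball 0 r)" "ball 0 \<rho> \<subseteq> nome_lim ` ball 0 r"
proof -
  obtain r0 where r0: "r0 > 0" "ball 0 r0 \<subseteq> one_cut_plane" "inj_on nome_lim (ball 0 r0)"
    using has_complex_derivative_locally_injective[OF holomorphic_nome_lim _ open_one_cut_plane deriv_nome_lim_0(2)]
    by auto
  define r where "r = min r0 (1/2)"
  have r: "0 < r" "r < 1" "ball 0 r \<subseteq> one_cut_plane" "inj_on nome_lim (ball 0 r)"
    using r0 by (auto simp: r_def intro: inj_on_subset)
  have "open (nome_lim ` ball 0 r)"
    using open_mapping_thm3[OF holomorphic_on_subset[OF holomorphic_nome_lim r(3)] _ r(4)] by simp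
  moreover have "0 \<in> nome_lim ` ball 0 r" using r by (intro image_eqI[of _ _ 0]) auto
  ultimately obtain \<rho>0 where "\<rho>0 > 0" "ball 0 \<rho>0 \<subseteq> nome_lim ` ball 0 r"
    using open_contains_ball by metis
  then show ?thesis
    by (intro that[of r "min \<rho>0 (1/2)"]) (use r in auto)
qed

text \<open>One step of the continuation of the inverse nome: a solution on a disc of radius \<open>R\<close> of the
  functional equation coming from the Landen transformation determines one on the disc of radius
  \<open>sqrt R\<close>.\<close>

lemma extend_kap:
  assumes \<rho>: "0 < \<rho>" "\<rho> \<le> R" "R < 1"
    and K0: "K0 holomorphic_on ball 0 \<rho>" "K0 0 = 0" "\<And>q. q \<in> ball 0 \<rho> \<Longrightarrow> K0 q = 0 \<Longrightarrow> q = 0"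
      "deriv K0 0 \<noteq> 0" "\<And>q. q \<in> ball 0 \<rho> \<Longrightarrow> (K0 q)\<^sup>2 = phi1 (K0 (q\<^sup>2))"
    and K: "K holomorphic_on ball 0 R" "\<And>q. q \<in> ball 0 \<rho> \<Longrightarrow> K q = K0 q"
      "\<And>q. q \<in> ball 0 R \<Longrightarrow> K q \<noteq> 1 \<and> K q \<noteq> - 1 \<and> (K q = 0 \<longrightarrow> q = 0)"
  shows "\<exists>K'. K' holomorphic_on ball 0 (sqrt R) \<and> (\<forall>q\<in>ball 0 \<rho>. K' q = K0 q) \<and>
      (\<forall>q\<in>ball 0 (sqrt R). K' q \<noteq> 1 \<and> K' q \<noteq> - 1 \<and> (K' q = 0 \<longrightarrow> q = 0))"
proof -
  \<comment> \<open>The function \<open>h\<close> whose root is wanted has a double zero at 0.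
    Dividing the simple zero out of \<open>K0\<close> and its square out of \<open>h\<close> leaves
    zero-free functions \<open>e\<close> and \<open>E\<close>, with \<open>E = e ^ 2\<close> near
    0.\<close>
  define e where "e = (\<lambda>q. if q = 0 then deriv K0 0 else K0 q / q)"
  have e: "e holomorphic_on ball 0 \<rho>"
    by (rule pole_theorem_open_0[OF K0(1), of 0]) (auto simp: e_def K0)
  have e_nz: "e q \<noteq> 0" if "q \<in> ball 0 \<rho>" for q :: complex using that K0 by (auto simp: e_def)
  have Ke: "K0 q = q * e q" for q :: complex using K0 by (auto simp: e_def)
  have R: "\<rho> \<le> sqrt R"
  proof -
    have "\<rho>\<^sup>2 \<le> \<rho>" using \<rho> by (simp add: power2_eq_square mult_left_le_one_le)
    then show ?thesis using \<rho> by (intro real_le_rsqrt) auto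
  qed
  have sq: "q\<^sup>2 \<in> ball 0 R" if "q \<in> ball 0 (sqrt R)" for q :: complex
  proof -
    have "(norm q)\<^sup>2 < (sqrt R)\<^sup>2" using that by (intro power_strict_mono) auto
    then show ?thesis using \<rho> by (simp add: norm_power)
  qed
  have sq\<rho>: "q\<^sup>2 \<in> ball 0 \<rho>" if "q \<in> ball 0 \<rho>" for q :: complex
  proof -
    have "norm q * norm q \<le> norm q" using that \<rho> by (intro mult_left_le_one_le) auto
    then show ?thesis using that by (simp add: norm_mult power2_eq_square)
  qed
  define h where "h = (\<lambda>q. phi1 (K (q\<^sup>2)))"
  have h: "h holomorphic_on ball 0 (sqrt R)"
  proof -
    have "K \<circ> (\<lambda>q. q\<^sup>2) holomorphic_on ball 0 (sqrt R)"
      by (rule holomorphic_on_compose_gen[where t = "ball 0 R"])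
         (use sq K in \<open>auto intro!: holomorphic_intros\<close>)
    then have "(\<lambda>q. K (q\<^sup>2)) holomorphic_on ball 0 (sqrt R)" by (simp add: o_def)
    then show ?thesis
      unfolding h_def phi1_def using sq K(3) by (intro holomorphic_intros) (auto simp: add_eq_0_iff)
  qed
  have h_nz: "h q \<noteq> 0" if "q \<in> ball 0 (sqrt R)" "q \<noteq> 0" for q :: complex
    using K(3)[OF sq[OF that(1)]] that by (auto simp: h_def phi1_eq_0_iff)
  have h_e: "h q = q\<^sup>2 * (e q)\<^sup>2" if "q \<in> ball 0 \<rho>" for q :: complex
    using K0(5)[OF that] K(2)[OF sq\<rho>[OF that]] by (simp add: h_def Ke power_mult_distrib)
  define E where "E = (\<lambda>q. if q = 0 then (deriv K0 0)\<^sup>2 else h q / q\<^sup>2)"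
  have E_e: "E q = (e q)\<^sup>2" if "q \<in> ball 0 \<rho>" for q :: complex
    using h_e[OF that] by (auto simp: E_def e_def)
  have "E holomorphic_on ball 0 \<rho> \<union> (ball 0 (sqrt R) - {0})"
  proof (rule holomorphic_on_Un)
    have "(\<lambda>q. (e q)\<^sup>2) holomorphic_on ball 0 \<rho>" by (intro holomorphic_intros e)
    then show "E holomorphic_on ball 0 \<rho>"
      by (rule holomorphic_transform) (simp add: E_e)
    have "(\<lambda>q. h q / q\<^sup>2) holomorphic_on ball 0 (sqrt R) - {0}"
      by (intro holomorphic_intros holomorphic_on_subset[OF h]) auto
    then show "E holomorphic_on ball 0 (sqrt R) - {0}"
      by (rule holomorphic_transform) (auto simp: E_def)
  qed auto
  also have "ball 0 \<rho> \<union> (ball 0 (sqrt R) - {0}) = ball 0 (sqrt R)" using R \<rho> by auto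
  finally have E: "E holomorphic_on ball 0 (sqrt R)" .
  have E_nz: "E q \<noteq> 0" if "q \<in> ball 0 (sqrt R)" for q :: complex
    using h_nz[OF that] K0(4) by (auto simp: E_def)
  obtain s0 where s0: "s0 holomorphic_on ball 0 (sqrt R)"
      "\<And>q. q \<in> ball 0 (sqrt R) \<Longrightarrow> E q = (s0 q)\<^sup>2"
    using contractible_imp_holomorphic_sqrt[OF E _ E_nz] convex_imp_contractible[OF convex_ball]
    by metis
  have "(s0 0)\<^sup>2 = (e 0)\<^sup>2" using s0(2)[of 0] E_e[of 0] \<rho> R by auto
  \<comment> \<open>The sign that makes the root agree with \<open>e\<close> at 0, and by continuity
    on the small disc.\<close>
  then obtain c where c: "c = 1 \<or> c = (-1::complex)" "c * s0 0 = e 0"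
    by (auto simp: power2_eq_iff) (metis mult_1 mult_minus1 minus_minus)+
  define s where "s = (\<lambda>q. c * s0 q)"
  have s: "s holomorphic_on ball 0 (sqrt R)" unfolding s_def by (intro holomorphic_intros s0)
  have sE: "(s q)\<^sup>2 = E q" if "q \<in> ball 0 (sqrt R)" for q :: complex
    using s0(2)[OF that] c(1) by (auto simp: s_def power_mult_distrib)
  have se: "s q = e q" if "q \<in> ball 0 \<rho>" for q :: complex
  proof (rule eq_if_square_eq[of "ball 0 \<rho>" s e 0])
    show "continuous_on (ball 0 \<rho>) s"
      using R by (intro holomorphic_on_imp_continuous_on holomorphic_on_subset[OF s]) auto
    show "(s x)\<^sup>2 = (e x)\<^sup>2" if "x \<in> ball 0 \<rho>" for x
      using sE[of x] E_e[of x] that R by auto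
  qed (use \<rho> e e_nz c that in \<open>auto simp: s_def intro: holomorphic_on_imp_continuous_on\<close>)
  have h_s: "(q * s q)\<^sup>2 = h q" if "q \<in> ball 0 (sqrt R)" for q :: complex
    using sE[OF that] h_e[of 0] \<rho> by (auto simp: E_def power_mult_distrib)
  show ?thesis
  proof (intro exI[of _ "\<lambda>q. q * s q"] conjI ballI)
    show "(\<lambda>q. q * s q) holomorphic_on ball 0 (sqrt R)" by (intro holomorphic_intros s)
    show "q * s q = K0 q" if "q \<in> ball 0 \<rho>" for q :: complex using that by (simp add: se Ke)
  next
    fix q :: complex assume q: "q \<in> ball 0 (sqrt R)"
    \<comment> \<open>The square of the new function is \<open>h q\<close>, a value of
      \<open>phi1\<close>, and \<open>phi1\<close> takes the value 1 only at 1; so both 1 and -1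
      remain omitted.\<close>
    have "h q \<noteq> 1" using K(3)[OF sq[OF q]] by (simp add: h_def phi1_eq_1_iff)
    then show "q * s q \<noteq> 1" "q * s q \<noteq> -1" using h_s[OF q] by (metis one_power2 power2_minus)+
    show "q * s q = 0 \<longrightarrow> q = 0" using h_s[OF q] h_nz[OF q] by fastforce
  qed
qed

text \<open>On a small disc, \<open>psi1\<close> composed with the local inverse of
  \<open>nome_lim\<close> works: \<open>nome_lim_square\<close> becomes the functional equation.
  \<open>extend_kap\<close> then passes through the radii \<open>\<rho> powr (1 / 2 ^ n)\<close>,
  which tend to 1.\<close>

lemma kap_exists:
  "\<exists>K. K holomorphic_on ball 0 1 \<and>
     (\<forall>q\<in>ball 0 1. (K q)\<^sup>2 = phi1 (K (q\<^sup>2)) \<and> K q \<noteq> 1 \<and> K q \<noteq> - 1 \<and> (K q = 0 \<longleftrightarrow> q = 0)) \<and>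
     (\<exists>r>0. \<forall>w\<in>ball 0 r. K (nome_lim w) = psi1 w)"
proof -
  obtain r \<rho> where r: "0 < r" "r < 1" "0 < \<rho>" "\<rho> < 1" "inj_on nome_lim (ball 0 r)" "ball 0 \<rho> \<subseteq> nome_lim ` ball 0 r"
    using local_inverse_nome_lim .
  have r1: "ball 0 r \<subseteq> one_cut_plane" using r ball_subset_one_cut_plane by force
  obtain g where g: "g holomorphic_on nome_lim ` ball 0 r" "\<And>z. z \<in> ball 0 r \<Longrightarrow> deriv nome_lim z * deriv g (nome_lim z) = 1"
      "\<And>z. z \<in> ball 0 r \<Longrightarrow> g (nome_lim z) = z"
    using holomorphic_has_inverse[OF holomorphic_on_subset[OF holomorphic_nome_lim r1] _ r(5)] by auto
  have gr: "g q \<in> ball 0 r" "nome_lim (g q) = q" if "q \<in> ball 0 \<rho>" for q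
    using that r(6) g(3) by (force)+
  define K0 where "K0 = (\<lambda>q. psi1 (g q))"
  have K0: "K0 holomorphic_on ball 0 \<rho>"
    unfolding K0_def using gr r1 by (intro holomorphic_intros holomorphic_on_subset[OF g(1) r(6)]) auto
  have g0: "g 0 = 0" using g(3)[of 0] r by simp
  have K00: "K0 0 = 0" by (simp add: K0_def g0 psi1_eq_0_iff)
  have K0_nz: "q = 0" if "q \<in> ball 0 \<rho>" "K0 q = 0" for q
    using that gr[of q] r1 by (force simp: K0_def psi1_eq_0_iff)
  have phK0: "phi1 (K0 q) = g q" if "q \<in> ball 0 \<rho>" for q
    using gr[OF that] r1 by (auto simp: K0_def phi1_psi1)
  have nK0: "norm (K0 q) < 1" if "q \<in> ball 0 \<rho>" for q
    using gr[OF that] r1 norm_psi1_less_1 by (auto simp: K0_def)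
  have sq\<rho>: "q\<^sup>2 \<in> ball 0 \<rho>" if "q \<in> ball 0 \<rho>" for q :: complex
  proof -
    have "norm q * norm q \<le> norm q" using that r by (intro mult_left_le_one_le) auto
    then show ?thesis using that by (simp add: norm_mult power2_eq_square)
  qed
  have K0_sq: "(K0 q)\<^sup>2 = phi1 (K0 (q\<^sup>2))" if "q \<in> ball 0 \<rho>" for q
  proof -
    have w: "g q \<in> ball 0 r" "g q \<in> one_cut_plane" using gr[OF that] r1 by auto
    have "norm (psi1 (g q)) \<le> norm (g q)" using w norm_psi1_le by blast
    also have "\<dots> < r" using w by simp
    finally have "norm (psi1 (g q)) < r" .
    then have "(norm (psi1 (g q)))\<^sup>2 < r"
      using r by (smt (verit) mult_left_le_one_le norm_ge_zero power2_eq_square)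
    then have "(psi1 (g q))\<^sup>2 \<in> ball 0 r" by (simp add: norm_power)
    then have "g (nome_lim ((psi1 (g q))\<^sup>2)) = (psi1 (g q))\<^sup>2" by (rule g)
    moreover have "nome_lim ((psi1 (g q))\<^sup>2) = q\<^sup>2" using gr[OF that] nome_lim_square[OF w(2)] by simp
    ultimately show ?thesis using phK0[OF sq\<rho>[OF that]] by (simp add: K0_def)
  qed
  have K0_deriv: "deriv K0 0 \<noteq> 0"
  proof
    \<comment> \<open>Otherwise the derivative of \<open>phi1 (K0 q) = g q\<close> at 0 would vanish
      too, contradicting that \<open>g\<close> inverts \<open>nome_lim\<close>
      holomorphically.\<close>
    assume d: "deriv K0 0 = 0"
    have 0: "(K0 has_field_derivative 0) (at 0)"
      using holomorphic_derivI[OF K0, of 0] r d by simp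
    have "((\<lambda>q. 4 * K0 q / (1 + K0 q)\<^sup>2) has_field_derivative 0) (at 0)"
      by (rule derivative_eq_intros 0 refl | simp add: K00)+
    then have "((\<lambda>q. phi1 (K0 q)) has_field_derivative 0) (at 0)" by (simp add: phi1_def)
    then have "(g has_field_derivative 0) (at 0)"
      by (rule has_field_derivative_transform_within_open[of _ _ _ "ball 0 \<rho>"]) (use r phK0 in auto)
    then have "deriv g 0 = 0" by (rule DERIV_imp_deriv)
    then show False using g(2)[of 0] r by simp
  qed
  define P where "P = (\<lambda>R K. K holomorphic_on ball 0 R \<and> (\<forall>q\<in>ball 0 \<rho>. K q = K0 q) \<and>
      (\<forall>q\<in>ball 0 R. K q \<noteq> 1 \<and> K q \<noteq> - 1 \<and> (K q = 0 \<longrightarrow> q = 0)))"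
  define R where "R = (\<lambda>n::nat. \<rho> powr (1 / 2 ^ n))"
  have R: "\<rho> \<le> R n" "R n < 1" for n
  proof -
    have "\<rho> powr 1 \<le> \<rho> powr (1 / 2 ^ n)" using r by (intro powr_mono') auto
    then show "\<rho> \<le> R n" using r by (simp add: R_def)
    show "R n < 1" using r powr_less_mono2[of "1 / 2 ^ n" \<rho> 1] by (simp add: R_def)
  qed
  have R_Suc: "R (Suc n) = sqrt (R n)" for n
    using r by (simp add: R_def powr_half_sqrt[symmetric] powr_powr mult.commute)
  have "\<exists>f. \<forall>n. P (R n) (f n) \<and> True"
  proof (rule dependent_nat_choice[where P = "\<lambda>n. P (R n)" and Q = "\<lambda>_ _ _. True"])
    have "P (R 0) K0"
      using K0 K0_nz nK0 r by (fastforce simp: P_def R_def)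
    then show "\<exists>x. P (R 0) x" by blast
  next
    fix K n assume "P (R n) K"
    then have "\<exists>K'. P (sqrt (R n)) K'"
      unfolding P_def
      by (intro extend_kap[of _ "R n" K0 K])
         (use r R[of n] K0 K00 K0_nz K0_sq K0_deriv in auto)
    then show "\<exists>y. P (R (Suc n)) y \<and> True" by (simp add: R_Suc)
  qed
  then obtain f where f: "\<And>n. P (R n) (f n)" by blast
  have f_eq: "f n q = f m q" if "q \<in> ball 0 (R n)" "q \<in> ball 0 (R m)" for n m q
  proof (rule analytic_continuation_open[of "ball 0 \<rho>" "ball 0 (min (R n) (R m))" "f n" "f m"])
    show "f n holomorphic_on ball 0 (min (R n) (R m))" "f m holomorphic_on ball 0 (min (R n) (R m))"
      using f[of n] f[of m] by (auto simp: P_def elim: holomorphic_on_subset)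
    show "f n z = f m z" if "z \<in> ball 0 \<rho>" for z using f[of n] f[of m] that by (auto simp: P_def)
  qed (use R[of n] R[of m] r that in auto)
  have R_lim: "R \<longlonglongrightarrow> 1"
  proof -
    have "(\<lambda>n. \<rho> powr ((1 / 2) ^ n)) \<longlonglongrightarrow> \<rho> powr 0"
      using r by (intro tendsto_intros LIMSEQ_power_zero) auto
    then show ?thesis using r by (simp add: R_def power_divide)
  qed
  have ex: "\<exists>n. q \<in> ball 0 (R n)" if "q \<in> ball 0 1" for q :: complex
  proof -
    have "\<forall>\<^sub>F n in sequentially. norm q < R n" using R_lim that by (intro order_tendstoD) auto
    then show ?thesis by (auto simp: eventually_sequentially)
  qed
  \<comment> \<open>All the extensions continue \<open>K0\<close>, so any two agree on their common
    disc and the choice of index is immaterial.\<close>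
  define K where "K = (\<lambda>q. f (LEAST n. q \<in> ball 0 (R n)) q)"
  have Kf: "K q = f n q" if "q \<in> ball 0 (R n)" for n q
    unfolding K_def using LeastI[of "\<lambda>n. q \<in> ball 0 (R n)", OF that] that by (intro f_eq)
  have hol: "K holomorphic_on ball 0 1"
  proof -
    have "K holomorphic_on (\<Union>n\<in>UNIV. ball 0 (R n))"
    proof (rule holomorphic_on_UN_open)
      fix n show "K holomorphic_on ball 0 (R n)"
        using f[of n] Kf by (auto simp: P_def elim!: holomorphic_transform)
    qed auto
    then show ?thesis by (rule holomorphic_on_subset) (use ex in auto)
  qed
  have K_K0: "K q = K0 q" if "q \<in> ball 0 \<rho>" for q
  proof -
    have "q \<in> ball 0 (R 0)" using that r by (simp add: R_def)
    then show ?thesis using Kf[of q 0] f[of 0] that by (simp add: P_def)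
  qed
  have K_nz: "K q \<noteq> 1 \<and> K q \<noteq> - 1 \<and> (K q = 0 \<longleftrightarrow> q = 0)" if "q \<in> ball 0 1" for q
    using ex[OF that] Kf f K_K0[of 0] K00 r by (fastforce simp: P_def)
  have sq1: "q\<^sup>2 \<in> ball 0 1" if "q \<in> ball 0 1" for q :: complex
    using that by (simp add: norm_power power_less_one_iff)
  have hol2: "(\<lambda>q. K (q\<^sup>2)) holomorphic_on ball 0 1"
  proof -
    have "(K \<circ> (\<lambda>q. q\<^sup>2)) holomorphic_on ball 0 1"
      by (rule holomorphic_on_compose_gen[OF _ hol]) (use sq1 in \<open>auto intro!: holomorphic_intros\<close>)
    then show ?thesis by (simp add: o_def)
  qed
  have K_sq: "(K q)\<^sup>2 = phi1 (K (q\<^sup>2))" if "q \<in> ball 0 1" for q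
  proof (rule analytic_continuation_open[of "ball 0 \<rho>" "ball 0 1" "\<lambda>q. (K q)\<^sup>2" "\<lambda>q. phi1 (K (q\<^sup>2))"])
    show "(\<lambda>q. phi1 (K (q\<^sup>2))) holomorphic_on ball 0 1"
      unfolding phi1_def using K_nz sq1 by (intro holomorphic_intros hol2) (auto simp: add_eq_0_iff)
  qed (use r that K_K0 K0_sq sq\<rho> in \<open>auto intro!: holomorphic_intros hol\<close>)
  have "continuous (at 0) nome_lim"
    using deriv_nome_lim_0(1) DERIV_isCont by blast
  then obtain d where d: "d > 0" "\<And>w. norm w < d \<Longrightarrow> norm (nome_lim w) < \<rho>"
    using r(3) by (auto simp: continuous_at_eps_delta)
  have "K (nome_lim w) = psi1 w" if "w \<in> ball 0 (min d r)" for w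
    using that d(2)[of w] g(3)[of w] by (simp add: K_K0 K0_def)
  then have "\<exists>r>0. \<forall>w\<in>ball 0 r. K (nome_lim w) = psi1 w"
    using d r by (intro exI[of _ "min d r"]) auto
  then show ?thesis using hol K_nz K_sq by blast
qed

text \<open>In classical notation \<open>lam q\<close> is the elliptic modular function \<open>\<lambda> = k\<^sup>2\<close> of the nome \<open>q\<close>, and
  \<open>kap q\<close> is the modulus \<open>k\<close> belonging to the nome \<open>q\<^sup>2\<close>.\<close>

definition kap :: "complex \<Rightarrow> complex" where
  "kap = (SOME K. K holomorphic_on ball 0 1 \<and>
     (\<forall>q\<in>ball 0 1. (K q)\<^sup>2 = phi1 (K (q\<^sup>2)) \<and> K q \<noteq> 1 \<and> K q \<noteq> - 1 \<and> (K q = 0 \<longleftrightarrow> q = 0)) \<and>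
     (\<exists>r>0. \<forall>w\<in>ball 0 r. K (nome_lim w) = psi1 w))"

definition lam :: "complex \<Rightarrow> complex" where
  "lam q = phi1 (kap q)"

lemmas kap_props = someI_ex[OF kap_exists, folded kap_def]

lemma
  assumes "norm q < 1"
  shows kap_square: "(kap q)\<^sup>2 = lam (q\<^sup>2)"
    and kap_neq: "kap q \<noteq> 1" "kap q \<noteq> - 1"
    and lam_eq_0_iff: "lam q = 0 \<longleftrightarrow> q = 0"
    and lam_neq_1: "lam q \<noteq> 1"
  using kap_props assms by (auto simp: lam_def phi1_eq_0_iff phi1_eq_1_iff)

lemma holomorphic_kap: "kap holomorphic_on ball 0 1"
  using kap_props by blast

lemma holomorphic_lam: "lam holomorphic_on ball 0 1"
proof -
  have "(\<lambda>q. 4 * kap q / (1 + kap q)\<^sup>2) holomorphic_on ball 0 1"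
    using kap_neq by (intro holomorphic_intros holomorphic_kap) (auto simp: add_eq_0_iff)
  then show ?thesis by (simp add: lam_def[abs_def] phi1_def)
qed

text \<open>True near 0 by the choice of \<open>kap\<close>, then everywhere by the identity
  theorem. Thus \<open>nome_lim\<close> is a section of \<open>lam\<close> over the one-cut
  plane.\<close>

lemma lam_nome_lim:
  assumes "w \<in> one_cut_plane"
  shows "lam (nome_lim w) = w"
proof -
  obtain r where r: "r > 0" "\<forall>w\<in>ball 0 r. kap (nome_lim w) = psi1 w" using kap_props by blast
  show ?thesis
  proof (rule analytic_continuation_open[of "ball 0 (min r 1)" one_cut_plane "\<lambda>w. lam (nome_lim w)" "\<lambda>w. w"])
    have "(lam \<circ> nome_lim) holomorphic_on one_cut_plane"
      by (rule holomorphic_on_compose_gen[OF holomorphic_nome_lim holomorphic_lam]) (use norm_nome_lim_less_1 in auto)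
    then show "(\<lambda>w. lam (nome_lim w)) holomorphic_on one_cut_plane" by (simp add: o_def)
    show "ball 0 (min r 1) \<subseteq> one_cut_plane" using ball_subset_one_cut_plane by auto
    then show "lam (nome_lim z) = z" if "z \<in> ball 0 (min r 1)" for z
      using r that by (auto simp: lam_def phi1_psi1)
  qed (use open_one_cut_plane connected_one_cut_plane r assms in \<open>auto intro: holomorphic_intros\<close>)
qed

text \<open>Here \<open>nome_lim\<close> is a left inverse as well; \<open>lam\<close> is not
  injective, so this is confined to a disc about 0.\<close>

lemma local_inverse_lam:
  obtains \<delta> where "0 < \<delta>" "\<And>q. norm q < \<delta> \<Longrightarrow> norm (lam q) < 1 \<and> nome_lim (lam q) = q"
proof -
  obtain r \<rho> where r: "0 < r" "r < 1" "0 < \<rho>" "\<rho> < 1" "inj_on nome_lim (ball 0 r)" "ball 0 \<rho> \<subseteq> nome_lim ` ball 0 r"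
    using local_inverse_nome_lim .
  have "norm (lam q) < 1 \<and> nome_lim (lam q) = q" if q: "norm q < \<rho>" for q
  proof -
    obtain w where w: "w \<in> ball 0 r" "q = nome_lim w" using q r by force
    then have "w \<in> one_cut_plane" using r ball_subset_one_cut_plane by force
    then have "lam q = w" using w by (simp add: lam_nome_lim)
    then show ?thesis using w r by simp
  qed
  then show ?thesis using r that by blast
qed

subsection \<open>The inverse function as a covering of the twice punctured plane\<close>

text \<open>Schottky's theorem concerns the closed unit disc, so \<open>h\<close> is rescaled by a
  radius \<open>R'\<close> between that of \<open>K\<close> and \<open>R\<close>. The bound is the
  same for all \<open>h\<close>, which is the local boundedness required by Montel's
  theorem.\<close>

lemma Schottky_bounded_on_compact:
  assumes "compact K" "K \<subseteq> ball b R"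
  shows "\<exists>B. \<forall>h. h holomorphic_on ball b R \<longrightarrow> (\<forall>z\<in>ball b R. h z \<noteq> 0 \<and> h z \<noteq> 1) \<longrightarrow>
           norm (h b) \<le> 1 \<longrightarrow> (\<forall>z\<in>K. norm (h z) \<le> B)"
proof (cases "K = {}")
  case False
  have "continuous_on K (dist b)" by (intro continuous_intros)
  then obtain z0 where z0: "z0 \<in> K" "\<And>z. z \<in> K \<Longrightarrow> dist b z \<le> dist b z0"
    using continuous_attains_sup[OF assms(1) False] by blast
  define d where "d = dist b z0"
  define R' where "R' = (d + R) / 2"
  \<comment> \<open>\<open>t * R'\<close> is the midpoint of \<open>d\<close> and \<open>R'\<close>,
    hence \<open>t\<close> is positive even if \<open>K\<close> consists of the centre
    alone.\<close>
  define t where "t = (d + R') / (2 * R')"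
  have d: "0 \<le> d" "d < R" using z0(1) assms(2) by (auto simp: d_def)
  then have R': "d < R'" "R' < R" "0 < R'" by (auto simp: R'_def)
  then have "d * R' \<le> R' * R'" using d by (intro mult_right_mono) auto
  then have t: "0 < t" "t < 1" "dist b z0 \<le> t * R'"
    using d R' unfolding d_def[symmetric] by (auto simp: t_def field_simps)
  show ?thesis
  proof (rule exI, intro allI impI ballI)
    fix h z
    assume h: "h holomorphic_on ball b R" "\<forall>z\<in>ball b R. h z \<noteq> 0 \<and> h z \<noteq> 1" "norm (h b) \<le> 1"
      and z: "z \<in> K"
    define l where "l = (\<lambda>u. b + of_real R' * u)"
    have l: "l u \<in> ball b R" if "u \<in> cball 0 1" for u
    proof -
      have "R' * norm u \<le> R'" using that R' by (intro mult_left_le) auto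
      then have "R' * norm u < R" using R'(2) by linarith
      then show ?thesis using R' by (simp add: l_def dist_norm norm_mult)
    qed
    have "(h \<circ> l) holomorphic_on cball 0 1"
      by (rule holomorphic_on_compose_gen[OF _ h(1)]) (use l in \<open>auto simp: l_def intro!: holomorphic_intros\<close>)
    moreover have "norm ((h \<circ> l) 0) \<le> 1" using h by (simp add: l_def)
    moreover have "\<not> ((h \<circ> l) u = 0 \<or> (h \<circ> l) u = 1)" if "u \<in> cball 0 1" for u
      using h(2) l[OF that] by auto
    moreover have "norm ((z - b) / of_real R') \<le> t"
    proof -
      have "norm (z - b) \<le> t * R'" using z0(2)[OF z] t(3) by (simp add: dist_norm norm_minus_commute)
      then show ?thesis using R' by (simp add: norm_divide field_simps)
    qed
    ultimately have "norm ((h \<circ> l) ((z - b) / of_real R')) \<le> exp (pi * exp (pi * (2 + 2 * 1 + 12 * t / (1 - t))))"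
      using t(1,2) Schottky[of "h \<circ> l" 1 t "(z - b) / of_real R'"] by blast
    then show "norm (h z) \<le> exp (pi * exp (pi * (2 + 2 * 1 + 12 * t / (1 - t))))"
      using R' by (simp add: l_def)
  qed
qed simp

text \<open>A subsequence converges locally uniformly. Its limit vanishes at \<open>b\<close> while
  the functions have no zeros, so Hurwitz's theorem forces it to be identically 0.\<close>

lemma omitting_family_small:
  assumes hol: "\<And>n::nat. f n holomorphic_on ball b R"
    and omit: "\<And>n z. z \<in> ball b R \<Longrightarrow> f n z \<noteq> 0 \<and> f n z \<noteq> 1"
    and lim: "(\<lambda>n. f n b) \<longlonglongrightarrow> 0" and "0 < r" "r < R" "0 < e"
  shows "\<exists>n\<ge>N. \<forall>z\<in>ball b r. norm (f n z) < e"
proof -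
  have "\<forall>\<^sub>F n in sequentially. norm (f n b) < 1"
    using tendsto_norm[OF lim] by (intro order_tendstoD) auto
  then obtain M where M: "\<And>n. n \<ge> M \<Longrightarrow> norm (f n b) < 1" by (auto simp: eventually_sequentially)
  \<comment> \<open>The shift by \<open>M\<close> makes the values at \<open>b\<close> at most 1 in
    norm, as the bound from Schottky's theorem requires; the shift by \<open>N\<close> makes the
    index found large.\<close>
  define F where "F n = f (n + M + N)" for n
  define H where "H = {h. h holomorphic_on ball b R \<and> (\<forall>z\<in>ball b R. h z \<noteq> 0 \<and> h z \<noteq> 1) \<and> norm (h b) \<le> 1}"
  obtain g \<rho> where g: "g holomorphic_on ball b R" "strict_mono (\<rho> :: nat \<Rightarrow> nat)"
      "\<And>x. x \<in> ball b R \<Longrightarrow> (\<lambda>n. F (\<rho> n) x) \<longlonglongrightarrow> g x"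
      "\<And>K. compact K \<Longrightarrow> K \<subseteq> ball b R \<Longrightarrow> uniform_limit K (F \<circ> \<rho>) g sequentially"
  proof (rule Montel[of "ball b R" H F])
    show "\<exists>B. \<forall>h\<in>H. \<forall>z\<in>K. norm (h z) \<le> B" if "compact K" "K \<subseteq> ball b R" for K
      using Schottky_bounded_on_compact[OF that] unfolding H_def by blast
    show "range F \<subseteq> H"
      using hol omit M by (auto simp: H_def F_def intro: less_imp_le)
  qed (auto simp: H_def)
  have b: "b \<in> ball b R" using assms by auto
  have "(\<lambda>n. F (\<rho> n) b) \<longlonglongrightarrow> 0"
  proof -
    have "(\<lambda>n. F n b) \<longlonglongrightarrow> 0"
      unfolding F_def using LIMSEQ_ignore_initial_segment[OF lim, of "M + N"] by (simp add: add.assoc)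
    then show ?thesis using LIMSEQ_subseq_LIMSEQ[OF _ g(2)] by (auto simp: o_def)
  qed
  then have gb: "g b = 0" using g(3)[OF b] LIMSEQ_unique by blast
  have "g constant_on ball b R"
  proof (rule ccontr)
    assume "\<not> g constant_on ball b R"
    then have "g b \<noteq> 0"
      by (rule Hurwitz_no_zeros[of "ball b R" "F \<circ> \<rho>" g b, rotated 5])
         (use g hol omit b in \<open>auto simp: F_def\<close>)
    then show False using gb by simp
  qed
  then have g0: "g z = 0" if "z \<in> ball b R" for z
    using that b gb by (auto simp: constant_on_def)
  have "\<forall>\<^sub>F n in sequentially. \<forall>z\<in>cball b r. dist ((F \<circ> \<rho>) n z) (g z) < e"
    using assms by (intro uniform_limitD[OF g(4)]) auto
  then obtain n where n: "\<forall>z\<in>cball b r. dist ((F \<circ> \<rho>) n z) (g z) < e"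
    by (auto simp: eventually_sequentially)
  have "norm (f (\<rho> n + M + N) z) < e" if "z \<in> ball b r" for z
    using n[rule_format, of z] g0[of z] that assms(5) by (simp add: F_def)
  then show ?thesis by (intro exI[of _ "\<rho> n + M + N"]) auto
qed

section \<open>Continuation of inverse branches of \<open>lam\<close>\<close>

lemma sign_of_squares:
  assumes "x\<^sup>2 = (y :: complex)\<^sup>2"
  obtains e :: complex where "e = 1 \<or> e = - 1" "e * x = y"
  using assms that[of 1] that[of "- 1"] by (auto simp: power2_eq_iff)

lemma power_2_power_Suc: "(x :: 'a :: monoid_mult) ^ 2 ^ Suc n = (x ^ 2 ^ n)\<^sup>2"
  using power_mult[of x "2 ^ n" 2] by (simp add: mult.commute)

text \<open>One step down the tower. Since \<open>1 - phi1 k\<close> is the square of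
  \<open>(1 - k) / (1 + k)\<close>, a root \<open>s\<close> of \<open>1 - f\<close> gives
  \<open>k = (1 - s) / (1 + s)\<close>; the root exists because \<open>f\<close> omits 1. The square
  of \<open>k\<close> again omits 0 and 1, so the step can be repeated.\<close>

lemma lift_landen:
  assumes f: "f holomorphic_on ball b R" "\<And>z. z \<in> ball b R \<Longrightarrow> f z \<noteq> 0 \<and> f z \<noteq> 1"
    and R: "0 < R" and c: "norm c < 1" "f b = lam c"
  obtains k where "k holomorphic_on ball b R" "k b = kap c"
    "\<And>z. z \<in> ball b R \<Longrightarrow> phi1 (k z) = f z \<and> (k z)\<^sup>2 \<noteq> 0 \<and> (k z)\<^sup>2 \<noteq> 1"
proof -
  have "(\<lambda>z. 1 - f z) holomorphic_on ball b R" by (intro holomorphic_intros f)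
  then obtain s0 where s0: "s0 holomorphic_on ball b R" "\<And>z. z \<in> ball b R \<Longrightarrow> 1 - f z = (s0 z)\<^sup>2"
    using contractible_imp_holomorphic_sqrt[of "\<lambda>z. 1 - f z" "ball b R"]
      convex_imp_contractible[OF convex_ball] f(2) by (metis eq_iff_diff_eq_0)
  define d where "d = (1 - kap c) / (1 + kap c)"
  have "1 - f b = d\<^sup>2" using one_minus_phi1 kap_neq[OF c(1)] by (simp add: c lam_def d_def)
  then have "(s0 b)\<^sup>2 = d\<^sup>2" using s0(2)[of b] R by simp
  then obtain \<epsilon> where \<epsilon>: "\<epsilon> = 1 \<or> \<epsilon> = (-1::complex)" "\<epsilon> * s0 b = d"
    by (rule sign_of_squares)
  define s where "s = (\<lambda>z. \<epsilon> * s0 z)"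
  have s: "s holomorphic_on ball b R" unfolding s_def by (intro holomorphic_intros s0)
  have sq: "(s z)\<^sup>2 = 1 - f z" if "z \<in> ball b R" for z
    using s0(2)[OF that] \<epsilon>(1) by (auto simp: s_def power_mult_distrib)
  have neq: "s z \<noteq> 0" "s z \<noteq> 1" "1 + s z \<noteq> 0" if "z \<in> ball b R" for z
    using sq[OF that] f(2)[OF that] by (auto simp: add_eq_0_iff)
  define k where "k = (\<lambda>z. (1 - s z) / (1 + s z))"
  have k_neq: "k z \<noteq> 0" "k z \<noteq> 1" "k z \<noteq> -1" if "z \<in> ball b R" for z
    using neq[OF that] by (auto simp: k_def divide_simps)
  have "phi1 (k z) = f z" if "z \<in> ball b R" for z
  proof -
    have "(1 - k z) / (1 + k z) = s z"
      using neq[OF that] by (simp add: k_def divide_simps)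
    then have "1 - phi1 (k z) = 1 - f z"
      using one_minus_phi1[OF k_neq(3)[OF that]] sq[OF that] by simp
    then show ?thesis by simp
  qed
  moreover have "k b = kap c"
  proof -
    have "1 + kap c \<noteq> 0" using kap_neq[OF c(1)] by (simp add: add_eq_0_iff)
    then have "1 - d = 2 * kap c / (1 + kap c)" "1 + d = 2 / (1 + kap c)"
      by (simp_all add: d_def field_simps)
    then show ?thesis using \<epsilon>(2) \<open>1 + kap c \<noteq> 0\<close> by (simp add: k_def s_def)
  qed
  moreover have "k holomorphic_on ball b R" unfolding k_def by (intro holomorphic_intros s neq)
  moreover have "(k z)\<^sup>2 \<noteq> 0 \<and> (k z)\<^sup>2 \<noteq> 1" if "z \<in> ball b R" for z
    using k_neq[OF that] by (auto simp: power2_eq_1_iff)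
  ultimately show ?thesis using that by blast
qed

text \<open>A germ of the inverse of \<open>lam\<close> is pushed down the Landen tower: it is continued at a level
  where, by Montel's theorem, the whole disc has been mapped close to the origin, and then the
  square roots are taken back.\<close>

lemma lam_section:
  assumes q: "norm q < 1" "q \<noteq> 0" "lam q = b" and r: "0 < r" "r < R"
    and omit: "0 \<notin> ball b R" "1 \<notin> ball b R"
  obtains s where "s holomorphic_on ball b r" "s b = q"
    "\<And>z. z \<in> ball b r \<Longrightarrow> norm (s z) < 1 \<and> s z \<noteq> 0 \<and> lam (s z) = z"
proof -
  \<comment> \<open>\<open>P n f\<close> describes the \<open>n\<close>-th Landen iterate of the
    identity, whose value at \<open>b\<close> tends to 0 with \<open>q ^ 2 ^ n\<close>.
    \<open>S\<close> records the modulus joining two levels, which is needed on the way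
    back.\<close>
  define P where "P = (\<lambda>n f. f holomorphic_on ball b R \<and>
      (\<forall>z\<in>ball b R. f z \<noteq> 0 \<and> f z \<noteq> 1) \<and> f b = lam (q ^ 2 ^ n) \<and> (n = 0 \<longrightarrow> f = (\<lambda>z. z)))"
  define S where "S = (\<lambda>n f f'. \<exists>k. k holomorphic_on ball b R \<and> k b = kap (q ^ 2 ^ n) \<and>
      (\<forall>z\<in>ball b R. phi1 (k z) = f z \<and> f' z = (k z)\<^sup>2))"
  have qn: "norm (q ^ 2 ^ n) < 1" for n using q by (simp add: norm_power power_less_one_iff)
  have "\<exists>f. \<forall>n::nat. P n (f n) \<and> S n (f n) (f (Suc n))"
  proof (rule dependent_nat_choice[where P = P and Q = "S"])
    have "P 0 (\<lambda>z. z)" using q omit by (auto simp: P_def intro: holomorphic_intros)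
    then show "\<exists>x. P 0 x" by blast
  next
    fix f n assume f: "P n f"
    obtain k where k: "k holomorphic_on ball b R" "k b = kap (q ^ 2 ^ n)"
      "\<And>z. z \<in> ball b R \<Longrightarrow> phi1 (k z) = f z \<and> (k z)\<^sup>2 \<noteq> 0 \<and> (k z)\<^sup>2 \<noteq> 1"
      using f r qn[of n] by (elim lift_landen[of f b R "q ^ 2 ^ n", rotated -1]) (auto simp: P_def)
    have "lam (q ^ 2 ^ Suc n) = (kap (q ^ 2 ^ n))\<^sup>2"
      using kap_square[OF qn[of n]] by (simp only: power_2_power_Suc)
    then have "P (Suc n) (\<lambda>z. (k z)\<^sup>2)"
      using k by (auto simp: P_def intro!: holomorphic_intros)
    moreover have "S n f (\<lambda>z. (k z)\<^sup>2)" using k by (auto simp: S_def)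
    ultimately show "\<exists>y. P (Suc n) y \<and> S n f y" by blast
  qed
  then obtain f where f: "\<And>n. P n (f n)" "\<And>n. S n (f n) (f (Suc n))" by blast
  have q_lim: "(\<lambda>n. q ^ 2 ^ n) \<longlonglongrightarrow> 0"
  proof -
    have "strict_mono (\<lambda>n::nat. (2::nat) ^ n)" by (simp add: strict_mono_def)
    then show ?thesis
      using LIMSEQ_subseq_LIMSEQ[OF LIMSEQ_power_zero[OF q(1)]] by (auto simp: o_def)
  qed
  have "isCont lam 0"
    using holomorphic_on_imp_continuous_on[OF holomorphic_lam] by (simp add: continuous_on_eq_continuous_at)
  then have "(\<lambda>n. lam (q ^ 2 ^ n)) \<longlonglongrightarrow> lam 0" using q_lim isCont_tendsto_compose by blast
  then have f_lim: "(\<lambda>n. f n b) \<longlonglongrightarrow> 0" using f(1) lam_eq_0_iff[of 0] by (simp add: P_def)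
  obtain \<delta> where \<delta>: "0 < \<delta>" "\<And>q. norm q < \<delta> \<Longrightarrow> norm (lam q) < 1 \<and> nome_lim (lam q) = q"
    using local_inverse_lam by blast
  have "\<forall>\<^sub>F n in sequentially. norm (q ^ 2 ^ n) < \<delta>"
    using tendsto_norm[OF q_lim] \<delta>(1) by (intro order_tendstoD) auto
  then obtain N where N: "\<And>n. n \<ge> N \<Longrightarrow> norm (q ^ 2 ^ n) < \<delta>" by (auto simp: eventually_sequentially)
  \<comment> \<open>The bound 1 makes \<open>nome_lim\<close> applicable on the whole disc at level
    \<open>n\<close>; \<open>n \<ge> N\<close> ensures that the branch takes the value
    \<open>q ^ 2 ^ n\<close> at \<open>b\<close> and not another preimage.\<close>
  obtain n where n: "n \<ge> N" "\<And>z. z \<in> ball b r \<Longrightarrow> norm (f n z) < 1"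
    using omitting_family_small[of f b R r 1 N] f(1) f_lim r unfolding P_def by auto
  have sub: "ball b r \<subseteq> ball b R" using r by auto
  have "\<exists>s. s holomorphic_on ball b r \<and> s b = q ^ 2 ^ m \<and>
     (\<forall>z\<in>ball b r. norm (s z) < 1 \<and> s z \<noteq> 0 \<and> lam (s z) = f m z)" if "m \<le> n" for m
    using that
  proof (induction m rule: inc_induct)
    case base
    have in_cut: "f n z \<in> one_cut_plane" if "z \<in> ball b r" for z
      using n(2)[OF that] ball_subset_one_cut_plane by auto
    have hol: "f n holomorphic_on ball b r" using f(1)[of n] sub by (auto simp: P_def intro: holomorphic_on_subset)
    have "(nome_lim \<circ> f n) holomorphic_on ball b r"
      by (rule holomorphic_on_compose_gen[OF hol holomorphic_nome_lim]) (use in_cut in auto)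
    moreover have "(nome_lim \<circ> f n) b = q ^ 2 ^ n" using f(1)[of n] \<delta>(2)[OF N[OF n(1)]] by (simp add: P_def)
    moreover have "norm ((nome_lim \<circ> f n) z) < 1 \<and> (nome_lim \<circ> f n) z \<noteq> 0 \<and> lam ((nome_lim \<circ> f n) z) = f n z" if "z \<in> ball b r" for z
      using in_cut[OF that] f(1)[of n] sub that norm_nome_lim_less_1 nome_lim_eq_0_iff lam_nome_lim by (auto simp: P_def)
    ultimately show ?case by blast
  next
    case (step m)
    then obtain s' where s': "s' holomorphic_on ball b r" "s' b = q ^ 2 ^ Suc m"
        "\<And>z. z \<in> ball b r \<Longrightarrow> norm (s' z) < 1 \<and> s' z \<noteq> 0 \<and> lam (s' z) = f (Suc m) z" by blast
    obtain k where k: "k holomorphic_on ball b R" "k b = kap (q ^ 2 ^ m)"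
        "\<And>z. z \<in> ball b R \<Longrightarrow> phi1 (k z) = f m z \<and> f (Suc m) z = (k z)\<^sup>2"
      using f(2)[of m] unfolding S_def by blast
    obtain s0 where s0: "s0 holomorphic_on ball b r" "\<And>z. z \<in> ball b r \<Longrightarrow> s' z = (s0 z)\<^sup>2"
      using contractible_imp_holomorphic_sqrt[OF s'(1)] convex_imp_contractible[OF convex_ball] s'(3) by metis
    have "(s0 b)\<^sup>2 = (q ^ 2 ^ m)\<^sup>2" using s0(2)[of b] s'(2) r by (simp add: power_2_power_Suc del: power_Suc)
    then obtain \<epsilon> where \<epsilon>: "\<epsilon> = 1 \<or> \<epsilon> = (-1::complex)" "\<epsilon> * s0 b = q ^ 2 ^ m"
      by (rule sign_of_squares)
    define s where "s = (\<lambda>z. \<epsilon> * s0 z)"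
    have s: "s holomorphic_on ball b r" unfolding s_def by (intro holomorphic_intros s0)
    have sq: "(s z)\<^sup>2 = s' z" if "z \<in> ball b r" for z
      using s0(2)[OF that] \<epsilon>(1) by (auto simp: s_def power_mult_distrib)
    have s1: "norm (s z) < 1" "s z \<noteq> 0" if "z \<in> ball b r" for z
    proof -
      have "norm (s z) ^ 2 < 1" using s'(3)[OF that] sq[OF that] by (metis norm_power)
      then show "norm (s z) < 1" by (simp add: power_less_one_iff abs_square_less_1)
      show "s z \<noteq> 0" using s'(3)[OF that] sq[OF that] by auto
    qed
    \<comment> \<open>Both sides are square roots of \<open>f (Suc m) z\<close> and agree at
      \<open>b\<close>; hence \<open>lam (s z) = phi1 (k z) = f m z\<close>.\<close>
    have "kap (s z) = k z" if "z \<in> ball b r" for z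
    proof (rule eq_if_square_eq[of "ball b r" "\<lambda>z. kap (s z)" k b])
      have "(kap \<circ> s) holomorphic_on ball b r"
        by (rule holomorphic_on_compose_gen[OF s holomorphic_kap]) (use s1 in auto)
      then show "continuous_on (ball b r) (\<lambda>z. kap (s z))"
        by (auto simp: o_def dest: holomorphic_on_imp_continuous_on)
      show "continuous_on (ball b r) k"
        using k(1) sub by (intro holomorphic_on_imp_continuous_on) (rule holomorphic_on_subset)
      show "(kap (s z))\<^sup>2 = (k z)\<^sup>2" if "z \<in> ball b r" for z
        using kap_square[OF s1(1)[OF that]] sq[OF that] s'(3)[OF that] k(3)[of z] sub that by auto
      show "k z \<noteq> 0" if "z \<in> ball b r" for z
        using k(3)[of z] f(1)[of "Suc m"] sub that by (auto simp: P_def)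
    qed (use r that k(2) \<epsilon>(2) in \<open>auto simp: s_def\<close>)
    then have "lam (s z) = f m z" if "z \<in> ball b r" for z
      using that k(3)[of z] sub by (auto simp: lam_def)
    then show ?case using s s1 \<epsilon>(2) by (intro exI[of _ s]) (auto simp: s_def)
  qed
  from this[of 0] obtain s where "s holomorphic_on ball b r" "s b = q"
     "\<forall>z\<in>ball b r. norm (s z) < 1 \<and> s z \<noteq> 0 \<and> lam (s z) = f 0 z" by auto
  then show ?thesis using that[of s] f(1)[of 0] by (auto simp: P_def)
qed

text \<open>The chain rule for \<open>lam (s x) = x\<close> shows that \<open>lam\<close> has
  nonzero derivative at \<open>s a\<close>, so it is injective near that point. The sections
  therefore agree near \<open>a\<close>, and the identity theorem finishes.\<close>

lemma lam_section_unique: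
  assumes "open T" "connected T" and s: "s holomorphic_on T" "s' holomorphic_on T"
    and sec: "\<And>z. z \<in> T \<Longrightarrow> norm (s z) < 1 \<and> lam (s z) = z" "\<And>z. z \<in> T \<Longrightarrow> norm (s' z) < 1 \<and> lam (s' z) = z"
    and a: "a \<in> T" "s a = s' a" and z: "z \<in> T"
  shows "s z = s' z"
proof -
  have "deriv lam (s a) \<noteq> 0"
  proof
    assume "deriv lam (s a) = 0"
    then have l: "(lam has_field_derivative 0) (at (s a))"
      using holomorphic_derivI[OF holomorphic_lam, of "s a"] sec(1)[OF a(1)] by simp
    have "(s has_field_derivative deriv s a) (at a)"
      using holomorphic_derivI[OF s(1) assms(1) a(1)] .
    from DERIV_chain2[OF l this] have "((\<lambda>x. lam (s x)) has_field_derivative 0) (at a)" by simp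
    then have "((\<lambda>x. x) has_field_derivative 0) (at a)"
      by (rule has_field_derivative_transform_within_open[OF _ assms(1) a(1)]) (use sec in auto)
    then show False using DERIV_unique[OF DERIV_ident] by force
  qed
  then obtain r where r: "r > 0" "ball (s a) r \<subseteq> ball 0 1" "inj_on lam (ball (s a) r)"
    using has_complex_derivative_locally_injective[OF holomorphic_lam] sec(1)[OF a(1)] by auto
  define U where "U = T \<inter> s -` ball (s a) r \<inter> (T \<inter> s' -` ball (s a) r)"
  have U: "open U" unfolding U_def
    using assms(1) s by (intro open_Int continuous_open_preimage holomorphic_on_imp_continuous_on) auto
  have "a \<in> U" using a r by (auto simp: U_def)
  have eq: "s x = s' x" if "x \<in> U" for x
    using that r(3) sec by (auto simp: U_def inj_on_def)
  show ?thesis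
  proof (rule analytic_continuation_open[of U T s s'])
    show "U \<noteq> {}" using \<open>a \<in> U\<close> by auto
    show "U \<subseteq> T" by (auto simp: U_def)
  qed (use U eq assms in auto)
qed

lemma lam_surj:
  assumes "w \<noteq> 0" "w \<noteq> 1"
  obtains q where "norm q < 1" "q \<noteq> 0" "lam q = w"
proof (cases "w \<in> one_cut_plane")
  case True
  then show ?thesis using that[of "nome_lim w"] norm_nome_lim_less_1 nome_lim_eq_0_iff lam_nome_lim assms by auto
next
  case False
  then have w: "Im w = 0" "1 < Re w" using assms by (auto simp: one_cut_plane_iff complex_eq_iff)
  define R where "R = Re w - 1"
  \<comment> \<open>A point \<open>w\<close> on the cut is reached from a point \<open>b\<close>
    above it, where \<open>nome_lim\<close> is available. As \<open>Re b - 1 = R\<close>, the disc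
    of radius \<open>R\<close> about \<open>b\<close> omits 0 and 1, and \<open>w\<close> is at
    distance \<open>R / 4\<close>.\<close>
  define b where "b = w + \<i> * of_real (R / 4)"
  have R: "R > 0" using w by (simp add: R_def)
  have b: "b \<in> one_cut_plane" "b \<noteq> 0" using w R by (auto simp: one_cut_plane_iff b_def complex_eq_iff)
  have "0 \<notin> ball b R" "1 \<notin> ball b R"
    using abs_Re_le_cmod[of b] abs_Re_le_cmod[of "b - 1"] w
    by (auto simp: dist_norm b_def R_def)
  then obtain s where "s holomorphic_on ball b (R / 2)" "s b = nome_lim b" and
      s: "\<And>z. z \<in> ball b (R / 2) \<Longrightarrow> norm (s z) < 1 \<and> s z \<noteq> 0 \<and> lam (s z) = z"
    using R norm_nome_lim_less_1 nome_lim_eq_0_iff lam_nome_lim b by (elim lam_section[of "nome_lim b" b "R / 2" R, rotated -1]) auto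
  have "w \<in> ball b (R / 2)" using R by (simp add: b_def dist_norm norm_mult)
  then show ?thesis using s that by blast
qed

text \<open>The sheets over a small disc \<open>T\<close> are the images of the sections through the
  points of the fibre over its centre. Every point over \<open>T\<close> lies on one of them, since
  sections extend over all of \<open>T\<close>; uniqueness of sections makes the sheets
  disjoint.\<close>

lemma covering_space_lam: "covering_space (ball 0 1 - {0}) lam (- {0, 1})"
  unfolding covering_space_def
proof (intro conjI ballI)
  let ?D = "ball 0 1 - {0 :: complex}"
  have cont: "continuous_on ?D lam"
    using holomorphic_on_imp_continuous_on[OF holomorphic_lam] continuous_on_subset by blast
  then show "continuous_on ?D lam" .
  show "lam ` ?D = - {0, 1}"
  proof
    show "lam ` ?D \<subseteq> - {0, 1}" using lam_eq_0_iff lam_neq_1 by auto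
    show "- {0, 1} \<subseteq> lam ` ?D"
    proof
      fix w :: complex assume "w \<in> - {0, 1}"
      then obtain q where "norm q < 1" "q \<noteq> 0" "lam q = w" using lam_surj by auto
      then show "w \<in> lam ` ?D" by auto
    qed
  qed
  fix p :: complex assume "p \<in> - {0, 1}"
  \<comment> \<open>With a quarter of the distance, the radius \<open>3 * \<rho>\<close> about any
    point of \<open>T\<close> avoids 0 and 1 while \<open>2 * \<rho>\<close> still covers
    \<open>T\<close>; \<open>lam_section\<close> needs the gap between the two.\<close>
  define \<rho> where "\<rho> = min (dist p 0) (dist p 1) / 4"
  have \<rho>: "\<rho> > 0" using \<open>p \<in> - {0, 1}\<close> by (simp add: \<rho>_def)
  define T where "T = ball p \<rho>"
  have T: "open T" "connected T" "p \<in> T" using \<rho> by (auto simp: T_def)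
  have omit: "0 \<notin> ball b (3 * \<rho>) \<and> 1 \<notin> ball b (3 * \<rho>)" if "b \<in> T" for b
  proof -
    have "dist p b < \<rho>" "4 * \<rho> \<le> dist p 0" "4 * \<rho> \<le> dist p 1" using that by (auto simp: T_def \<rho>_def)
    then show ?thesis using dist_triangle[of p 0 b] dist_triangle[of p 1 b] by auto
  qed
  have sec: "\<exists>s. s holomorphic_on T \<and> s (lam q) = q \<and> (\<forall>z\<in>T. norm (s z) < 1 \<and> s z \<noteq> 0 \<and> lam (s z) = z)"
    if q: "q \<in> ?D" "lam q \<in> T" for q
  proof -
    obtain s where s: "s holomorphic_on ball (lam q) (2 * \<rho>)" "s (lam q) = q"
        "\<And>z. z \<in> ball (lam q) (2 * \<rho>) \<Longrightarrow> norm (s z) < 1 \<and> s z \<noteq> 0 \<and> lam (s z) = z"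
      using lam_section[of q "lam q" "2 * \<rho>" "3 * \<rho>"] q \<rho> omit[OF q(2)] by auto
    have "T \<subseteq> ball (lam q) (2 * \<rho>)"
    proof
      fix z assume "z \<in> T"
      then show "z \<in> ball (lam q) (2 * \<rho>)"
        using q(2) dist_triangle[of "lam q" z p] by (simp add: T_def dist_commute)
    qed
    then show ?thesis using s by (intro exI[of _ s]) (auto intro: holomorphic_on_subset)
  qed
  define Fib where "Fib = {q \<in> ?D. lam q = p}"
  have "\<forall>q\<in>Fib. \<exists>s. s holomorphic_on T \<and> s p = q \<and> (\<forall>z\<in>T. norm (s z) < 1 \<and> s z \<noteq> 0 \<and> lam (s z) = z)"
    using sec T unfolding Fib_def by fastforce
  then obtain s where s: "\<And>q. q \<in> Fib \<Longrightarrow> s q holomorphic_on T" "\<And>q. q \<in> Fib \<Longrightarrow> s q p = q"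
      "\<And>q z. q \<in> Fib \<Longrightarrow> z \<in> T \<Longrightarrow> norm (s q z) < 1 \<and> s q z \<noteq> 0 \<and> lam (s q z) = z"
    by metis
  have uniq: "s q z = s' z" if "q \<in> Fib" "s' holomorphic_on T" "\<And>z. z \<in> T \<Longrightarrow> norm (s' z) < 1 \<and> lam (s' z) = z"
      "a \<in> T" "s q a = s' a" "z \<in> T" for q s' a z
    by (rule lam_section_unique[of T "s q" s' a z]) (use that s T in auto)
  have op: "open (s q ` T)" if "q \<in> Fib" for q
  proof (rule open_mapping_thm3[OF s(1)[OF that] T(1)])
    show "inj_on (s q) T" using s(3)[OF that] by (metis inj_onI)
  qed
  show "\<exists>T. p \<in> T \<and> openin (top_of_set (- {0, 1})) T \<and>
      (\<exists>v. \<Union> v = ?D \<inter> lam -` T \<and> (\<forall>u\<in>v. openin (top_of_set ?D) u) \<and> pairwise disjnt v \<and>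
         (\<forall>u\<in>v. \<exists>q. homeomorphism u T lam q))"
  proof (intro exI[of _ T] exI[of _ "(\<lambda>q. s q ` T) ` Fib"] conjI ballI)
    show "p \<in> T" by fact
    have "T \<subseteq> - {0, 1}" using omit \<rho> by force
    then show "openin (top_of_set (- {0, 1})) T" using T(1) by (rule open_subset)
    show "\<Union> ((\<lambda>q. s q ` T) ` Fib) = ?D \<inter> lam -` T"
    proof (intro equalityI subsetI)
      fix x assume "x \<in> \<Union> ((\<lambda>q. s q ` T) ` Fib)"
      then show "x \<in> ?D \<inter> lam -` T" using s(3) by auto
    next
      fix x assume x: "x \<in> ?D \<inter> lam -` T"
      then obtain s' where s': "s' holomorphic_on T" "s' (lam x) = x"
          "\<And>z. z \<in> T \<Longrightarrow> norm (s' z) < 1 \<and> s' z \<noteq> 0 \<and> lam (s' z) = z" using sec[of x] by auto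
      have F: "s' p \<in> Fib" using s'(3)[OF T(3)] by (auto simp: Fib_def)
      have "s (s' p) (lam x) = s' (lam x)"
        by (rule uniq[OF F s'(1) _ T(3) s(2)[OF F]]) (use x s' in auto)
      then have "x \<in> s (s' p) ` T" using x s'(2) by (intro image_eqI[of _ _ "lam x"]) auto
      then show "x \<in> \<Union> ((\<lambda>q. s q ` T) ` Fib)" using F by blast
    qed
    show "pairwise disjnt ((\<lambda>q. s q ` T) ` Fib)"
    proof (clarsimp simp: pairwise_def disjnt_iff)
      fix q q' z z' assume q: "q \<in> Fib" "q' \<in> Fib" "s q ` T \<noteq> s q' ` T" "z \<in> T" "z' \<in> T" "s q z = s q' z'"
      then have "z = z'" using s(3) by metis
      have "s q x = s q' x" if "x \<in> T" for x
        by (rule uniq[of q "s q'" z]) (use q s that \<open>z = z'\<close> in auto)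
      then show False using q(3) by force
    qed
  next
    fix u assume "u \<in> (\<lambda>q. s q ` T) ` Fib"
    then obtain q where q: "q \<in> Fib" "u = s q ` T" by auto
    have sub: "u \<subseteq> ?D" using q s(3) by auto
    then show "openin (top_of_set ?D) u" using op[OF q(1)] q(2) by (simp add: open_subset)
    have "homeomorphism u T lam (s q)"
    proof (rule homeomorphismI)
      show "continuous_on u lam" using sub by (rule continuous_on_subset[OF cont])
      show "continuous_on T (s q)" using s(1)[OF q(1)] by (rule holomorphic_on_imp_continuous_on)
    qed (use q s in auto)
    then show "\<exists>q. homeomorphism u T lam q" by blast
  qed
qed

subsection \<open>Lifts of curves emanating from the origin\<close>

text \<open>The starting point 0 is not in the base of the covering, so the lift is defined by hand:
  it starts at the centre of the disc and never returns there.\<close>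

definition lift_of :: "(real \<Rightarrow> complex) \<Rightarrow> (real \<Rightarrow> complex) \<Rightarrow> bool" where
  "lift_of g l \<longleftrightarrow> continuous_on {0..1} l \<and> l 0 = 0 \<and>
     (\<forall>t\<in>{0<..1}. l t \<in> ball 0 1 - {0}) \<and> (\<forall>t\<in>{0..1}. lam (l t) = g t)"

lemma lam_0 [simp]: "lam 0 = 0"
  by (simp add: lam_eq_0_iff)

lemma lift_of_norm_less_1: "lift_of g l \<Longrightarrow> t \<in> {0..1} \<Longrightarrow> norm (l t) < 1"
  by (cases "t = 0") (auto simp: lift_of_def)

text \<open>For short times both lifts equal \<open>nome_lim\<close> of the curve by
  \<open>local_inverse_lam\<close>. From a positive time on, the covering property applies.\<close>

lemma lift_unique:
  assumes l: "lift_of g l" "lift_of g l'" and t: "t \<in> {0..1}"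
  shows "l t = l' t"
proof (cases "t = 0")
  case False
  obtain \<delta> where \<delta>: "0 < \<delta>" "\<And>q. norm q < \<delta> \<Longrightarrow> norm (lam q) < 1 \<and> nome_lim (lam q) = q"
    using local_inverse_lam by blast
  have small: "\<exists>e>0. \<forall>t\<in>{0..1}. t < e \<longrightarrow> norm (k t) < \<delta>" if "lift_of g k" for k
  proof -
    have "continuous_on {0..1} k" "k 0 = 0" using that by (auto simp: lift_of_def)
    then obtain e where "e > 0" "\<forall>t\<in>{0..1}. dist t 0 < e \<longrightarrow> dist (k t) (k 0) < \<delta>"
      using \<delta>(1) unfolding continuous_on_iff by (metis atLeastAtMost_iff order_refl zero_le_one)
    then show ?thesis using \<open>k 0 = 0\<close> by (intro exI[of _ e]) (auto simp: dist_norm)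
  qed
  obtain e e' where e: "e > 0" "\<forall>t\<in>{0..1}. t < e \<longrightarrow> norm (l t) < \<delta>"
      "e' > 0" "\<forall>t\<in>{0..1}. t < e' \<longrightarrow> norm (l' t) < \<delta>"
    using small[OF l(1)] small[OF l(2)] by blast
  define a where "a = min 1 (min e e') / 2"
  have a: "0 < a" "a < e" "a < e'" "a \<in> {0..1}" using e by (auto simp: a_def)
  have "l a = nome_lim (lam (l a))" "l' a = nome_lim (lam (l' a))" using \<delta>(2) e a by auto
  then have la: "l a = l' a" using l a(4) by (simp add: lift_of_def)
  have cl: "continuous_on {0<..1} l" "continuous_on {0<..1} l'"
    using l by (auto simp: lift_of_def elim: continuous_on_subset)
  have "continuous_on {0<..1} (\<lambda>t. lam (l t))"
    by (rule continuous_on_compose2[OF holomorphic_on_imp_continuous_on[OF holomorphic_lam] cl(1)])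
       (use lift_of_norm_less_1[OF l(1)] in auto)
  then have cg: "continuous_on {0<..1} g"
    by (rule continuous_on_eq) (use l in \<open>auto simp: lift_of_def\<close>)
  have "g \<in> {0<..1} \<rightarrow> - {0, 1}"
  proof
    fix t :: real assume "t \<in> {0<..1}"
    then have "g t = lam (l t)" "norm (l t) < 1" "l t \<noteq> 0" using l(1) by (auto simp: lift_of_def)
    then show "g t \<in> - {0, 1}" by (simp add: lam_eq_0_iff lam_neq_1)
  qed
  then show ?thesis
    by (intro covering_space_lift_unique[OF covering_space_lam, of l a l' "{0<..1}" g t] la cg cl)
       (use l a t False in \<open>auto simp: lift_of_def\<close>)
qed (use l in \<open>auto simp: lift_of_def\<close>)

text \<open>Near the origin the lift is given by \<open>nome_lim\<close>; from there on the homotopy avoids the branch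
  value \<open>0\<close> and is lifted through the covering of the punctured disc.\<close>

lemma lift_homotopy:
  fixes H :: "real \<times> real \<Rightarrow> complex"
  assumes cont: "continuous_on ({0..1} \<times> {0..1}) H"
    and H0: "\<And>s. s \<in> {0..1} \<Longrightarrow> H (s, 0) = 0"
    and H: "\<And>s t. s \<in> {0..1} \<Longrightarrow> t \<in> {0<..1} \<Longrightarrow> H (s, t) \<notin> {0, 1}"
  obtains k where "continuous_on ({0..1} \<times> {0..1}) k" "\<And>s. s \<in> {0..1} \<Longrightarrow> lift_of (\<lambda>t. H (s, t)) (\<lambda>t. k (s, t))"
proof -
  have "uniformly_continuous_on ({0..1} \<times> {0..1}) H"
    using cont by (intro compact_uniformly_continuous compact_Times) auto
  then obtain d where d: "d > 0" "\<And>x x'. x \<in> {0..1} \<times> {0..1} \<Longrightarrow> x' \<in> {0..1} \<times> {0..1} \<Longrightarrow>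
      dist x' x < d \<Longrightarrow> dist (H x') (H x) < 1"
    unfolding uniformly_continuous_on_def by (metis zero_less_one)
  \<comment> \<open>Up to time \<open>e\<close>, for all \<open>s\<close> at once, the homotopy
    stays in the unit disc, where \<open>nome_lim\<close> lifts it.\<close>
  define e where "e = min (d / 2) (1 / 2)"
  have e: "0 < e" "e < 1" "e < d" using d by (auto simp: e_def)
  have small: "norm (H (s, t)) < 1" if "s \<in> {0..1}" "t \<in> {0..e}" for s t
    using d(2)[of "(s, 0)" "(s, t)"] H0[OF that(1)] that e by (simp add: dist_Pair_Pair)
  have cut: "H (s, t) \<in> one_cut_plane" if "s \<in> {0..1}" "t \<in> {0..e}" for s t
    using small[OF that] ball_subset_one_cut_plane by auto
  have contQ: "continuous_on one_cut_plane nome_lim" using holomorphic_nome_lim by (rule holomorphic_on_imp_continuous_on)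
  \<comment> \<open>Affine map of the unit interval onto \<open>{e..1}\<close>. In the lifting
    theorem time is the variable along which the lift is continued and \<open>s\<close> is the
    parameter, hence the exchanged coordinates.\<close>
  define \<tau> where "\<tau> = (\<lambda>u. e + u * (1 - e))"
  have \<tau>: "\<tau> u \<in> {0<..1}" if "u \<in> {0..1}" for u
  proof -
    have "u * (1 - e) \<le> 1 * (1 - e)" using that e by (intro mult_right_mono) auto
    then have "\<tau> u \<le> 1" unfolding \<tau>_def by simp
    moreover have "0 < \<tau> u" unfolding \<tau>_def using that e by (intro add_pos_nonneg) auto
    ultimately show ?thesis by simp
  qed
  obtain k' where k': "continuous_on ({0..1} \<times> {0..1}) k'"
      "k' \<in> {0..1} \<times> {0..1} \<rightarrow> ball 0 1 - {0}" "\<And>y. y \<in> {0..1} \<Longrightarrow> k' (0, y) = nome_lim (H (y, e))"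
      "\<And>z. z \<in> {0..1} \<times> {0..1} \<Longrightarrow> H (snd z, \<tau> (fst z)) = lam (k' z)"
  proof (rule covering_space_lift_homotopy[OF covering_space_lam, of "{0..1}" "\<lambda>z. H (snd z, \<tau> (fst z))" "\<lambda>y. nome_lim (H (y, e))"])
    show "continuous_on ({0..1} \<times> {0..1}) (\<lambda>z. H (snd z, \<tau> (fst z)))"
      by (rule continuous_on_compose2[OF cont]) (use \<tau> in \<open>force simp: \<tau>_def intro!: continuous_intros\<close>)+
    show "(\<lambda>z. H (snd z, \<tau> (fst z))) \<in> {0..1} \<times> {0..1} \<rightarrow> - {0, 1}"
      using H \<tau> by fastforce
    show "H (snd (0, y), \<tau> (fst (0, y))) = lam (nome_lim (H (y, e)))" if "y \<in> {0..1}" for y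
      using lam_nome_lim[OF cut[OF that, of e]] e by (simp add: \<tau>_def)
    show "continuous_on {0..1} (\<lambda>y. nome_lim (H (y, e)))"
    proof (rule continuous_on_compose2[OF contQ])
      show "continuous_on {0..1} (\<lambda>y. H (y, e))"
        by (rule continuous_on_compose2[OF cont]) (use e in \<open>auto intro!: continuous_intros\<close>)
    qed (use cut e in auto)
    show "(\<lambda>y. nome_lim (H (y, e))) \<in> {0..1} \<rightarrow> ball 0 1 - {0}"
      using cut[of _ e] H[of _ e] e norm_nome_lim_less_1 nome_lim_eq_0_iff by fastforce
  qed blast
  define \<sigma> where "\<sigma> = (\<lambda>t. (t - e) / (1 - e))"
  have \<sigma>: "\<sigma> t \<in> {0..1}" "\<tau> (\<sigma> t) = t" if "t \<in> {e..1}" for t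
    using that e by (auto simp: \<sigma>_def \<tau>_def divide_simps)
  define k where "k = (\<lambda>z. if snd z \<le> e then nome_lim (H z) else k' (\<sigma> (snd z), fst z))"
  have "continuous_on ({0..1} \<times> {0..1}) k"
    unfolding k_def
  proof (rule continuous_on_cases_le)
    show "continuous_on {x \<in> {0..1} \<times> {0..1}. snd x \<le> e} (\<lambda>z. nome_lim (H z))"
      by (rule continuous_on_compose2[OF contQ continuous_on_subset[OF cont]]) (use cut in auto)
    show "continuous_on {x \<in> {0..1} \<times> {0..1}. e \<le> snd x} (\<lambda>z. k' (\<sigma> (snd z), fst z))"
      by (rule continuous_on_compose2[OF k'(1)])
         (use \<sigma>(1) e in \<open>auto simp: \<sigma>_def intro!: continuous_intros\<close>)
    show "continuous_on ({0..1} \<times> {0..1}) (snd :: real \<times> real \<Rightarrow> real)" by (intro continuous_intros)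
    show "nome_lim (H x) = k' (\<sigma> (snd x), fst x)" if "x \<in> {0..1} \<times> {0..1}" "snd x = e" for x
    proof -
      have "x = (fst x, e)" "\<sigma> (snd x) = 0" using that by (auto simp: \<sigma>_def prod_eq_iff)
      then show ?thesis using k'(3)[of "fst x"] that by (metis mem_Times_iff)
    qed
  qed
  moreover have "lift_of (\<lambda>t. H (s, t)) (\<lambda>t. k (s, t))" if s: "s \<in> {0..1}" for s
    unfolding lift_of_def
  proof (intro conjI ballI)
    show "continuous_on {0..1} (\<lambda>t. k (s, t))"
      by (rule continuous_on_compose2[OF \<open>continuous_on _ k\<close>]) (use s in \<open>auto intro!: continuous_intros\<close>)
    show "k (s, 0) = 0" using e H0[OF s] by (simp add: k_def)
    show "k (s, t) \<in> ball 0 1 - {0}" if t: "t \<in> {0<..1}" for t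
    proof (cases "t \<le> e")
      case True
      then show ?thesis using cut[OF s, of t] H[OF s t] t norm_nome_lim_less_1 nome_lim_eq_0_iff by (auto simp: k_def)
    next
      case False
      then have "(\<sigma> t, s) \<in> {0..1} \<times> {0..1}" using \<sigma>(1)[of t] s t by auto
      then show ?thesis using k'(2) False by (auto simp: k_def)
    qed
    show "lam (k (s, t)) = H (s, t)" if t: "t \<in> {0..1}" for t
    proof (cases "t \<le> e")
      case True
      then show ?thesis using cut[OF s, of t] t lam_nome_lim by (auto simp: k_def)
    next
      case False
      then have "(\<sigma> t, s) \<in> {0..1} \<times> {0..1}" "\<tau> (\<sigma> t) = t" using \<sigma>[of t] s t by auto
      then show ?thesis using k'(4)[of "(\<sigma> t, s)"] False by (simp add: k_def)
    qed
  qed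
  ultimately show ?thesis using that by blast
qed

lemma lift_exists:
  assumes "g \<in> omega_curves"
  obtains l where "lift_of g l"
proof -
  have g: "continuous_on {0..1} g" "g 0 = 0" "\<And>t. t \<in> {0<..1} \<Longrightarrow> g t \<notin> {0, 1}"
    using assms by (auto simp: omega_curves_def omega_admissible_def path_def)
  obtain k where k: "\<And>s. s \<in> {0..1} \<Longrightarrow> lift_of (\<lambda>t. g (snd (s :: real, t))) (\<lambda>t. k (s, t))"
  proof (rule lift_homotopy[of "\<lambda>x. g (snd x)"])
    show "continuous_on ({0..1} \<times> {0..1}) (\<lambda>x. g (snd x))"
      by (rule continuous_on_compose2[OF g(1)]) (auto intro!: continuous_intros)
  qed (use g in auto)
  from k[of 0] show ?thesis using that by simp
qed

lemma lift_of_mem: "lift_of g l \<Longrightarrow> l 1 \<in> ball 0 1 - {0} \<and> lam (l 1) = g 1"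
  by (auto simp: lift_of_def)

text \<open>The end point is tied to the first argument, so symmetry and transitivity need
  \<open>omega_homotopic_endpoint\<close>.\<close>

abbreviation omega_homotopic :: "(real \<Rightarrow> complex) \<Rightarrow> (real \<Rightarrow> complex) \<Rightarrow> bool" where
  "omega_homotopic g h \<equiv> homotopic_with_canon (\<lambda>k. omega_admissible k \<and> k 1 = g 1) {0..1} UNIV g h"

lemma omega_homotopic_endpoint: "omega_homotopic g h \<Longrightarrow> h 1 = g 1"
  using homotopic_with_imp_property[of "\<lambda>k. omega_admissible k \<and> k 1 = g 1" _ _ g h] by blast

lemma omega_homotopic_imp_curves:
  assumes "omega_homotopic g h"
  shows "g \<in> omega_curves" "h \<in> omega_curves"
  using homotopic_with_imp_property[OF assms] homotopic_with_imp_continuous[OF assms]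
  by (auto simp: omega_curves_def path_def)

lemma omega_homotopic_refl: "g \<in> omega_curves \<Longrightarrow> omega_homotopic g g"
  by (simp add: omega_curves_def path_def)

lemma omega_homotopic_sym: "omega_homotopic g h \<Longrightarrow> omega_homotopic h g"
  using homotopic_with_symD[of "\<lambda>k. omega_admissible k \<and> k 1 = g 1" _ _ g h] omega_homotopic_endpoint[of g h]
  by simp

lemma omega_homotopic_trans:
  assumes "omega_homotopic g h" "omega_homotopic h k"
  shows "omega_homotopic g k"
proof -
  have "homotopic_with_canon (\<lambda>k. omega_admissible k \<and> k 1 = g 1) {0..1} UNIV h k"
    using assms(2) omega_homotopic_endpoint[OF assms(1)] by simp
  then show ?thesis by (rule homotopic_with_trans[OF assms(1)])
qed

lemma omega_class_eq_iff:
  assumes "g \<in> omega_curves"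
  shows "omega_class g = omega_class h \<longleftrightarrow> omega_homotopic g h"
proof
  assume "omega_class g = omega_class h"
  moreover have "g \<in> omega_class g"
    using omega_homotopic_refl[OF assms] by (simp only: omega_class_def mem_Collect_eq)
  ultimately have "g \<in> omega_class h" by simp
  then have "omega_homotopic h g" by (simp only: omega_class_def mem_Collect_eq)
  then show "omega_homotopic g h" by (rule omega_homotopic_sym)
next
  assume h: "omega_homotopic g h"
  show "omega_class g = omega_class h"
  proof (intro equalityI subsetI)
    show "k \<in> omega_class h" if "k \<in> omega_class g" for k
      using omega_homotopic_trans[OF omega_homotopic_sym[OF h], of k] that
      by (simp only: omega_class_def mem_Collect_eq)
    show "k \<in> omega_class g" if "k \<in> omega_class h" for k
      using omega_homotopic_trans[OF h, of k] that by (simp only: omega_class_def mem_Collect_eq)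
  qed
qed

text \<open>The end points of the lifted curves form a lift of a constant path, hence do not
  move.\<close>

lemma omega_homotopic_imp_lift_eq:
  assumes "omega_homotopic g g'" "lift_of g l" "lift_of g' l'"
  shows "l 1 = l' 1"
proof -
  obtain h where "continuous_map (prod_topology (top_of_set {0..1::real}) (top_of_set {0..1::real})) (top_of_set UNIV) h"
     and h: "\<forall>t. h (0, t) = g t" "\<forall>t. h (1, t) = g' t"
     "\<forall>s\<in>{0..1}. omega_admissible (\<lambda>t. h (s, t)) \<and> h (s, 1) = g 1"
    using assms(1) unfolding homotopic_with_def by blast
  then have h: "continuous_on ({0..1} \<times> {0..1}) h" "\<And>t. h (0, t) = g t" "\<And>t. h (1, t) = g' t"
     "\<And>s. s \<in> {0..1} \<Longrightarrow> omega_admissible (\<lambda>t. h (s, t)) \<and> h (s, 1) = g 1"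
    by auto
  obtain k where k: "continuous_on ({0..1} \<times> {0..1}) k" "\<And>s. s \<in> {0..1} \<Longrightarrow> lift_of (\<lambda>t. h (s, t)) (\<lambda>t. k (s, t))"
    using lift_homotopy[of h] h(1,4) by (auto simp: omega_admissible_def)
  have "lift_of g (\<lambda>t. k (0, t))" "lift_of g' (\<lambda>t. k (1, t))" using k(2)[of 0] k(2)[of 1] h(2,3) by auto
  then have "l 1 = k (0, 1)" "l' 1 = k (1, 1)"
    using lift_unique[OF assms(2), of _ 1] lift_unique[OF assms(3), of _ 1] by auto
  moreover have "k (0, 1) = k (1, 1)"
  proof (rule covering_space_lift_unique[OF covering_space_lam, of "\<lambda>_. k (0, 1)" 0 "\<lambda>s. k (s, 1)" "{0..1::real}" "\<lambda>_. g 1" 1])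
    show "continuous_on {0..1} (\<lambda>s. k (s, 1))"
      by (rule continuous_on_compose2[OF k(1)]) (auto intro!: continuous_intros)
    show "(\<lambda>s. k (s, 1)) \<in> {0..1} \<rightarrow> ball 0 1 - {0}" using k(2) lift_of_mem by fastforce
    show "g 1 = lam (k (s, 1))" if "s \<in> {0..1}" for s
      using lift_of_mem[OF k(2)[OF that]] h(4)[OF that] by auto
    show "g 1 = lam (k (0, 1))" "(\<lambda>_. k (0, 1)) \<in> {0..1} \<rightarrow> ball 0 1 - {0}"
      using lift_of_mem[OF k(2)[of 0]] h(4)[of 0] by auto
    show "(\<lambda>_. g 1) \<in> {0..1::real} \<rightarrow> - {0, 1}"
      using h(4)[of 0] by (auto simp: omega_admissible_def)
  qed auto
  ultimately show ?thesis by simp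
qed

text \<open>The image of a radius of the disc; it will represent the point of \<open>Omega\<close>
  that corresponds to \<open>q\<close>.\<close>

definition ray :: "complex \<Rightarrow> real \<Rightarrow> complex" where
  "ray q t = lam (of_real t * q)"

lemma lift_of_ray:
  assumes "norm q < 1" "q \<noteq> 0"
  shows "lift_of (ray q) (\<lambda>t. of_real t * q)"
proof -
  have "t * norm q < 1" if "t \<in> {0<..1}" for t
  proof -
    have "t * norm q \<le> 1 * norm q" using that by (intro mult_right_mono) auto
    then show ?thesis using assms by linarith
  qed
  then show ?thesis
    using assms by (auto simp: lift_of_def ray_def norm_mult intro!: continuous_intros)
qed

lemma lift_of_imp_curve:
  assumes "lift_of g l"
  shows "g \<in> omega_curves"
proof -
  have "continuous_on {0..1} (\<lambda>t. lam (l t))"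
    by (rule continuous_on_compose2[OF holomorphic_on_imp_continuous_on[OF holomorphic_lam]])
       (use assms lift_of_norm_less_1[OF assms] in \<open>auto simp: lift_of_def\<close>)
  then have "continuous_on {0..1} g"
    by (rule continuous_on_eq) (use assms in \<open>auto simp: lift_of_def\<close>)
  moreover have "g t \<notin> {0, 1}" if "t \<in> {0<..1}" for t
  proof -
    have "g t = lam (l t)" "norm (l t) < 1" "l t \<noteq> 0" using assms that by (auto simp: lift_of_def)
    then show ?thesis by (simp add: lam_eq_0_iff lam_neq_1)
  qed
  moreover have "g 0 = 0"
  proof -
    have "lam (l 0) = g 0" "l 0 = 0" using assms unfolding lift_of_def by force+
    then show ?thesis by simp
  qed
  ultimately show ?thesis by (simp add: omega_curves_def omega_admissible_def path_def)
qed

text \<open>The punctured disc is not simply connected, but a curve emanating from the puncture has a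
  continuous logarithm, and the straight-line homotopy of logarithms is continuous at the puncture.\<close>

lemma omega_homotopic_ray:
  assumes "lift_of g l"
  shows "omega_homotopic g (ray (l 1))"
proof -
  have l: "continuous_on {0..1} l" "l 0 = 0" "\<And>t. t \<in> {0<..1} \<Longrightarrow> norm (l t) < 1 \<and> l t \<noteq> 0"
      "\<And>t. t \<in> {0..1} \<Longrightarrow> lam (l t) = g t"
    using assms by (auto simp: lift_of_def)
  obtain u where u: "continuous_on {0<..1} u" "\<And>t. t \<in> {0<..1} \<Longrightarrow> l t = exp (u t)"
  proof (rule continuous_logarithm_on_contractible[of "{0<..1}" l])
    show "continuous_on {0<..1} l" using l(1) by (rule continuous_on_subset) auto
    show "contractible {0<..1::real}" by (rule convex_imp_contractible) simp
  qed (use l(3) in auto)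
  define q where "q = l 1"
  have q: "norm q < 1" "q \<noteq> 0" "q = exp (u 1)" using l(3)[of 1] u(2)[of 1] by (auto simp: q_def)
  have Re_u: "Re (u t) = ln (norm (l t))" "Re (u t) < 0" if "t \<in> {0<..1}" for t
    using u(2)[OF that] l(3)[OF that] by auto
  \<comment> \<open>Interpolates between the logarithms of \<open>l t\<close> and of
    \<open>t * q\<close>. Both have real part tending to minus infinity at 0, so the value 0 there
    is the continuous choice.\<close>
  define k where "k = (\<lambda>(s, t). if t = 0 then 0 else
      exp (of_real (1 - s) * u t + of_real s * (u 1 + of_real (ln t))))"
  have k_pos: "k (s, t) = exp (of_real (1 - s) * u t + of_real s * (u 1 + of_real (ln t)))"
    if "t > 0" for s t using that by (simp add: k_def)
  \<comment> \<open>The norm is a weighted geometric mean of \<open>norm (l t)\<close> and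
    \<open>t * norm q\<close>, hence at most the larger of them. This gives continuity at
    \<open>t = 0\<close>.\<close>
  have k_norm: "norm (k (s, t)) \<le> norm (l t) + t" "t > 0 \<Longrightarrow> norm (k (s, t)) < 1"
    if "s \<in> {0..1}" "t \<in> {0..1}" for s t
  proof -
    have *: "norm (k (s, t)) \<le> norm (l t) + t \<and> norm (k (s, t)) < 1" if t: "t > 0"
    proof -
      define a where "a = Re (u t)"
      define b where "b = Re (u 1) + ln t"
      have t1: "t \<in> {0<..1}" using t \<open>t \<in> {0..1}\<close> by auto
      have ab: "a < 0" "b < 0" "exp a = norm (l t)" "exp b \<le> t"
        using Re_u[OF t1] Re_u[of 1] l(3)[OF t1] t1 by (auto simp: a_def b_def exp_add add_neg_nonpos mult_left_le_one_le)
      have n: "norm (k (s, t)) = exp ((1 - s) * a + s * b)" using t by (simp add: k_pos a_def b_def)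
      have "(1 - s) * a + s * b \<le> (1 - s) * max a b + s * max a b"
        using \<open>s \<in> {0..1}\<close> by (intro add_mono mult_left_mono) auto
      then have le: "(1 - s) * a + s * b \<le> max a b" by (simp add: algebra_simps)
      then have "exp ((1 - s) * a + s * b) \<le> max (exp a) (exp b)" by (auto simp: max_def split: if_splits)
      moreover have "exp b \<le> norm (l t) + t" using ab(4) norm_ge_zero[of "l t"] by linarith
      then have "max (exp a) (exp b) \<le> norm (l t) + t" using ab t by auto
      moreover have "exp ((1 - s) * a + s * b) < 1" using le ab by auto
      ultimately show ?thesis unfolding n by linarith
    qed
    show "norm (k (s, t)) \<le> norm (l t) + t"
      using * that l(2) by (cases "t = 0") (auto simp: k_def)
    show "t > 0 \<Longrightarrow> norm (k (s, t)) < 1" using * by blast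
  qed
  let ?S = "{0..1::real} \<times> {0..1::real}"
  have k_cont: "continuous_on ?S k"
    unfolding continuous_on_def
  proof
    fix x assume x: "x \<in> ?S"
    show "(k \<longlongrightarrow> k x) (at x within ?S)"
    proof (cases "snd x = 0")
      case False
      define U :: "(real \<times> real) set" where "U = {x. 0 < snd x}"
      have U: "open U" unfolding U_def by (intro open_Collect_less continuous_intros)
      have "continuous_on (?S \<inter> U) (\<lambda>x. exp (of_real (1 - fst x) * u (snd x) + of_real (fst x) * (u 1 + of_real (ln (snd x)))))"
        by (intro continuous_intros continuous_on_compose2[OF u(1)]) (auto simp: U_def)
      then have "continuous_on (?S \<inter> U) k"
        by (rule continuous_on_eq) (auto simp: U_def k_pos)
      then have "(k \<longlongrightarrow> k x) (at x within (?S \<inter> U))"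
        using x False by (auto simp: continuous_on_def U_def)
      moreover have "at x within (?S \<inter> U) = at x within ?S"
        by (rule at_within_nhd[of _ U]) (use x False U in \<open>auto simp: U_def\<close>)
      ultimately show ?thesis by simp
    next
      case True
      have kx: "k x = 0" using True by (cases x) (simp add: k_def)
      have "((\<lambda>y. norm (l (snd y)) + snd y) \<longlongrightarrow> norm (l (snd x)) + snd x) (at x within ?S)"
      proof -
        have "continuous_on ?S (\<lambda>y. norm (l (snd y)) + snd y)"
          by (intro continuous_intros continuous_on_compose2[OF l(1)]) auto
        then show ?thesis using x unfolding continuous_on_def by blast
      qed
      then have "((\<lambda>y. norm (l (snd y)) + snd y) \<longlongrightarrow> 0) (at x within ?S)" using True l(2) by simp
      then have "(k \<longlongrightarrow> 0) (at x within ?S)"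
        by (rule Lim_null_comparison[rotated])
           (use k_norm(1) in \<open>auto simp: eventually_at_filter intro!: always_eventually\<close>)
      then show ?thesis using kx by simp
    qed
  qed
  have k_lt: "norm (k x) < 1" if "x \<in> ?S" for x
  proof -
    obtain s t where x: "x = (s, t)" by (cases x)
    show ?thesis using k_norm(2)[of s t] that unfolding x by (cases "t = 0") (auto simp: k_def)
  qed
  show ?thesis
  proof (subst homotopic_with)
    show "(omega_admissible h \<and> h 1 = g 1) = (omega_admissible k \<and> k 1 = g 1)"
      if "\<And>x. x \<in> topspace (top_of_set {0..1}) \<Longrightarrow> h x = k x" for h k
      using that by (auto simp: omega_admissible_def)
    show "\<exists>h. continuous_map (prod_topology (top_of_set {0..1::real}) (top_of_set {0..1::real})) (top_of_set UNIV) h \<and>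
        (\<forall>x\<in>topspace (top_of_set {0..1}). h (0, x) = g x) \<and>
        (\<forall>x\<in>topspace (top_of_set {0..1}). h (1, x) = ray (l 1) x) \<and>
        (\<forall>t\<in>{0..1}. omega_admissible (\<lambda>x. h (t, x)) \<and> h (t, 1) = g 1)"
    proof (intro exI[of _ "\<lambda>x. lam (k x)"] conjI ballI)
      have "continuous_on ?S (\<lambda>x. lam (k x))"
        by (rule continuous_on_compose2[OF holomorphic_on_imp_continuous_on[OF holomorphic_lam] k_cont])
           (use k_lt in auto)
      then show "continuous_map (prod_topology (top_of_set {0..1}) (top_of_set {0..1})) (top_of_set UNIV) (\<lambda>x. lam (k x))"
        by simp
    next
      fix t :: real assume "t \<in> topspace (top_of_set {0..1})"
      then have t: "t \<in> {0..1}" by simp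
      have "k (0, t) = l t" using t u(2)[of t] l(2) by (cases "t = 0") (auto simp: k_def)
      then show "lam (k (0, t)) = g t" using l(4)[OF t] by simp
      have "k (1, t) = of_real t * q"
        using t q(3) by (cases "t = 0") (auto simp: k_def exp_add exp_of_real mult.commute)
      then show "lam (k (1, t)) = ray (l 1) t" by (simp add: ray_def q_def)
    next
      fix s :: real assume s: "s \<in> {0..1}"
      have "lam (k (s, t)) \<notin> {0, 1}" if "t \<in> {0<..1}" for t
      proof -
        have "k (s, t) \<noteq> 0" "norm (k (s, t)) < 1" using that k_lt[of "(s, t)"] s by (auto simp: k_pos)
        then show ?thesis by (simp add: lam_eq_0_iff lam_neq_1)
      qed
      then show "omega_admissible (\<lambda>x. lam (k (s, x)))" by (simp add: omega_admissible_def k_def)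
      have "k (s, 1) = q" using q(3) by (simp add: k_def algebra_simps)
      then show "lam (k (s, 1)) = g 1" using l(4)[of 1] by (simp add: q_def)
    qed
  qed
qed

subsection \<open>The uniformization of Omega\<close>

text \<open>The candidate for the inverse of the uniformization.\<close>

definition Phi :: "complex \<Rightarrow> (real \<Rightarrow> complex) set" where
  "Phi q = (if q = 0 then omega_origin else omega_class (ray q))"

lemma omega_class_lift:
  assumes "lift_of g l"
  shows "omega_class g = Phi (l 1)"
  using omega_homotopic_ray[OF assms] lift_of_imp_curve[OF assms] lift_of_mem[OF assms]
  by (simp add: Phi_def omega_class_eq_iff)

lemma Phi_nonzero:
  assumes "norm q < 1" "q \<noteq> 0"
  shows "Phi q = omega_class (ray q)" "ray q \<in> Phi q" "Phi q \<noteq> omega_origin"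
    and "\<And>g. g \<in> Phi q \<Longrightarrow> g \<in> omega_curves \<and> g 1 = lam q \<and> (\<exists>l. lift_of g l \<and> l 1 = q)"
proof -
  show 1: "Phi q = omega_class (ray q)" using assms by (simp add: Phi_def)
  have c: "ray q \<in> omega_curves" using lift_of_imp_curve[OF lift_of_ray[OF assms]] .
  then show 2: "ray q \<in> Phi q"
    unfolding 1 by (simp only: omega_class_def mem_Collect_eq omega_homotopic_refl[OF c])
  have "ray q 1 \<noteq> 0" using assms by (simp add: ray_def lam_eq_0_iff)
  then show "Phi q \<noteq> omega_origin" using 2 by (auto simp: omega_origin_def)
  fix g assume "g \<in> Phi q"
  then have g: "omega_homotopic (ray q) g" unfolding 1 by (simp only: omega_class_def mem_Collect_eq)
  then have gc: "g \<in> omega_curves" "g 1 = lam q"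
    using omega_homotopic_imp_curves[OF g] omega_homotopic_endpoint[OF g] by (auto simp: ray_def)
  obtain l where l: "lift_of g l" using lift_exists[OF gc(1)] .
  have "l 1 = q" using omega_homotopic_imp_lift_eq[OF g lift_of_ray[OF assms] l] by simp
  then show "g \<in> omega_curves \<and> g 1 = lam q \<and> (\<exists>l. lift_of g l \<and> l 1 = q)" using gc l by blast
qed

lemma Phi_0: "Phi 0 = omega_origin"
  by (simp add: Phi_def)

lemma inj_on_Phi: "inj_on Phi (ball 0 1)"
proof (rule inj_onI)
  fix q q' :: complex assume "q \<in> ball 0 1" "q' \<in> ball 0 1" and eq: "Phi q = Phi q'"
  then have q: "norm q < 1" "norm q' < 1" by auto
  show "q = q'"
  proof (cases "q = 0 \<or> q' = 0")
    case True
    then show ?thesis using Phi_nonzero(3)[OF q(1)] Phi_nonzero(3)[OF q(2)] eq Phi_0 by metis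
  next
    case False
    then have "ray q \<in> Phi q'" using Phi_nonzero(2)[OF q(1)] eq by blast
    then obtain l where l: "lift_of (ray q) l" "l 1 = q'" using Phi_nonzero(4)[OF q(2)] False by blast
    have "of_real 1 * q = l 1"
      by (rule lift_unique[OF lift_of_ray l(1)]) (use q False in auto)
    then show ?thesis using l(2) by simp
  qed
qed

lemma Phi_image: "Phi ` ball 0 1 = Omega"
proof (intro equalityI subsetI)
  fix x assume "x \<in> Phi ` ball 0 1"
  then obtain q where q: "norm q < 1" "x = Phi q" by auto
  show "x \<in> Omega"
  proof (cases "q = 0")
    case False
    then show ?thesis
      using q Phi_nonzero(1)[of q] lift_of_imp_curve[OF lift_of_ray[of q]] by (auto simp: Omega_def)
  qed (simp add: q Phi_def Omega_def)
next
  fix x assume "x \<in> Omega"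
  then consider "x = omega_origin" | g where "x = omega_class g" "g \<in> omega_curves" by (auto simp: Omega_def)
  then show "x \<in> Phi ` ball 0 1"
  proof cases
    case 1
    then show ?thesis by (intro image_eqI[of _ _ 0]) (auto simp: Phi_def)
  next
    case 2
    then obtain l where "lift_of g l" using lift_exists by blast
    then show ?thesis using 2 omega_class_lift[of g l] lift_of_mem[of g l] by auto
  qed
qed

lemma omega_proj_Phi:
  assumes "norm q < 1"
  shows "omega_proj (Phi q) = lam q"
proof (cases "q = 0")
  case True
  then show ?thesis by (simp add: omega_proj_def Phi_def omega_origin_def pathfinish_def)
next
  case False
  have "(\<forall>g\<in>Phi q. pathfinish g = p) \<longleftrightarrow> p = lam q" for p
    using Phi_nonzero(2)[OF assms False] Phi_nonzero(4)[OF assms False]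
    unfolding pathfinish_def by metis
  then show ?thesis by (simp add: omega_proj_def)
qed

text \<open>The plane is star-shaped about 0, so \<open>nome_lim\<close> along the segment is the
  lift of the segment.\<close>

lemma first_sheet_eq_Phi_nome_lim:
  assumes w: "w \<in> one_cut_plane"
  shows "omega_first_sheet w = Phi (nome_lim w)"
proof (cases "w = 0")
  case False
  have cut: "linepath 0 w t \<in> one_cut_plane" if "t \<in> {0..1}" for t
    using scale_in_one_cut_plane[OF w, of t] that by (simp add: linepath_def scaleR_conv_of_real)
  have "continuous_on {0..1} (\<lambda>t. nome_lim (linepath 0 w t))"
    by (rule continuous_on_compose2[OF holomorphic_on_imp_continuous_on[OF holomorphic_nome_lim]])
       (use cut in \<open>auto intro!: continuous_intros\<close>)
  moreover have "linepath 0 w t \<noteq> 0" if "t \<in> {0<..1}" for t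
    using False that by (simp add: linepath_def)
  ultimately have "lift_of (linepath 0 w) (\<lambda>t. nome_lim (linepath 0 w t))"
    using cut by (auto simp: lift_of_def norm_nome_lim_less_1 nome_lim_eq_0_iff lam_nome_lim)
  from omega_class_lift[OF this] show ?thesis using False by (simp add: omega_first_sheet_def linepath_1')
qed (simp add: omega_first_sheet_def Phi_def)

text \<open>Turns the charts of \<open>Omega\<close> into holomorphic sections of
  \<open>lam\<close>: \<open>nome_lim\<close> at the origin, \<open>lam_section\<close> elsewhere.
  Appending a segment to a curve appends to its lift the image of the segment under the section. The
  radius drops to \<open>\<rho>\<close> because \<open>lam_section\<close> needs room.\<close>

lemma omega_section_Phi:
  assumes q: "norm q < 1" and rad: "omega_radius (Phi q) r" and \<rho>: "0 < \<rho>" "\<rho> < r"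
  shows "\<exists>s. s holomorphic_on ball (lam q) \<rho> \<and> s (lam q) = q \<and>
    (\<forall>z\<in>ball (lam q) \<rho>. norm (s z) < 1 \<and> lam (s z) = z \<and> omega_section (Phi q) z = Phi (s z))"
proof (cases "q = 0")
  case True
  have "ball (0 :: complex) r \<inter> {1} = {}" using rad True by (auto simp: omega_radius_def Phi_def omega_proj_Phi[of 0, unfolded Phi_def, simplified])
  then have "r \<le> 1" by (auto simp: dist_norm)
  then have cut: "ball 0 \<rho> \<subseteq> one_cut_plane" using \<rho> ball_subset_one_cut_plane by auto
  show ?thesis
  proof (intro exI[of _ nome_lim] conjI[of "nome_lim holomorphic_on _"] conjI[of "nome_lim _ = _"] ballI)
    show "nome_lim holomorphic_on ball (lam q) \<rho>" using cut True holomorphic_on_subset[OF holomorphic_nome_lim] by simp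
    show "norm (nome_lim z) < 1 \<and> lam (nome_lim z) = z \<and> omega_section (Phi q) z = Phi (nome_lim z)" if "z \<in> ball (lam q) \<rho>" for z
    proof -
      have "z \<in> one_cut_plane" using that cut True by auto
      then show ?thesis
        using True by (simp add: norm_nome_lim_less_1 lam_nome_lim omega_section_def first_sheet_eq_Phi_nome_lim) (simp add: Phi_def)
    qed
  qed (use True in auto)
next
  case False
  note Ph = Phi_nonzero[OF q False]
  have omit: "0 \<notin> ball (lam q) r" "1 \<notin> ball (lam q) r"
    using rad Ph(3) omega_proj_Phi[OF q] by (auto simp: omega_radius_def)
  obtain s where s: "s holomorphic_on ball (lam q) \<rho>" "s (lam q) = q"
    "\<And>z. z \<in> ball (lam q) \<rho> \<Longrightarrow> norm (s z) < 1 \<and> s z \<noteq> 0 \<and> lam (s z) = z"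
    using lam_section[OF q False refl \<rho> omit] by blast
  have "omega_section (Phi q) z = Phi (s z)" if z: "z \<in> ball (lam q) \<rho>" for z
  proof -
    have "omega_class (g +++ linepath (pathfinish g) z) = Phi (s z)" if g: "g \<in> Phi q" for g
    proof -
      obtain l where l: "lift_of g l" "l 1 = q" "g 1 = lam q" using Ph(4)[OF g] by blast
      define m where "m = (\<lambda>t. s (linepath (lam q) z t))"
      have seg: "linepath (lam q) z t \<in> ball (lam q) \<rho>" if "t \<in> {0..1}" for t
      proof -
        have "closed_segment (lam q) z \<subseteq> ball (lam q) \<rho>"
          using z \<rho> by (intro closed_segment_subset) auto
        then show ?thesis using linepath_in_path[OF that] by blast
      qed
      have "path m" unfolding path_def m_def
        by (rule continuous_on_compose2[OF holomorphic_on_imp_continuous_on[OF s(1)]])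
           (use seg in \<open>auto intro!: continuous_intros\<close>)
      moreover have "path l" using l by (simp add: lift_of_def path_def)
      ultimately have "path (l +++ m)"
        using l s by (intro path_join_imp) (auto simp: pathfinish_def pathstart_def m_def linepath_0')
      then have "lift_of (g +++ linepath (lam q) z) (l +++ m)"
        unfolding lift_of_def
      proof (intro conjI ballI)
        show "(l +++ m) 0 = 0" using l by (simp add: lift_of_def joinpaths_def)
        show "(l +++ m) t \<in> ball 0 1 - {0}" if "t \<in> {0<..1}" for t
          using that l s(3)[OF seg[of "2 * t - 1"]] by (auto simp: lift_of_def joinpaths_def m_def)
        show "lam ((l +++ m) t) = (g +++ linepath (lam q) z) t" if "t \<in> {0..1}" for t
          using that l s(3)[OF seg[of "2 * t - 1"]] by (auto simp: lift_of_def joinpaths_def m_def)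
      qed (simp add: path_def)
      from omega_class_lift[OF this] show ?thesis
        using l by (simp add: pathfinish_def joinpaths_def m_def linepath_1')
    qed
    then have "(\<Union>g\<in>Phi q. omega_class (g +++ linepath (pathfinish g) z)) = Phi (s z)"
      by - (rule UN_constant_eq[OF Ph(2)], blast)
    then show ?thesis using Ph(3) by (simp only: omega_section_def if_False)
  qed
  then show ?thesis using s by (intro exI[of _ s] conjI ballI) auto
qed

section \<open>Topology and complex structure of \<open>Omega\<close>\<close>

definition Psi :: "(real \<Rightarrow> complex) set \<Rightarrow> complex" where
  "Psi = inv_into (ball 0 1) Phi"

lemma Psi_Phi: "norm q < 1 \<Longrightarrow> Psi (Phi q) = q"
  unfolding Psi_def using inj_on_Phi by (intro inv_into_f_f) auto

lemma Psi_cases: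
  assumes "x \<in> Omega"
  obtains q where "norm q < 1" "x = Phi q"
  using assms unfolding Phi_image[symmetric] by auto

lemma omega_radius_exists:
  assumes "norm q < 1"
  obtains r where "omega_radius (Phi q) r"
proof (cases "q = 0")
  case True
  then show ?thesis
    using that[of 1] omega_proj_Phi[of 0] by (auto simp: omega_radius_def Phi_def)
next
  case False
  have "omega_radius (Phi q) (min (dist (lam q) 0) (dist (lam q) 1))"
    using omega_proj_Phi[OF assms] lam_eq_0_iff[OF assms] lam_neq_1[OF assms] False Phi_nonzero(3)[OF assms False]
    by (auto simp: omega_radius_def)
  then show ?thesis by (rule that)
qed

lemma omega_radius_mono: "omega_radius x r \<Longrightarrow> 0 < r' \<Longrightarrow> r' \<le> r \<Longrightarrow> omega_radius x r'"
  by (fastforce simp: omega_radius_def split: if_splits)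

lemma omega_section_in_Omega:
  assumes "x \<in> Omega" "omega_radius x r"
  shows "omega_section x ` ball (omega_proj x) r \<subseteq> Omega" "x \<in> omega_section x ` ball (omega_proj x) r"
proof -
  obtain q where q: "norm q < 1" "x = Phi q" using assms(1) by (rule Psi_cases)
  have r: "r > 0" using assms(2) by (simp add: omega_radius_def)
  show "omega_section x ` ball (omega_proj x) r \<subseteq> Omega"
  proof
    fix y assume "y \<in> omega_section x ` ball (omega_proj x) r"
    then obtain z where z: "dist (lam q) z < r" "y = omega_section x z" by (auto simp: q omega_proj_Phi)
    obtain \<rho> where \<rho>: "dist (lam q) z < \<rho>" "\<rho> < r" using dense[OF z(1)] by blast
    have "0 < \<rho>" using \<rho>(1) zero_le_dist[of "lam q" z] by linarith
    obtain s where "s holomorphic_on ball (lam q) \<rho>" "s (lam q) = q" and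
      s: "\<And>z. z \<in> ball (lam q) \<rho> \<Longrightarrow> norm (s z) < 1 \<and> lam (s z) = z \<and> omega_section (Phi q) z = Phi (s z)"
      using omega_section_Phi[OF q(1) assms(2)[unfolded q(2)] \<open>0 < \<rho>\<close> \<rho>(2)] by blast
    have "y = Phi (s z)" "norm (s z) < 1" using s[of z] z \<rho> q by auto
    then show "y \<in> Omega" using Phi_image by auto
  qed
  have r2: "0 < r / 2" "r / 2 < r" using r by auto
  obtain s where "s holomorphic_on ball (lam q) (r / 2)" and s: "s (lam q) = q"
     "\<And>z. z \<in> ball (lam q) (r / 2) \<Longrightarrow> norm (s z) < 1 \<and> lam (s z) = z \<and> omega_section (Phi q) z = Phi (s z)"
    using omega_section_Phi[OF q(1) assms(2)[unfolded q(2)] r2] by blast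
  have "omega_section x (lam q) = x" using s(1) s(2)[of "lam q"] r q by simp
  then show "x \<in> omega_section x ` ball (omega_proj x) r"
    using r q omega_proj_Phi by (intro image_eqI[of _ _ "lam q"]) auto
qed

lemma topspace_omega: "topspace omega_topology = Omega"
  unfolding omega_topology_def topology_generated_by_topspace
proof (intro equalityI subsetI)
  fix y assume "y \<in> \<Union> {omega_section x ` ball (omega_proj x) r | x r. x \<in> Omega \<and> omega_radius x r}"
  then obtain x r where "x \<in> Omega" "omega_radius x r" "y \<in> omega_section x ` ball (omega_proj x) r"
    by blast
  then show "y \<in> Omega" using omega_section_in_Omega(1) by blast
next
  fix x assume x: "x \<in> Omega"
  then obtain q where q: "norm q < 1" "x = Phi q" by (elim Psi_cases)
  obtain r where r: "omega_radius (Phi q) r" using omega_radius_exists[OF q(1)] .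
  show "x \<in> \<Union> {omega_section x ` ball (omega_proj x) r | x r. x \<in> Omega \<and> omega_radius x r}"
    by (rule UnionI[OF _ omega_section_in_Omega(2)[OF x r[folded q(2)]]]) (use x r q in blast)
qed

lemma Psi_image: "x \<in> Omega \<Longrightarrow> norm (Psi x) < 1 \<and> Phi (Psi x) = x"
  using Psi_Phi by (auto elim!: Psi_cases)

text \<open>In a chart, \<open>Psi\<close> is a section \<open>s\<close> of \<open>lam\<close>;
  continuity of \<open>s\<close> yields a basic neighbourhood inside the preimage.\<close>

lemma continuous_map_Psi: "continuous_map omega_topology (top_of_set (ball 0 1)) Psi"
  unfolding continuous_map_def
proof (intro conjI allI impI)
  show "Psi \<in> topspace omega_topology \<rightarrow> topspace (top_of_set (ball 0 1))"
    using Psi_image by (auto simp: topspace_omega)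
  fix U assume "openin (top_of_set (ball 0 1)) (U :: complex set)"
  then have U: "open U" "U \<subseteq> ball 0 1" by (simp_all add: openin_open_eq)
  show "openin omega_topology {x \<in> topspace omega_topology. Psi x \<in> U}"
  proof (subst openin_subopen, intro ballI)
    fix x assume "x \<in> {x \<in> topspace omega_topology. Psi x \<in> U}"
    then have x: "x \<in> Omega" "Psi x \<in> U" by (auto simp: topspace_omega)
    then obtain q where q: "norm q < 1" "x = Phi q" by (elim Psi_cases)
    have qU: "q \<in> U" using x q Psi_Phi by simp
    obtain r where r: "omega_radius (Phi q) r" using omega_radius_exists[OF q(1)] .
    have r0: "r > 0" using r by (simp add: omega_radius_def)
    then have r2: "0 < r / 2" "r / 2 < r" by auto
    obtain s where s: "s holomorphic_on ball (lam q) (r / 2)" "s (lam q) = q"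
      "\<And>z. z \<in> ball (lam q) (r / 2) \<Longrightarrow> norm (s z) < 1 \<and> lam (s z) = z \<and> omega_section (Phi q) z = Phi (s z)"
      using omega_section_Phi[OF q(1) r r2] by blast
    have "open (ball (lam q) (r / 2) \<inter> s -` U)"
      using s(1) U by (intro continuous_open_preimage holomorphic_on_imp_continuous_on) auto
    then obtain e where e: "e > 0" "ball (lam q) e \<subseteq> ball (lam q) (r / 2) \<inter> s -` U"
      using qU s(2) r0 open_contains_ball by (metis Int_iff centre_in_ball half_gt_zero vimageI)
    define e' where "e' = min e r"
    have e': "omega_radius x e'" using omega_radius_mono[OF r] e r0 q by (simp add: e'_def)
    have "omega_section x ` ball (omega_proj x) e' \<subseteq> {x \<in> topspace omega_topology. Psi x \<in> U}"
    proof
      fix y assume "y \<in> omega_section x ` ball (omega_proj x) e'"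
      then obtain z where z: "z \<in> ball (lam q) e" "y = omega_section x z" 
        by (auto simp: q omega_proj_Phi e'_def)
      then have "y = Phi (s z)" "norm (s z) < 1" "s z \<in> U" using s(3)[of z] e q by auto
      then show "y \<in> {x \<in> topspace omega_topology. Psi x \<in> U}"
        using Psi_Phi Phi_image by (auto simp: topspace_omega)
    qed
    moreover have "openin omega_topology (omega_section x ` ball (omega_proj x) e')"
      unfolding omega_topology_def using x e' by (intro topology_generated_by_Basis) blast
    ultimately show "\<exists>T. openin omega_topology T \<and> x \<in> T \<and> T \<subseteq> {x \<in> topspace omega_topology. Psi x \<in> U}"
      using omega_section_in_Omega(2)[OF x(1) e'] by blast
  qed
qed

text \<open>It suffices to treat generating sets. Their preimages are unions of images of injective
  holomorphic sections, which are open by the open mapping theorem.\<close>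

lemma continuous_map_Phi: "continuous_map (top_of_set (ball 0 1)) omega_topology Phi"
  unfolding omega_topology_def
proof (rule continuous_on_generated_topo)
  show "Phi ` topspace (top_of_set (ball 0 1)) \<subseteq>
      \<Union> {omega_section x ` ball (omega_proj x) r | x r. x \<in> Omega \<and> omega_radius x r}"
    using topspace_omega
    unfolding omega_topology_def topology_generated_by_topspace topspace_euclidean_subtopology Phi_image
    by (rule equalityD2)
  fix G assume "G \<in> {omega_section x ` ball (omega_proj x) r | x r. x \<in> Omega \<and> omega_radius x r}"
  then obtain x r where G: "G = omega_section x ` ball (omega_proj x) r" "x \<in> Omega" "omega_radius x r" by blast
  obtain q where q: "norm q < 1" "x = Phi q" using G(2) by (rule Psi_cases)
  have "open (Phi -` G \<inter> ball 0 1)"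
  proof (rule topological_space_class.openI)
    fix q' assume "q' \<in> Phi -` G \<inter> ball 0 1"
    then obtain z where z: "norm q' < 1" "dist (lam q) z < r" "Phi q' = omega_section (Phi q) z"
      by (auto simp: G(1) q omega_proj_Phi)
    obtain \<rho> where \<rho>: "dist (lam q) z < \<rho>" "\<rho> < r" using dense[OF z(2)] by blast
    have "0 < \<rho>" using \<rho>(1) zero_le_dist[of "lam q" z] by linarith
    obtain s where s: "s holomorphic_on ball (lam q) \<rho>" "s (lam q) = q"
       "\<And>z. z \<in> ball (lam q) \<rho> \<Longrightarrow> norm (s z) < 1 \<and> lam (s z) = z \<and> omega_section (Phi q) z = Phi (s z)"
      using omega_section_Phi[OF q(1) G(3)[unfolded q(2)] \<open>0 < \<rho>\<close> \<rho>(2)] by blast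
    have "inj_on s (ball (lam q) \<rho>)" using s(3) by (metis inj_onI)
    then have "open (s ` ball (lam q) \<rho>)" using s(1) by (intro open_mapping_thm3) auto
    moreover have "q' = s z" using s(3)[of z] z \<rho> by (intro inj_onD[OF inj_on_Phi]) auto
    then have "q' \<in> s ` ball (lam q) \<rho>" using \<rho> by auto
    moreover have "s z' \<in> Phi -` G \<inter> ball 0 1" if z': "z' \<in> ball (lam q) \<rho>" for z'
    proof -
      have "Phi (s z') = omega_section (Phi q) z'" "norm (s z') < 1" using s(3)[OF z'] by auto
      then show ?thesis using z' \<rho> by (auto simp: G(1) q omega_proj_Phi)
    qed
    then have "s ` ball (lam q) \<rho> \<subseteq> Phi -` G \<inter> ball 0 1" by (rule image_subsetI)
    ultimately show "\<exists>T. open T \<and> q' \<in> T \<and> T \<subseteq> Phi -` G \<inter> ball 0 1" by (intro exI conjI)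
  qed
  then show "openin (top_of_set (ball 0 1)) (Phi -` G \<inter> topspace (top_of_set (ball 0 1)))"
    by (simp add: open_subset)
qed

lemma omega_uniformization_Psi: "omega_uniformization Psi"
  unfolding omega_uniformization_def
proof (intro conjI)
  have "homeomorphic_maps omega_topology (top_of_set (ball 0 1)) Psi Phi"
    unfolding homeomorphic_maps_def
    using continuous_map_Psi continuous_map_Phi Psi_image Psi_Phi by (auto simp: topspace_omega)
  then show "homeomorphic_map omega_topology (top_of_set (ball 0 1)) Psi"
    using homeomorphic_map_maps by blast
  show "omega_holomorphic Psi"
    unfolding omega_holomorphic_def
  proof (intro ballI allI impI)
    fix x r assume x: "x \<in> Omega" and r: "omega_radius x r"
    obtain q where q: "norm q < 1" "x = Phi q" using x by (rule Psi_cases)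
    \<comment> \<open>The sections are available only on smaller discs, which exhaust the
      disc.\<close>
    have "(Psi \<circ> omega_section x) holomorphic_on (\<Union>\<rho>\<in>{0<..<r}. ball (lam q) \<rho>)"
    proof (rule holomorphic_on_UN_open)
      fix \<rho> assume "\<rho> \<in> {0<..<r}"
      then have \<rho>: "0 < \<rho>" "\<rho> < r" by auto
      obtain s where s: "s holomorphic_on ball (lam q) \<rho>" "s (lam q) = q"
         "\<And>z. z \<in> ball (lam q) \<rho> \<Longrightarrow> norm (s z) < 1 \<and> lam (s z) = z \<and> omega_section (Phi q) z = Phi (s z)"
        using omega_section_Phi[OF q(1) r[unfolded q(2)] \<rho>] by blast
      show "(Psi \<circ> omega_section x) holomorphic_on ball (lam q) \<rho>"
        by (rule holomorphic_transform[OF s(1)]) (use s(3) q Psi_Phi in simp)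
    qed auto
    moreover have "ball (omega_proj x) r \<subseteq> (\<Union>\<rho>\<in>{0<..<r}. ball (lam q) \<rho>)"
    proof
      fix z assume "z \<in> ball (omega_proj x) r"
      then obtain \<rho> where \<rho>: "dist (lam q) z < \<rho>" "\<rho> < r"
        using dense[of "dist (lam q) z" r] q omega_proj_Phi by auto
      moreover have "0 < \<rho>" using \<rho>(1) zero_le_dist[of "lam q" z] by linarith
      ultimately show "z \<in> (\<Union>\<rho>\<in>{0<..<r}. ball (lam q) \<rho>)" by auto
    qed
    ultimately show "(Psi \<circ> omega_section x) holomorphic_on ball (omega_proj x) r"
      by (rule holomorphic_on_subset)
  qed
  have "inj_on Psi Omega" using Psi_image by (metis inj_onI)
  then have "inv_into Omega Psi q = Phi q" if "norm q < 1" for q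
    using that Psi_Phi Phi_image by (intro inv_into_f_eq) auto
  then show "(omega_proj \<circ> inv_into Omega Psi) holomorphic_on ball 0 1"
    by (intro holomorphic_transform[OF holomorphic_lam]) (auto simp: omega_proj_Phi)
qed

subsection \<open>The complete elliptic integral\<close>

text \<open>The Landen product \<open>\<Prod>n. 1 + landen n w\<close>, written as an exponential; it will turn out to be
  \<open>2 / \<pi> * K(w)\<close>, and it provides the continuation of the hypergeometric series.\<close>

definition K_factor :: "complex \<Rightarrow> complex" where
  "K_factor w = exp (\<Sum>n. Ln (1 + landen n w))"

lemma one_plus_not_nonpos_Reals: "norm (k :: complex) < 1 \<Longrightarrow> 1 + k \<notin> \<real>\<^sub>\<le>\<^sub>0"
  using abs_Re_le_cmod[of k] by (auto simp: complex_nonpos_Reals_iff)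

text \<open>As \<open>n \<le> 2 ^ n\<close>, the doubly exponential decay of the moduli is relaxed
  to a geometric majorant; the factor 2 bounds the logarithm of \<open>1 + z\<close> for
  \<open>norm z < 1 / 2\<close>.\<close>

lemma norm_Ln_landen_le:
  assumes "w \<in> one_cut_plane" "norm (psi1 w) \<le> c" "c < 1" "c ^ n < 1 / 2"
  shows "norm (Ln (1 + landen n w)) \<le> 2 * c ^ n"
proof -
  have c: "0 \<le> c" using assms(2) norm_ge_zero order_trans by blast
  have "norm (landen n w) \<le> norm (psi1 w) ^ 2 ^ n" by (rule norm_landen_le[OF assms(1)])
  also have "\<dots> \<le> c ^ 2 ^ n" using assms by (intro power_mono) auto
  also have "\<dots> \<le> c ^ n" using assms c by (intro power_decreasing) (auto simp: less_imp_le)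
  finally show ?thesis using norm_Ln_le[of "landen n w"] assms(4) by simp
qed

lemma eventually_power_less_half:
  assumes "0 \<le> (c::real)" "c < 1"
  shows "\<forall>\<^sub>F n in sequentially. c ^ n < 1 / 2"
  using assms by (intro order_tendstoD(2)[OF LIMSEQ_power_zero]) auto

lemma summable_Ln_landen:
  assumes "w \<in> one_cut_plane"
  shows "summable (\<lambda>n. Ln (1 + landen n w))"
proof (rule summable_comparison_test_ev)
  have c: "0 \<le> norm (psi1 w)" "norm (psi1 w) < 1" using norm_psi1_less_1[OF assms] by auto
  show "\<forall>\<^sub>F n in sequentially. norm (Ln (1 + landen n w)) \<le> 2 * norm (psi1 w) ^ n"
    using eventually_power_less_half[OF c]
    by eventually_elim (rule norm_Ln_landen_le, use assms c in auto)
  show "summable (\<lambda>n. 2 * norm (psi1 w) ^ n)" using c by (intro summable_mult summable_geometric) auto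
qed

lemma holomorphic_K_factor: "K_factor holomorphic_on one_cut_plane"
proof -
  have "(\<lambda>w. \<Sum>n. Ln (1 + landen n w)) holomorphic_on one_cut_plane"
  proof (rule holomorphic_uniform_sequence[OF open_one_cut_plane])
    show "(\<lambda>w. \<Sum>j<n. Ln (1 + landen j w)) holomorphic_on one_cut_plane" for n
      using norm_landen_less_1
      by (intro holomorphic_on_sum holomorphic_on_Ln' holomorphic_on_add holomorphic_on_const
          holomorphic_landen one_plus_not_nonpos_Reals) auto
  next
    fix x assume "x \<in> one_cut_plane"
    then obtain d where d: "d > 0" "cball x d \<subseteq> one_cut_plane"
      using open_one_cut_plane open_contains_cball by blast
    have "(\<lambda>w. psi1 w) holomorphic_on cball x d" using d by (intro holomorphic_intros) auto
    then have "continuous_on (cball x d) (\<lambda>w. norm (psi1 w))"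
      by (intro continuous_on_norm holomorphic_on_imp_continuous_on)
    moreover have "cball x d \<noteq> {}" using d by simp
    \<comment> \<open>The maximum of \<open>norm (psi1 w)\<close> over the compact disc is below 1
      and gives one ratio for the whole disc.\<close>
    ultimately obtain z where z: "z \<in> cball x d" "\<forall>w\<in>cball x d. norm (psi1 w) \<le> norm (psi1 z)"
      using continuous_attains_sup[OF compact_cball] by blast
    define c where "c = norm (psi1 z)"
    have c: "0 \<le> c" "c < 1" using norm_psi1_less_1 z d by (auto simp: c_def)
    have "uniform_limit (cball x d) (\<lambda>n w. \<Sum>j<n. Ln (1 + landen j w)) (\<lambda>w. \<Sum>n. Ln (1 + landen n w)) sequentially"
    proof (rule Weierstrass_m_test_ev)
      show "\<forall>\<^sub>F n in sequentially. \<forall>w\<in>cball x d. norm (Ln (1 + landen n w)) \<le> 2 * c ^ n"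
        using eventually_power_less_half[OF c]
        by eventually_elim (intro ballI norm_Ln_landen_le, use c d z in \<open>auto simp: c_def\<close>)
      show "summable (\<lambda>n. 2 * c ^ n)" using c by (intro summable_mult summable_geometric) auto
    qed
    then show "\<exists>d>0. cball x d \<subseteq> one_cut_plane \<and>
        uniform_limit (cball x d) (\<lambda>n w. \<Sum>j<n. Ln (1 + landen j w)) (\<lambda>w. \<Sum>n. Ln (1 + landen n w)) sequentially"
      using d by blast
  qed
  then show ?thesis unfolding K_factor_def[abs_def] by (intro holomorphic_intros)
qed

lemma K_factor_nonzero: "K_factor w \<noteq> 0"
  by (simp add: K_factor_def)

lemma K_factor_landen:
  assumes "w \<in> one_cut_plane"
  shows "K_factor w = (1 + psi1 w) * K_factor ((psi1 w)\<^sup>2)"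
proof -
  have "(\<Sum>n. Ln (1 + landen n w)) = Ln (1 + psi1 w) + (\<Sum>n. Ln (1 + landen (Suc n) w))"
    using suminf_split_head[OF summable_Ln_landen[OF assms]] by simp
  moreover have "1 + psi1 w \<noteq> 0"
    using one_plus_not_nonpos_Reals[OF norm_psi1_less_1[OF assms]] by force
  ultimately show ?thesis unfolding K_factor_def landen_shift by (simp add: exp_add)
qed

lemma landen_0: "landen n 0 = 0"
  by (induction n) (auto simp: psi1_eq_0_iff)

lemma K_factor_0: "K_factor 0 = 1"
  by (simp add: K_factor_def landen_0)

text \<open>The Taylor coefficients of \<open>2 / pi\<close> times the complete elliptic integral,
  as a function of the parameter \<open>m\<close>.\<close>

definition K_coeff :: "nat \<Rightarrow> real" where
  "K_coeff n = (pochhammer (1 / 2) n / fact n)\<^sup>2"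

lemma K_coeff_0: "K_coeff 0 = 1"
  by (simp add: K_coeff_def)

lemma K_coeff_Suc: "K_coeff (Suc n) = ((real n + 1 / 2) / (real n + 1))\<^sup>2 * K_coeff n"
  by (simp add: K_coeff_def pochhammer_Suc power_divide power_mult_distrib add_ac mult_ac)

lemma K_coeff_nonneg: "0 \<le> K_coeff n"
  by (simp add: K_coeff_def)

lemma K_coeff_le_1: "K_coeff n \<le> 1"
proof (induction n)
  case (Suc n)
  have "((real n + 1 / 2) / (real n + 1))\<^sup>2 \<le> 1" by (intro power_le_one) auto
  then show ?case
    using Suc K_coeff_nonneg[of n] unfolding K_coeff_Suc by (simp add: mult_le_one)
qed (simp add: K_coeff_0)

section \<open>The hypergeometric series and its Landen transformation\<close>

abbreviation K_fps :: "complex fps" where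
  "K_fps \<equiv> fps_hypergeo [1/2, 1/2] [1] 1"

lemma K_fps_nth: "fps_nth K_fps n = of_real (K_coeff n)"
proof (induction n)
  case (Suc n)
  have "of_nat n + (1::complex) \<noteq> 0" by (metis of_nat_Suc of_nat_neq_0 add.commute)
  then show ?case
    unfolding fps_hypergeo_rec Suc K_coeff_Suc by (simp add: power2_eq_square field_simps)
qed (simp add: K_coeff_0)

lemma conv_radius_K_fps: "fps_conv_radius K_fps \<ge> 1"
  unfolding fps_conv_radius_def
proof (rule conv_radius_geI_ex')
  fix r :: real assume r: "0 < r" "ereal r < 1"
  show "summable (\<lambda>n. fps_nth K_fps n * of_real r ^ n)"
  proof (rule summable_comparison_test'[where N = 0])
    show "summable (\<lambda>n. r ^ n)" using r by (intro summable_geometric) auto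
    show "norm (fps_nth K_fps n * of_real r ^ n) \<le> r ^ n" for n
      unfolding K_fps_nth using r K_coeff_le_1[of n] K_coeff_nonneg[of n]
      by (simp add: norm_mult norm_power mult_left_le_one_le)
  qed
qed

lemma holomorphic_K_series: "eval_fps K_fps holomorphic_on ball 0 1"
  using conv_radius_K_fps by (intro holomorphic_on_eval_fps ball_eball_mono) (simp add: one_ereal_def)

text \<open>The hypergeometric differential equation; comparing coefficients reduces it to the
  recursion \<open>K_coeff_Suc\<close>.\<close>

lemma K_fps_ode:
  defines "f \<equiv> K_fps"
  shows "fps_X * (1 - fps_X) * fps_deriv (fps_deriv f) + (1 - 2 * fps_X) * fps_deriv f = fps_const (1 / 4) * f"
proof (rule fps_ext)
  fix n
  have rec: "4 * (of_nat n + 1)\<^sup>2 * fps_nth f (Suc n) = (2 * of_nat n + 1)\<^sup>2 * fps_nth f n" for n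
  proof -
    have "of_nat n + (1::complex) \<noteq> 0" by (metis of_nat_Suc of_nat_neq_0 add.commute)
    then show ?thesis
      unfolding f_def K_fps_nth K_coeff_Suc
      by (simp add: power_divide) (simp add: power2_eq_square algebra_simps)
  qed
  have eq: "fps_X * (1 - fps_X) * fps_deriv (fps_deriv f) + (1 - 2 * fps_X) * fps_deriv f =
      fps_X * fps_deriv (fps_deriv f) - fps_X * (fps_X * fps_deriv (fps_deriv f)) + fps_deriv f -
      fps_const 2 * (fps_X * fps_deriv f)"
    by (simp add: algebra_simps numeral_fps_const)
  show "fps_nth (fps_X * (1 - fps_X) * fps_deriv (fps_deriv f) + (1 - 2 * fps_X) * fps_deriv f) n =
     fps_nth (fps_const (1 / 4) * f) n"
    unfolding eq using rec[of n]
    by (cases n; cases "n - 1"; simp) (simp_all add: algebra_simps power2_eq_square)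
qed

text \<open>Both sides of the Landen transformation of the hypergeometric series, as power series in the
  modulus, solve the same differential equation, whose solution regular at 0 is unique up to a
  factor.\<close>

lemma landen_ode_unique:
  fixes d :: "complex fps"
  assumes ode: "fps_X * (1 - fps_X\<^sup>2) * fps_deriv (fps_deriv d) + (1 - 3 * fps_X\<^sup>2) * fps_deriv d = fps_X * d"
    and d0: "fps_nth d 0 = 0"
  shows "d = 0"
proof -
  have ode': "fps_X * fps_deriv (fps_deriv d) + fps_deriv d =
     fps_X * (fps_X * (fps_X * fps_deriv (fps_deriv d))) + fps_const 3 * (fps_X * (fps_X * fps_deriv d)) + fps_X * d"
    using ode by (simp add: algebra_simps power2_eq_square numeral_fps_const)
  have d1: "fps_nth d 1 = 0"
    using arg_cong[OF ode', of "\<lambda>f. fps_nth f 0"] by simp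
  have rec: "(of_nat n + 2)\<^sup>2 * fps_nth d (n + 2) = (of_nat n + 1)\<^sup>2 * fps_nth d n" for n
    using arg_cong[OF ode', of "\<lambda>f. fps_nth f (Suc n)"]
    by (cases n; cases "n - 1") (auto simp: algebra_simps power2_eq_square numeral_2_eq_2)
  have "fps_nth d n = 0" for n
  proof (induction n rule: less_induct)
    case (less n)
    show ?case
    proof (cases "n < 2")
      case True
      then show ?thesis using d0 d1 by (auto simp: less_2_cases_iff)
    next
      case False
      then obtain m where m: "n = m + 2" by (metis add.commute le_Suc_ex not_less)
      have "of_nat m + (2 :: complex) \<noteq> 0" by (metis of_nat_add of_nat_numeral of_nat_eq_0_iff add_is_0 zero_neq_numeral)
      then show ?thesis using rec[of m] less[of m] m by simp
    qed
  qed
  then show ?thesis by (simp add: fps_eq_iff)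
qed

lemma K_fps_landen:
  defines "f \<equiv> K_fps" and "i \<equiv> inverse (1 + fps_X) :: complex fps"
  shows "i * (f oo (4 * fps_X * i\<^sup>2)) = f oo fps_X\<^sup>2"
proof -
  have ode: "P * (1 - P) * (fps_deriv (fps_deriv f) oo P) + (1 - 2 * P) * (fps_deriv f oo P) = fps_const (1 / 4) * (f oo P)"
    if P: "fps_nth P 0 = 0" for P
    using arg_cong[OF K_fps_ode, of "\<lambda>g. g oo P", folded f_def] P
    by (simp add: fps_compose_mult_distrib fps_compose_add_distrib fps_compose_sub_distrib)
  have i: "i * (1 + fps_X) = 1" unfolding i_def by (rule inverse_mult_eq_1) simp
  have di: "fps_deriv i = - i\<^sup>2" unfolding i_def by (subst fps_inverse_deriv) auto
  have quarter: "4 * (fps_const (1 / 4) * g) = (g :: complex fps)" for g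
    by (simp add: numeral_fps_const mult.assoc[symmetric])
  define D where "D = (\<lambda>g. fps_X * (1 - fps_X\<^sup>2) * fps_deriv (fps_deriv g) + (1 - 3 * fps_X\<^sup>2) * fps_deriv g - fps_X * (g :: complex fps))"
  have D1: "D (f oo fps_X\<^sup>2) = 0"
  proof -
    define y y1 y2 where "y = f oo fps_X\<^sup>2" and "y1 = fps_deriv f oo fps_X\<^sup>2" and "y2 = fps_deriv (fps_deriv f) oo fps_X\<^sup>2"
    have d: "fps_deriv y = 2 * fps_X * y1" "fps_deriv y1 = 2 * fps_X * y2"
      unfolding y_def y1_def y2_def by (subst fps_compose_deriv; simp add: power2_eq_square algebra_simps)+
    have e: "fps_X\<^sup>2 * (1 - fps_X\<^sup>2) * y2 + (1 - 2 * fps_X\<^sup>2) * y1 = fps_const (1 / 4) * y"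
      using ode[of "fps_X\<^sup>2"] by (simp add: y_def y1_def y2_def)
    have "fps_deriv (fps_deriv y) = 2 * y1 + 4 * fps_X\<^sup>2 * y2"
      unfolding d by (simp add: d algebra_simps power2_eq_square)
    then have "D y = 4 * fps_X * (fps_X\<^sup>2 * (1 - fps_X\<^sup>2) * y2 + (1 - 2 * fps_X\<^sup>2) * y1) - fps_X * y"
      unfolding D_def d(1) by algebra
    also have "\<dots> = fps_X * (4 * (fps_const (1 / 4) * y)) - fps_X * y" unfolding e by algebra
    also have "\<dots> = 0" unfolding quarter by simp
    finally show ?thesis by (simp add: y_def)
  qed
  \<comment> \<open>The expansion of \<open>phi1\<close>, with \<open>fps_X\<close> as the
    modulus.\<close>
  define P where "P = 4 * fps_X * i\<^sup>2"
  have P0: "fps_nth P 0 = 0" by (simp add: P_def mult.assoc)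
  have D2: "D (i * (f oo P)) = 0"
  proof -
    define y y1 y2 where "y = f oo P" and "y1 = fps_deriv f oo P" and "y2 = fps_deriv (fps_deriv f) oo P"
    have dP: "fps_deriv P = 4 * i\<^sup>2 - 8 * fps_X * i ^ 3"
      unfolding P_def by (simp add: di power2_eq_square power3_eq_cube algebra_simps)
    have d: "fps_deriv y = y1 * fps_deriv P" "fps_deriv y1 = y2 * fps_deriv P"
      unfolding y_def y1_def y2_def by (subst fps_compose_deriv; simp add: P0)+
    have e: "P * (1 - P) * y2 + (1 - 2 * P) * y1 = fps_const (1 / 4) * y"
      using ode[OF P0] by (simp add: y_def y1_def y2_def)
    have e4: "4 * (P * (1 - P) * y2 + (1 - 2 * P) * y1) = y" unfolding e quarter ..
    have g1: "fps_deriv (i * y) = i * (y1 * fps_deriv P) - i\<^sup>2 * y"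
      by (simp add: d di algebra_simps)
    have g2: "fps_deriv (fps_deriv (i * y)) = i * (y2 * fps_deriv P * fps_deriv P) +
        i * (y1 * fps_deriv (fps_deriv P)) - 2 * i\<^sup>2 * (y1 * fps_deriv P) + 2 * i ^ 3 * y"
      unfolding g1 by (simp add: d di algebra_simps power2_eq_square power3_eq_cube)
    have ddP: "fps_deriv (fps_deriv P) = - 16 * i ^ 3 + 24 * fps_X * i ^ 4"
      unfolding dP by (simp add: di algebra_simps power2_eq_square power3_eq_cube power4_eq_xxxx)
    \<comment> \<open>This relation turns \<open>P\<close>, its derivatives and the coefficients of
      \<open>D\<close> times \<open>i ^ 3\<close> into polynomials in \<open>i\<close>. Once
      \<open>y\<close> is eliminated by \<open>e4\<close>, a polynomial identity remains.\<close>
    have xi: "fps_X * i = 1 - i" using i by (simp add: algebra_simps)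
    have P': "P = 4 * i * (1 - i)"
      unfolding P_def using xi by algebra
    have dP': "fps_deriv P = 4 * i\<^sup>2 * (2 * i - 1)"
      unfolding dP using xi by algebra
    have ddP': "fps_deriv (fps_deriv P) = 8 * i ^ 3 * (1 - 3 * i)"
      unfolding ddP using xi by algebra
    have c1: "i ^ 3 * (fps_X * (1 - fps_X\<^sup>2)) = (1 - i) * (2 * i - 1)"
      using xi by algebra
    have c2: "i ^ 3 * (1 - 3 * fps_X\<^sup>2) = i * (i\<^sup>2 - 3 * (1 - i)\<^sup>2)"
      using xi by algebra
    have c3: "i ^ 3 * fps_X = i\<^sup>2 * (1 - i)"
      using xi by algebra
    have "i ^ 3 * D (i * y) = i ^ 3 * (fps_X * (1 - fps_X\<^sup>2)) * fps_deriv (fps_deriv (i * y)) +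
        i ^ 3 * (1 - 3 * fps_X\<^sup>2) * fps_deriv (i * y) - i ^ 3 * fps_X * (i * y)"
      unfolding D_def by algebra
    also have "\<dots> = 0"
      unfolding c1 c2 c3 g2 unfolding g1 ddP' unfolding dP' unfolding e4[symmetric] P'
      by (simp add: algebra_simps power2_eq_square power3_eq_cube)
    finally have "i ^ 3 * D (i * y) = 0" .
    moreover have "i \<noteq> 0" using i by auto
    ultimately show ?thesis by (simp add: y_def)
  qed
  have "D (i * (f oo P) - (f oo fps_X\<^sup>2)) = 0"
  proof -
    have "D (a - b) = D a - D b" for a b by (simp add: D_def algebra_simps)
    then show ?thesis using D1 D2 by simp
  qed
  then have "i * (f oo P) - (f oo fps_X\<^sup>2) = 0"
    unfolding D_def by (intro landen_ode_unique) (simp_all only: right_minus_eq, simp add: i_def f_def)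
  then show ?thesis by (simp add: P_def)
qed

lemma K_series_landen:
  "\<forall>\<^sub>F k in nhds 0. eval_fps K_fps (phi1 k) = (1 + k) * eval_fps K_fps (k\<^sup>2)"
proof -
  let ?y = "eval_fps K_fps" and ?i = "inverse (1 + fps_X) :: complex fps"
  have y: "?y has_fps_expansion K_fps"
    by (rule eval_fps_has_fps_expansion, rule less_le_trans[OF _ conv_radius_K_fps]) simp
  have i: "(\<lambda>k. inverse (1 + k)) has_fps_expansion ?i"
    by (intro fps_expansion_intros) auto
  have "(\<lambda>k. 4 * k * (inverse (1 + k))\<^sup>2) has_fps_expansion 4 * fps_X * ?i\<^sup>2"
    by (intro fps_expansion_intros i)
  then have P: "phi1 has_fps_expansion 4 * fps_X * ?i\<^sup>2"
    by (simp add: phi1_def[abs_def] field_simps)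
  have "(?y \<circ> phi1) has_fps_expansion (K_fps oo (4 * fps_X * ?i\<^sup>2))"
    by (rule has_fps_expansion_compose[OF y P]) (simp add: mult.assoc)
  then have "(\<lambda>k. inverse (1 + k) * (?y \<circ> phi1) k) has_fps_expansion (?i * (K_fps oo (4 * fps_X * ?i\<^sup>2)))"
    by (rule has_fps_expansion_mult[OF i])
  then have 1: "(\<lambda>k. inverse (1 + k) * (?y \<circ> phi1) k) has_fps_expansion (K_fps oo fps_X\<^sup>2)"
    unfolding K_fps_landen .
  have "(?y \<circ> (\<lambda>k. k\<^sup>2)) has_fps_expansion (K_fps oo fps_X\<^sup>2)"
    by (rule has_fps_expansion_compose[OF y]) (auto intro: fps_expansion_intros)
  with 1 have "\<forall>\<^sub>F k in nhds 0. inverse (1 + k) * ?y (phi1 k) = ?y (k\<^sup>2)"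
    unfolding has_fps_expansion_def by (auto elim: eventually_elim2)
  moreover have "\<forall>\<^sub>F k in nhds 0. (1 :: complex) + k \<noteq> 0"
  proof -
    have "\<forall>\<^sub>F k in nhds 0. k \<in> - {- (1::complex)}"
      by (rule eventually_nhds_in_open) auto
    then show ?thesis by eventually_elim (auto simp: add_eq_0_iff)
  qed
  ultimately show ?thesis by eventually_elim (simp add: field_simps)
qed

lemma landen_square_le:
  assumes "norm w < 1"
  shows "norm ((psi1 w)\<^sup>2) \<le> norm w * norm w"
proof -
  have "norm (psi1 w) \<le> norm w"
    using assms ball_subset_one_cut_plane by (intro norm_psi1_le) auto
  then have "norm (psi1 w) * norm (psi1 w) \<le> norm w * norm w" by (intro mult_mono) auto
  then show ?thesis by (simp add: norm_power power2_eq_square norm_mult)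
qed

text \<open>Series and product obey the same Landen relation, so their quotient \<open>R\<close> is
  unchanged by the step near 0. The iterates tend to 0, hence \<open>R\<close> equals
  \<open>R 0 = 1\<close> there, and the identity theorem extends this to the disc.\<close>

lemma K_series_eq:
  assumes w: "norm w < 1"
  shows "eval_fps K_fps w = K_factor w"
proof -
  let ?y = "eval_fps K_fps"
  obtain d where d: "d > 0" "\<And>k. norm k < d \<Longrightarrow> ?y (phi1 k) = (1 + k) * ?y (k\<^sup>2)"
    using K_series_landen unfolding eventually_nhds_metric by auto
  \<comment> \<open>\<open>e \<le> d\<close> keeps the moduli where the relation is known;
    \<open>e \<le> 1 / 2\<close> makes each step at least halve the norm.\<close>
  define e where "e = min d (1 / 2)"
  have e: "e > 0" "e \<le> d" "e \<le> 1 / 2" using d by (auto simp: e_def)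
  define R where "R = (\<lambda>w. ?y w / K_factor w)"
  have R_hol: "R holomorphic_on ball 0 1"
    unfolding R_def using K_factor_nonzero ball_subset_one_cut_plane
    by (intro holomorphic_intros holomorphic_K_series holomorphic_on_subset[OF holomorphic_K_factor]) auto
  have R_step: "R ((psi1 w)\<^sup>2) = R w" if "norm w < e" for w
  proof -
    have cut: "w \<in> one_cut_plane" using that e ball_subset_one_cut_plane by force
    have n: "norm (psi1 w) < d" "psi1 w \<noteq> - 1"
      using norm_psi1_le[OF cut] norm_psi1_less_1[OF cut] that e by auto
    have "?y w = (1 + psi1 w) * ?y ((psi1 w)\<^sup>2)" using d(2)[OF n(1)] phi1_psi1[OF cut] by simp
    moreover have "1 + psi1 w \<noteq> 0" using n by (simp add: add_eq_0_iff)
    ultimately show ?thesis unfolding R_def K_factor_landen[OF cut] by simp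
  qed
  have R1: "R z = 1" if z: "norm z < e" for z
  proof -
    define u where "u = rec_nat z (\<lambda>_ v. (psi1 v)\<^sup>2)"
    have u: "norm (u n) \<le> e * (1 / 2) ^ n \<and> norm (u n) < e \<and> R (u n) = R z" for n
    proof (induction n)
      case 0
      then show ?case using z by (simp add: u_def)
    next
      case (Suc n)
      have un: "norm (u n) < 1" using Suc e by simp
      have "norm (u (Suc n)) \<le> norm (u n) * norm (u n)"
        using landen_square_le[OF un] by (simp add: u_def)
      also have "\<dots> \<le> 1 / 2 * norm (u n)" using Suc e by (intro mult_right_mono) auto
      finally have "norm (u (Suc n)) \<le> 1 / 2 * norm (u n)" .
      moreover have "1 / 2 * norm (u n) \<le> 1 / 2 * (e * (1 / 2) ^ n)" using Suc by (intro mult_left_mono) auto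
      moreover have "e * (1 / 2) ^ Suc n = 1 / 2 * (e * (1 / 2) ^ n)" by simp
      moreover have "norm (u n) < e" using Suc by blast
      ultimately have "norm (u (Suc n)) \<le> e * (1 / 2) ^ Suc n" "norm (u (Suc n)) < e"
        using norm_ge_zero[of "u n"] by linarith+
      moreover have "R (u (Suc n)) = R z" using R_step[of "u n"] Suc by (simp add: u_def)
      ultimately show ?case by blast
    qed
    have "(\<lambda>n. e * (1 / 2) ^ n) \<longlonglongrightarrow> e * 0" by (intro tendsto_intros LIMSEQ_power_zero) auto
    then have "u \<longlonglongrightarrow> 0" using u by (intro Lim_null_comparison[of u "\<lambda>n. e * (1 / 2) ^ n"]) auto
    moreover have "isCont R 0"
      using holomorphic_on_imp_continuous_on[OF R_hol] by (simp add: continuous_on_eq_continuous_at)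
    ultimately have "(\<lambda>n. R (u n)) \<longlonglongrightarrow> R 0" using isCont_tendsto_compose by blast
    then have "R z = R 0" using u by (simp add: LIMSEQ_const_iff)
    then show ?thesis by (simp add: R_def K_factor_0 eval_fps_at_0)
  qed
  have "R w = 1"
    by (rule analytic_continuation_open[of "ball 0 e" "ball 0 1" R "\<lambda>_. 1"])
       (use e w R1 R_hol in auto)
  then show ?thesis using K_factor_nonzero[of w] by (simp add: R_def)
qed

text \<open>\<open>K_factor\<close> witnesses the choice in the definition of
  \<open>gauss_2F1\<close>, and the identity theorem on the connected cut plane makes the choice
  unique there.\<close>

lemma gauss_2F1_eq:
  assumes "m \<in> one_cut_plane"
  shows "gauss_2F1 (1/2) (1/2) 1 m = K_factor m"
proof -
  let ?P = "\<lambda>F. F holomorphic_on one_cut_plane \<and> (\<forall>m\<in>ball 0 1. F m = eval_fps K_fps m)"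
  have eq: "K_factor m = eval_fps K_fps m" if "m \<in> ball 0 1" for m
    using K_series_eq[of m] that by simp
  then have "?P K_factor" using holomorphic_K_factor by blast
  then have P: "?P (gauss_2F1 (1/2) (1/2) 1)" unfolding gauss_2F1_def by (rule someI[of ?P])
  show ?thesis
  proof (rule analytic_continuation_open[of "ball 0 1" one_cut_plane "gauss_2F1 (1/2) (1/2) 1" K_factor])
    show "gauss_2F1 (1/2) (1/2) 1 z = K_factor z" if "z \<in> ball 0 1" for z
      using P eq[OF that] that by simp
  qed (use P holomorphic_K_factor assms open_one_cut_plane connected_one_cut_plane
         ball_subset_one_cut_plane in simp_all)
qed

lemma ellK_eq: "m \<in> one_cut_plane \<Longrightarrow> ellK m = of_real (pi / 2) * K_factor m"
  by (simp add: ellK_def gauss_2F1_eq)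

text \<open>\<open>1 / ((2 * n + 1) * K_coeff n)\<close> is the \<open>n\<close>-th partial Wallis
  product.\<close>

lemma K_coeff_wallis: "(\<lambda>n. (real n + 1 / 2) * K_coeff n) \<longlonglongrightarrow> 1 / pi"
proof -
  have eq: "inverse (2 * (real n + 1 / 2) * K_coeff n) = (\<Prod>k=1..n. (4*real k^2) / (4*real k^2 - 1))" for n
  proof (induction n)
    case (Suc n)
    have "4 * (real (Suc n))\<^sup>2 - 1 = (2 * real n + 1) * (2 * real n + 3)"
      by (simp add: power2_eq_square algebra_simps)
    then have "(\<Prod>k=1..Suc n. (4*real k^2) / (4*real k^2 - 1)) =
        inverse (2 * (real n + 1 / 2) * K_coeff n) * (4 * (real n + 1)\<^sup>2 / ((2 * real n + 1) * (2 * real n + 3)))"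
      using Suc by (simp add: add.commute)
    also have "\<dots> = inverse (2 * (real (Suc n) + 1 / 2) * K_coeff (Suc n))"
      unfolding K_coeff_Suc by (simp add: power_divide divide_simps) (simp add: power2_eq_square algebra_simps)
    finally show ?case by simp
  qed (simp add: K_coeff_0)
  have "(\<lambda>n. inverse (2 * (real n + 1 / 2) * K_coeff n)) \<longlonglongrightarrow> pi / 2" unfolding eq by (rule wallis)
  then have "(\<lambda>n. inverse (inverse (2 * (real n + 1 / 2) * K_coeff n)) / 2) \<longlonglongrightarrow> inverse (pi / 2) / 2"
    by (intro tendsto_intros) auto
  moreover have "inverse (inverse (2 * a * c)) / 2 = a * c" for a c :: real by (subst inverse_inverse_eq) simp
  ultimately show ?thesis by (simp only:) simp
qed

text \<open>\<open>(n + 1 / 2) * K_coeff n\<close> decreases and \<open>n * K_coeff n\<close>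
  increases to the same limit \<open>1 / pi\<close>. So \<open>pi * K_coeff n\<close> lies between
  \<open>1 / (n + 1 / 2)\<close> and \<open>1 / n\<close>.\<close>

lemma K_coeff_bounds:
  assumes "n > 0"
  shows "\<bar>pi * K_coeff n - 1 / real n\<bar> \<le> 1 / (real n)\<^sup>2"
proof -
  have lower: "1 / pi \<le> (real n + 1 / 2) * K_coeff n"
  proof (rule decseq_ge[OF _ K_coeff_wallis])
    show "decseq (\<lambda>n. (real n + 1 / 2) * K_coeff n)"
    proof (rule decseq_SucI)
      fix n
      have "(real (Suc n) + 1 / 2) * ((real n + 1 / 2) / (real n + 1))\<^sup>2 \<le> real n + 1 / 2"
        by (simp add: power_divide divide_simps) (simp add: power2_eq_square algebra_simps)
      from mult_right_mono[OF this K_coeff_nonneg[of n]]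
      show "(real (Suc n) + 1 / 2) * K_coeff (Suc n) \<le> (real n + 1 / 2) * K_coeff n"
        unfolding K_coeff_Suc by (simp add: mult.assoc)
    qed
  qed
  have upper: "real n * K_coeff n \<le> 1 / pi"
  proof (rule incseq_le)
    show "incseq (\<lambda>n. real n * K_coeff n)"
    proof (rule incseq_SucI)
      fix n
      have "real n \<le> real (Suc n) * ((real n + 1 / 2) / (real n + 1))\<^sup>2"
        by (simp add: power_divide divide_simps) (simp add: power2_eq_square algebra_simps)
      from mult_right_mono[OF this K_coeff_nonneg[of n]]
      show "real n * K_coeff n \<le> real (Suc n) * K_coeff (Suc n)"
        unfolding K_coeff_Suc by (simp add: mult.assoc)
    qed
    have "(\<lambda>n. (real n / (real n + 1 / 2)) * ((real n + 1 / 2) * K_coeff n)) \<longlonglongrightarrow> 1 * (1 / pi)"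
    proof (intro tendsto_mult K_coeff_wallis)
      show "(\<lambda>n. real n / (real n + 1 / 2)) \<longlonglongrightarrow> 1" by real_asymp
    qed
    moreover have "(real n / (real n + 1 / 2)) * ((real n + 1 / 2) * K_coeff n) = real n * K_coeff n" for n
      by (simp add: field_simps add_nonneg_eq_0_iff)
    ultimately show "(\<lambda>n. real n * K_coeff n) \<longlonglongrightarrow> 1 / pi" by simp
  qed
  have n: "real n > 0" using assms by simp
  have "pi * K_coeff n \<le> 1 / real n" using upper n by (simp add: field_simps)
  moreover have "1 / (real n + 1 / 2) \<le> pi * K_coeff n"
  proof -
    have "1 \<le> pi * K_coeff n * (real n + 1 / 2)" using lower by (simp add: field_simps)
    then show ?thesis using n by (subst pos_divide_le_eq) auto
  qed
  moreover have "1 / real n - 1 / (real n + 1 / 2) \<le> 1 / (real n)\<^sup>2"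
    using n by (simp add: divide_simps) (simp add: power2_eq_square algebra_simps)
  ultimately show ?thesis by linarith
qed

definition K_real :: "real \<Rightarrow> real" where
  "K_real x = (\<Sum>n. K_coeff n * x ^ n)"

lemma summable_K_real:
  assumes "0 \<le> x" "x < 1"
  shows "summable (\<lambda>n. K_coeff n * x ^ n)"
  by (rule summable_comparison_test'[of "\<lambda>n. x ^ n" 0])
     (use assms K_coeff_le_1 K_coeff_nonneg in \<open>auto simp: abs_mult intro!: mult_left_le_one_le summable_geometric\<close>)

lemma K_factor_of_real:
  assumes "0 \<le> x" "x < 1"
  shows "K_factor (of_real x) = of_real (K_real x)"
proof -
  have "K_factor (of_real x) = (\<Sum>n. of_real (K_coeff n * x ^ n))"
    using K_series_eq[of "of_real x"] assms by (simp add: eval_fps_def K_fps_nth del: fps_hypergeo_nth)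
  also have "\<dots> = of_real (K_real x)"
    unfolding K_real_def by (rule suminf_of_real[symmetric, OF summable_K_real[OF assms]])
  finally show ?thesis .
qed

text \<open>Subtracting the series of \<open>- ln (1 - x)\<close> term by term leaves coefficients
  bounded by \<open>1 / n ^ 2\<close>. This is the logarithmic singularity of the elliptic integral
  at 1.\<close>

lemma K_real_log_bound:
  "\<exists>C. \<forall>x. 0 \<le> x \<longrightarrow> x < 1 \<longrightarrow> \<bar>pi * K_real x + ln (1 - x)\<bar> \<le> C"
proof -
  \<comment> \<open>At \<open>n = 0\<close> the value of \<open>1 / real n\<close> is 0, so the
    coefficient there is \<open>pi * K_coeff 0 = pi\<close>.\<close>
  define b where "b = (\<lambda>n. if n = 0 then pi else 1 / (real n)\<^sup>2)"
  have b: "summable b"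
  proof -
    have "summable (\<lambda>n. inverse (real n ^ 2))" by (rule inverse_power_summable) simp
    moreover have "\<forall>\<^sub>F n in sequentially. b n = inverse (real n ^ 2)"
      using eventually_gt_at_top[of 0] by eventually_elim (simp add: b_def divide_inverse)
    ultimately show ?thesis by (simp only: summable_cong)
  qed
  show ?thesis
  proof (intro exI allI impI)
    fix x :: real assume x: "0 \<le> x" "x < 1"
    have "(\<lambda>n. - ((- (- x)) ^ n) / of_nat n) sums ln (1 + (- x))"
      using x by (intro ln_series') auto
    then have "(\<lambda>n. pi * (K_coeff n * x ^ n) + - (x ^ n) / of_nat n) sums (pi * K_real x + ln (1 - x))"
      unfolding K_real_def using x by (intro sums_add sums_mult summable_sums summable_K_real) auto
    then have s: "(\<lambda>n. (pi * K_coeff n - 1 / real n) * x ^ n) sums (pi * K_real x + ln (1 - x))"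
      by (simp add: algebra_simps)
    have le: "norm ((pi * K_coeff n - 1 / real n) * x ^ n) \<le> b n" for n
    proof -
      have "\<bar>pi * K_coeff n - 1 / real n\<bar> \<le> b n"
        using K_coeff_bounds[of n] by (auto simp: b_def K_coeff_0)
      moreover have "x ^ n \<le> 1" using x by (intro power_le_one) auto
      ultimately have "\<bar>pi * K_coeff n - 1 / real n\<bar> * x ^ n \<le> b n * 1" using x by (intro mult_mono) auto
      then show ?thesis using x by (simp add: abs_mult)
    qed
    have "norm (\<Sum>n. (pi * K_coeff n - 1 / real n) * x ^ n) \<le> (\<Sum>n. b n)"
      by (rule norm_suminf_le[OF le b])
    then show "\<bar>pi * K_real x + ln (1 - x)\<bar> \<le> (\<Sum>n. b n)" using sums_unique[OF s] by simp
  qed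
qed

subsection \<open>Identification of the limit with the nome\<close>

definition real_psi1 :: "real \<Rightarrow> real" where
  "real_psi1 x = (1 - sqrt (1 - x)) / (1 + sqrt (1 - x))"

lemma psi1_of_real:
  assumes "0 < x" "x < 1"
  shows "psi1 (of_real x) = of_real (real_psi1 x)" "0 < real_psi1 x" "real_psi1 x < 1"
proof -
  have "csqrt (1 - of_real x) = of_real (sqrt (1 - x))"
    using assms csqrt_of_real_nonneg[of "1 - x"] by simp
  then show "psi1 (of_real x) = of_real (real_psi1 x)" by (simp add: psi1_def real_psi1_def)
  define s where "s = sqrt (1 - x)"
  have "0 < s" "s < 1" using assms by (auto simp: s_def)
  then show "0 < real_psi1 x" "real_psi1 x < 1"
    unfolding real_psi1_def s_def[symmetric] by (simp_all add: divide_less_eq)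
qed

text \<open>On the unit interval all Landen moduli are real and between 0 and 1, so all the
  logarithms are real.\<close>

lemma nome_lim_of_real:
  assumes x: "0 < x" "x < 1"
  obtains y where "0 < y" "nome_lim (of_real x) = of_real y"
proof -
  have landen_real: "\<exists>y. 0 < y \<and> y < 1 \<and> landen n (of_real x) = of_real y" for n
  proof (induction n)
    case (Suc n)
    then obtain y where "0 < y" "y < 1" "landen n (of_real x) = of_real y" by blast
    then show ?case using psi1_of_real[of "y\<^sup>2"] by (auto simp: power_less_one_iff)
  qed (use psi1_of_real[OF x] in auto)
  have "Im (nome_term j (of_real x)) = 0" for j
  proof -
    obtain y where y: "0 < y" "y < 1" "landen j (of_real x) = of_real y" using landen_real by blast
    then have "y\<^sup>2 < 1" by (simp add: power_less_one_iff)
    then have "csqrt (1 - (of_real y)\<^sup>2) = of_real (sqrt (1 - y\<^sup>2))"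
      using csqrt_of_real_nonneg[of "1 - y\<^sup>2"] by simp
    then have "1 + csqrt (1 - (of_real y)\<^sup>2) = of_real (1 + sqrt (1 - y\<^sup>2))" by simp
    moreover have "0 < 1 + sqrt (1 - y\<^sup>2)" using \<open>y\<^sup>2 < 1\<close> by (simp add: add_pos_nonneg)
    ultimately show ?thesis unfolding nome_term_def y(3) by (simp add: Ln_of_real del: of_real_add)
  qed
  moreover have cut: "of_real x \<in> one_cut_plane" using x by (simp add: one_cut_plane_iff)
  ultimately have "Im (\<Sum>j. nome_term j (of_real x)) = 0" by (simp add: Im_suminf summable_nome_term)
  then obtain S where S: "(\<Sum>j. nome_term j (of_real x)) = of_real S"
    by (metis complex_is_Real_iff Reals_cases)
  obtain k where k: "0 < k" "psi1 (of_real x) = of_real k" using psi1_of_real[OF x] by blast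
  have "nome_lim (of_real x) = of_real (k * exp (- S))" by (simp add: nome_lim_def S k exp_of_real[symmetric])
  then show ?thesis using that[of "k * exp (- S)"] k by simp
qed

text \<open>The Landen step doubles both \<open>K(1 - x) / K(x)\<close> and \<open>- ln (nome_lim x)\<close>; as \<open>x\<close> tends to \<open>0\<close> their
  quotient, which the step leaves unchanged, is governed by the logarithmic singularity of \<open>K\<close>.\<close>

lemma nome_lim_eq_nome_real:
  assumes x: "0 < x" "x < 1"
  shows "nome_lim (of_real x) = exp (- (of_real pi * K_factor (1 - of_real x) / K_factor (of_real x)))"
proof -
  define qr where "qr = (\<lambda>x. Re (nome_lim (of_real x)))"
  have qr: "0 < qr x" "nome_lim (of_real x) = of_real (qr x)" "qr x < 1" if "0 < x" "x < 1" for x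
  proof -
    obtain y where "0 < y" "nome_lim (of_real x) = of_real y" using nome_lim_of_real[OF \<open>0 < x\<close> \<open>x < 1\<close>] .
    then show *: "0 < qr x" "nome_lim (of_real x) = of_real (qr x)" by (simp_all add: qr_def)
    have "norm (nome_lim (of_real x)) < 1" using that by (intro norm_nome_lim_less_1) (simp add: one_cut_plane_iff)
    then show "qr x < 1" using * by simp
  qed
  define L where "L = (\<lambda>x. pi * K_real (1 - x) / K_real x)"
  define T where "T = (\<lambda>x. (real_psi1 x)\<^sup>2)"
  have \<kappa>: "0 < real_psi1 x" "real_psi1 x < 1" "psi1 (of_real x) = of_real (real_psi1 x)"
    if "0 < x" "x < 1" for x using psi1_of_real[OF that] by auto
  have T: "0 < T x" "T x < 1" "T x \<le> x * x" if "0 < x" "x < 1" for x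
  proof -
    show "0 < T x" "T x < 1" using \<kappa>[OF that] by (auto simp: T_def power_less_one_iff)
    show "T x \<le> x * x" using landen_square_le[of "of_real x"] \<kappa>[OF that] that by (simp add: T_def norm_power)
  qed
  have cut: "of_real x \<in> one_cut_plane" if "x < 1" for x using that by (simp add: one_cut_plane_iff)
  have K_T: "K_real x = (1 + real_psi1 x) * K_real (T x)" if "0 < x" "x < 1" for x
  proof -
    have "of_real (K_real x) = (1 + of_real (real_psi1 x)) * K_factor (of_real (T x))"
      using K_factor_landen[OF cut[OF that(2)]] \<kappa>[OF that] K_factor_of_real[of x] that by (simp add: T_def)
    also have "\<dots> = of_real ((1 + real_psi1 x) * K_real (T x))"
      using K_factor_of_real[of "T x"] T[OF that] by simp
    finally show ?thesis by (simp only: of_real_eq_iff)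
  qed
  \<comment> \<open>The complementary parameters run backwards: the Landen step takes
    \<open>1 - T x\<close> to \<open>1 - x\<close>. The factors \<open>1 + real_psi1 x\<close> and
    \<open>2 / (1 + real_psi1 x)\<close> of the two integrals multiply to 2.\<close>
  have L_T: "L (T x) = 2 * L x" if "0 < x" "x < 1" for x
  proof -
    have k: "0 < real_psi1 x" "real_psi1 x < 1" using \<kappa>[OF that] by auto
    have T': "0 < 1 - T x" "1 - T x < 1" using T[OF that] by auto
    have "real_psi1 (1 - T x) = (1 - real_psi1 x) / (1 + real_psi1 x)" 
      unfolding real_psi1_def[of "1 - T x"] using k by (simp add: T_def)
    moreover have "1 - x = ((1 - real_psi1 x) / (1 + real_psi1 x))\<^sup>2"
    proof -
      have s: "0 < sqrt (1 - x)" "(sqrt (1 - x))\<^sup>2 = 1 - x" using that by auto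
      define r where "r = sqrt (1 - x)"
      have "1 - (1 - r) / (1 + r) = 2 * r / (1 + r)" "1 + (1 - r) / (1 + r) = 2 / (1 + r)" "1 + r \<noteq> 0"
        using s(1) by (auto simp: r_def[symmetric] field_simps)
      then have "(1 - real_psi1 x) / (1 + real_psi1 x) = sqrt (1 - x)"
        unfolding real_psi1_def r_def[symmetric] by simp
      then show ?thesis using s by simp
    qed
    ultimately have T2: "T (1 - T x) = 1 - x" by (simp add: T_def)
    have "K_real (1 - T x) = (1 + (1 - real_psi1 x) / (1 + real_psi1 x)) * K_real (1 - x)"
      using K_T[OF T'] T2 \<open>real_psi1 (1 - T x) = _\<close> by simp
    also have "1 + (1 - real_psi1 x) / (1 + real_psi1 x) = 2 / (1 + real_psi1 x)" using k by (simp add: field_simps)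
    finally have eq: "K_real (1 - T x) = 2 / (1 + real_psi1 x) * K_real (1 - x)" .
    show ?thesis unfolding L_def eq K_T[OF that] by simp
  qed
  have q_T: "ln (qr (T x)) = 2 * ln (qr x)" if "0 < x" "x < 1" for x
  proof -
    have "of_real (qr (T x)) = (of_real ((qr x)\<^sup>2) :: complex)"
      using nome_lim_square[OF cut[OF that(2)]] \<kappa>[OF that] qr[OF that] qr(2)[OF T(1,2)[OF that]]
      by (simp add: T_def)
    then have "qr (T x) = (qr x)\<^sup>2" by (simp only: of_real_eq_iff)
    then show ?thesis using qr(1)[OF that] by (simp add: ln_realpow)
  qed
  \<comment> \<open>Along these iterates, which tend to 0, the quotient of \<open>L\<close> and
    \<open>- ln qr\<close> keeps its value; it remains to find its limit.\<close>
  define u where "u = rec_nat x (\<lambda>_ v. T v)"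
  have u: "0 < u n \<and> u n < 1 \<and> u n \<le> x * x ^ n \<and> L (u n) / (- ln (qr (u n))) = L x / (- ln (qr x))" for n
  proof (induction n)
    case 0
    then show ?case using x by (simp add: u_def)
  next
    case (Suc n)
    then have un: "0 < u n" "u n < 1" by auto
    have "x * x ^ n \<le> x" using x by (intro mult_left_le) (auto intro: power_le_one)
    then have "u n \<le> x" "u n \<le> x * x ^ n" using Suc by auto
    then have "u n * u n \<le> (x * x ^ n) * x" using un x by (intro mult_mono) auto
    then have "u (Suc n) \<le> x * x ^ Suc n" using T(3)[OF un] by (simp add: u_def mult_ac)
    moreover have "L (u (Suc n)) / (- ln (qr (u (Suc n)))) = L (u n) / (- ln (qr (u n)))"
      using L_T[OF un] q_T[OF un] by (simp add: u_def)
    ultimately show ?case using T[OF un] Suc by (simp add: u_def)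
  qed
  have "(\<lambda>n. x * x ^ n) \<longlonglongrightarrow> x * 0" using x by (intro tendsto_intros LIMSEQ_power_zero) auto
  then have u_lim: "u \<longlonglongrightarrow> 0"
    using u by (intro tendsto_sandwich[of "\<lambda>_. 0" u sequentially "\<lambda>n. x * x ^ n"]) (auto intro!: always_eventually less_imp_le)
  have u_nz: "0 < u n" "u n \<noteq> 0" for n using u[of n] by auto
  have u_at: "filterlim u (at_right 0) sequentially"
    using u_lim u_nz by (auto simp: filterlim_at)
  have ln_lim: "filterlim (\<lambda>n. - ln (u n)) at_top sequentially"
    using filterlim_compose[OF ln_at_0 u_at] by (simp add: filterlim_uminus_at_top)
  \<comment> \<open>\<open>K_real_log_bound\<close> near 1: the bounded error disappears after
    division by \<open>- ln (u n)\<close>.\<close>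
  have lim1: "(\<lambda>n. pi * K_real (1 - u n) / (- ln (u n))) \<longlonglongrightarrow> 1"
  proof -
    obtain C where C: "\<And>x. 0 \<le> x \<Longrightarrow> x < 1 \<Longrightarrow> \<bar>pi * K_real x + ln (1 - x)\<bar> \<le> C"
      using K_real_log_bound by blast
    have "(\<lambda>n. C / (- ln (u n))) \<longlonglongrightarrow> 0"
      by (rule tendsto_divide_0[OF tendsto_const filterlim_at_top_imp_at_infinity[OF ln_lim]])
    then have "(\<lambda>n. (pi * K_real (1 - u n) + ln (u n)) / (- ln (u n))) \<longlonglongrightarrow> 0"
    proof (rule Lim_null_comparison[rotated], intro always_eventually allI)
      fix n
      have "ln (u n) < 0" using u[of n] by simp
      then show "norm ((pi * K_real (1 - u n) + ln (u n)) / (- ln (u n))) \<le> C / (- ln (u n))"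
        using C[of "1 - u n"] u[of n] by (simp add: abs_divide divide_right_mono_neg)
    qed
    then have "(\<lambda>n. (pi * K_real (1 - u n) + ln (u n)) / (- ln (u n)) + 1) \<longlonglongrightarrow> 0 + 1"
      by (intro tendsto_intros)
    moreover have "(pi * K_real (1 - u n) + ln (u n)) / (- ln (u n)) + 1 = pi * K_real (1 - u n) / (- ln (u n))" for n
    proof -
      have "ln (u n) < 0" using u[of n] by simp
      then show ?thesis by (simp add: field_simps)
    qed
    ultimately show ?thesis by simp
  qed
  have u_c: "(\<lambda>n. complex_of_real (u n)) \<longlonglongrightarrow> 0" using tendsto_of_real[OF u_lim] by simp
  have lim2: "(\<lambda>n. K_real (u n)) \<longlonglongrightarrow> 1"
  proof -
    have "isCont K_factor 0"
      using holomorphic_on_imp_continuous_on[OF holomorphic_K_factor] open_one_cut_plane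
      by (simp add: continuous_on_eq_continuous_at)
    then have "(\<lambda>n. Re (K_factor (of_real (u n)))) \<longlonglongrightarrow> Re (K_factor 0)"
      using u_c isCont_tendsto_compose by (intro tendsto_Re) blast
    moreover have "Re (K_factor (of_real (u n))) = K_real (u n)" for n
      using K_factor_of_real[of "u n"] u[of n] by simp
    ultimately show ?thesis by (simp add: K_factor_0)
  qed
  \<comment> \<open>\<open>qr (u n) / u n\<close> converges to a positive number, so its logarithm
    is negligible against \<open>ln (u n)\<close>.\<close>
  have lim3: "(\<lambda>n. ln (qr (u n)) / ln (u n)) \<longlonglongrightarrow> 1"
  proof -
    have "((\<lambda>w. norm (nome_lim w / w)) \<longlongrightarrow> norm (deriv nome_lim 0)) (at 0)"
      using deriv_nome_lim_0(1) by (auto simp: has_field_derivative_iff intro: tendsto_norm)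
    moreover have "filterlim (\<lambda>n. complex_of_real (u n)) (at 0) sequentially"
      using u_c u_nz by (auto simp: filterlim_at)
    ultimately have "(\<lambda>n. norm (nome_lim (of_real (u n)) / of_real (u n))) \<longlonglongrightarrow> norm (deriv nome_lim 0)"
      by (rule filterlim_compose)
    moreover have "norm (nome_lim (of_real (u n)) / of_real (u n)) = qr (u n) / u n" for n
      using qr[of "u n"] u[of n] by (simp add: norm_divide)
    ultimately have "(\<lambda>n. qr (u n) / u n) \<longlonglongrightarrow> norm (deriv nome_lim 0)" by simp
    then have "(\<lambda>n. ln (qr (u n) / u n)) \<longlonglongrightarrow> ln (norm (deriv nome_lim 0))"
      using deriv_nome_lim_0(2) by (intro tendsto_ln) auto
    then have "(\<lambda>n. ln (qr (u n) / u n) / (- ln (u n))) \<longlonglongrightarrow> 0"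
      by (rule tendsto_divide_0[OF _ filterlim_at_top_imp_at_infinity[OF ln_lim]])
    then have "(\<lambda>n. 1 - ln (qr (u n) / u n) / (- ln (u n))) \<longlonglongrightarrow> 1 - 0"
      by (intro tendsto_intros)
    moreover have "1 - ln (qr (u n) / u n) / (- ln (u n)) = ln (qr (u n)) / ln (u n)" for n
    proof -
      have "ln (u n) < 0" using u[of n] by simp
      then show ?thesis using qr[of "u n"] u[of n] by (simp add: ln_div field_simps)
    qed
    ultimately show ?thesis by simp
  qed
  have "(\<lambda>n. pi * K_real (1 - u n) / (- ln (u n)) / K_real (u n) / (ln (qr (u n)) / ln (u n))) \<longlonglongrightarrow> 1 / 1 / 1"
    by (intro tendsto_divide lim1 lim2 lim3) auto
  moreover have "pi * K_real (1 - u n) / (- ln (u n)) / K_real (u n) / (ln (qr (u n)) / ln (u n)) = L x / (- ln (qr x))" for n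
  proof -
    have "ln (u n) < 0" "ln (qr (u n)) < 0" using u[of n] qr[of "u n"] by simp_all
    then have "pi * K_real (1 - u n) / (- ln (u n)) / K_real (u n) / (ln (qr (u n)) / ln (u n)) = L (u n) / (- ln (qr (u n)))"
      by (simp add: L_def)
    then show ?thesis using u[of n] by simp
  qed
  ultimately have "L x / (- ln (qr x)) = 1" by (simp add: LIMSEQ_const_iff)
  moreover have "ln (qr x) < 0" using qr[OF x] by simp
  ultimately have "L x = - ln (qr x)" by (simp add: field_simps)
  then have "exp (- L x) = qr x" using qr[OF x] by simp
  then have "nome_lim (of_real x) = exp (- of_real (L x))" using qr(2)[OF x] exp_of_real[of "- L x", where 'a = complex] by simp
  moreover have "complex_of_real (L x) = of_real pi * K_factor (1 - of_real x) / K_factor (of_real x)"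
    using K_factor_of_real[of x] K_factor_of_real[of "1 - x"] x by (simp add: L_def)
  ultimately show ?thesis by simp
qed

section \<open>From the unit interval to the cut planes\<close>

lemma two_cut_plane_iff: "w \<in> two_cut_plane \<longleftrightarrow> Im w \<noteq> 0 \<or> (0 < Re w \<and> Re w < 1)"
  by (auto simp: two_cut_plane_def complex_eq_iff image_iff not_le)

lemma two_cut_plane_subset:
  "two_cut_plane \<subseteq> one_cut_plane" "w \<in> two_cut_plane \<Longrightarrow> 1 - w \<in> one_cut_plane"
  by (auto simp: two_cut_plane_iff one_cut_plane_iff)

lemma open_two_cut_plane: "open two_cut_plane"
proof -
  have eq: "two_cut_plane = one_cut_plane \<inter> (\<lambda>w. 1 - w) -` one_cut_plane"
    by (auto simp: two_cut_plane_iff one_cut_plane_iff)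
  have "open ((\<lambda>w. 1 - w) -` one_cut_plane)"
    by (rule open_vimage[OF open_one_cut_plane]) (intro continuous_intros)
  then show ?thesis unfolding eq by (rule open_Int[OF open_one_cut_plane])
qed

lemma connected_two_cut_plane: "connected two_cut_plane"
proof -
  have "starlike two_cut_plane"
    unfolding starlike_def
  proof (intro bexI ballI subsetI)
    fix w z assume w: "w \<in> two_cut_plane" and "z \<in> closed_segment (1 / 2) w"
    then obtain t where t: "0 \<le> t" "t \<le> 1" "z = (1 - t) *\<^sub>R (1 / 2) + t *\<^sub>R w"
      by (auto simp: in_segment)
    have z: "Im z = t * Im w" "Re z = (1 - t) / 2 + t * Re w" using t by simp_all
    show "z \<in> two_cut_plane"
    proof (cases "t = 0 \<or> Im w = 0")
      case True
      have "0 < Re z \<and> Re z < 1"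
      proof (cases "t = 0")
        case False
        then have "0 < Re w" "Re w < 1" "t > 0" using True w t by (auto simp: two_cut_plane_iff)
        then have "0 < t * Re w" "t * Re w < t * 1" by (auto intro: mult_strict_left_mono)
        then show ?thesis unfolding z using t by (simp add: field_simps)
      qed (use z in simp)
      then show ?thesis by (simp add: two_cut_plane_iff)
    next
      case False
      then show ?thesis using z by (simp add: two_cut_plane_iff)
    qed
  qed (simp add: two_cut_plane_iff)
  then show ?thesis by (rule starlike_imp_connected)
qed

text \<open>Both sides are holomorphic on the connected two-cut plane and agree on the interval from
  0 to 1, which accumulates at \<open>1 / 2\<close>.\<close>

lemma nome_lim_eq_nome_two_cut:
  assumes w: "w \<in> two_cut_plane"
  shows "exp (- (of_real pi * ellK (1 - w) / ellK w)) = nome_lim w"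
proof -
  define N where "N = (\<lambda>w. exp (- (of_real pi * K_factor (1 - w) / K_factor w)))"
  have hol: "(\<lambda>w. N w - nome_lim w) holomorphic_on two_cut_plane"
  proof -
    have "(K_factor \<circ> (\<lambda>w. 1 - w)) holomorphic_on two_cut_plane"
      by (rule holomorphic_on_compose_gen[OF _ holomorphic_K_factor])
         (use two_cut_plane_subset in \<open>auto intro!: holomorphic_intros\<close>)
    then show ?thesis
      unfolding N_def using K_factor_nonzero
      by (intro holomorphic_intros holomorphic_on_subset[OF holomorphic_K_factor two_cut_plane_subset(1)]
          holomorphic_on_subset[OF holomorphic_nome_lim two_cut_plane_subset(1)]) (auto simp: o_def)
  qed
  have "N w - nome_lim w = 0"
  proof (rule analytic_continuation[OF hol open_two_cut_plane connected_two_cut_plane])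
    show "of_real ` {0<..<1} \<subseteq> two_cut_plane" by (auto simp: two_cut_plane_iff)
    show "1 / 2 \<in> two_cut_plane" by (simp add: two_cut_plane_iff)
    show "1 / 2 islimpt complex_of_real ` {0<..<1}"
      unfolding islimpt_approachable
    proof (intro allI impI)
      fix e :: real assume e: "e > 0"
      define t where "t = 1 / 2 + min e (1 / 2) / 2"
      have t: "0 < t" "t < 1" "t \<noteq> 1 / 2" "\<bar>t - 1 / 2\<bar> < e" using e by (auto simp: t_def)
      have "complex_of_real t \<noteq> 1 / 2" using t(3) by (metis of_real_1 of_real_divide of_real_eq_iff of_real_numeral)
      moreover have "dist (complex_of_real t) (1 / 2) < e"
        using t(4) by (metis dist_of_real dist_real_def of_real_1 of_real_divide of_real_numeral)
      ultimately show "\<exists>x'\<in>complex_of_real ` {0<..<1}. x' \<noteq> 1 / 2 \<and> dist x' (1 / 2) < e" using t by auto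
    qed
    show "N z - nome_lim z = 0" if "z \<in> complex_of_real ` {0<..<1}" for z
      using that nome_lim_eq_nome_real by (auto simp: N_def)
  qed fact
  moreover have "of_real pi * ellK (1 - w) / ellK w = of_real pi * K_factor (1 - w) / K_factor w"
  proof -
    have "w \<in> one_cut_plane" "1 - w \<in> one_cut_plane" using two_cut_plane_subset w by auto
    then show ?thesis using K_factor_nonzero[of w] by (simp add: ellK_eq)
  qed
  ultimately show ?thesis by (simp only: N_def right_minus_eq)
qed

text \<open>On the half-line up to 0 the nome is a limit, and \<open>nome_lim\<close> is continuous
  there. The points of the half-line are approached vertically from within the two-cut plane, so the
  limit is unique.\<close>

lemma nome_eq_nome_lim:
  assumes w: "w \<in> one_cut_plane"
  shows "nome w = nome_lim w"
proof (cases "w \<in> two_cut_plane")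
  case True
  then show ?thesis by (simp add: nome_def nome_lim_eq_nome_two_cut Let_def)
next
  case False
  let ?q = "\<lambda>w. exp (- (of_real pi * ellK (1 - w) / ellK w))"
  have "isCont nome_lim w"
    using holomorphic_on_imp_continuous_on[OF holomorphic_nome_lim] open_one_cut_plane w
    by (simp add: continuous_on_eq_continuous_at)
  then have "(nome_lim \<longlongrightarrow> nome_lim w) (at w within two_cut_plane)"
    unfolding isCont_def by (rule tendsto_within_subset[OF _ subset_UNIV])
  then have "(?q \<longlongrightarrow> nome_lim w) (at w within two_cut_plane)"
    by (rule Lim_transform_eventually)
       (auto simp: eventually_at_filter nome_lim_eq_nome_two_cut)
  moreover have "w islimpt two_cut_plane"
    unfolding islimpt_approachable
  proof (intro allI impI)
    fix e :: real assume e: "e > 0"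
    have im: "Im w = 0" using False by (simp add: two_cut_plane_iff)
    show "\<exists>x'\<in>two_cut_plane. x' \<noteq> w \<and> dist x' w < e"
      by (rule bexI[of _ "w + \<i> * of_real (e / 2)"])
         (use e im in \<open>auto simp: two_cut_plane_iff dist_norm norm_mult\<close>)
  qed
  ultimately have "Lim (at w within two_cut_plane) ?q = nome_lim w"
    by (intro tendsto_Lim) (auto simp: trivial_limit_within)
  then show ?thesis using False by (simp add: nome_def Let_def)
qed

theorem theorem17:
  shows "(\<forall>C. compact C \<and> C \<subseteq> one_cut_plane \<longrightarrow>
            uniform_limit C psi_comp nome sequentially) \<and>
         (\<exists>Psi. omega_uniformization Psi \<and>
            (\<forall>w\<in>one_cut_plane. Psi (omega_first_sheet w) = nome w))"
proof (intro conjI allI impI)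
  fix C assume C: "compact C \<and> C \<subseteq> one_cut_plane"
  then have "uniform_limit C psi_comp nome_lim sequentially"
    using uniform_limit_psi_comp uniform_limit_on_subset by blast
  then show "uniform_limit C psi_comp nome sequentially"
    by (rule uniform_limit_cong'[THEN iffD1, rotated -1]) (use C in \<open>auto simp: nome_eq_nome_lim\<close>)
next
  show "\<exists>Psi. omega_uniformization Psi \<and> (\<forall>w\<in>one_cut_plane. Psi (omega_first_sheet w) = nome w)"
    using omega_uniformization_Psi
    by (auto simp: first_sheet_eq_Phi_nome_lim Psi_Phi norm_nome_lim_less_1 nome_eq_nome_lim intro!: exI[of _ Psi])
qed

end
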